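(* Let $d\ge1$, $S\in\tfrac12\mathbb{N}$, $u\in[0,1]$, $\beta>0$, $L$ even, $\Lambda=\{-\tfrac12L,\dots,\tfrac12L\}^d$, $\mathcal{E}_\Lambda$ the nearest-neighbour pairs in $\Lambda$, $\mathbf{h}=(h_x)_{x\in\Lambda}\in[0,\infty)^\Lambda$, and \[ H_{\Lambda,\mathbf{h}}=-\sum_{xy\in\mathcal{E}_\Lambda}\bigl(uT_{xy}+(1-u)Q_{xy}-1\bigr)-\sum_{x\in\Lambda}h_xS^3_x \] on $\bigotimes_{x\in\Lambda}\mathbb{C}^{2S+1}$, with $Z(\beta,\Lambda,\mathbf{h})=\operatorname{Tr}e^{-\beta H_{\Lambda,\mathbf{h}}}$ and $\langle M\rangle_{\Lambda,\mathbf{h}}=\operatorname{Tr}(Me^{-\beta H_{\Lambda,\mathbf{h}}})/Z(\beta,\Lambda,\mathbf{h})$. Then, with the random loop model defined in the context, and for $x\in\Lambda$, $x\neq0$: (a) $Z(\beta,\Lambda,\mathbf{h})=\int\rho(d\omega)\prod_{\gamma\in\mathcal{L}(\omega)}z_{\mathbf{h}}(\gamma)$; (b) $\langle S^1_0S^1_x\rangle_{\Lambda,\mathbf{h}}=\frac{1}{Z(\beta,\Lambda,\mathbf{h})}\int\rho(d\omega)\,1_{0\leftrightarrow x}(\omega)\,\tilde z_{\mathbf{h}}(\gamma_{0,x})\prod_{\gamma\in\mathcal{L}(\omega)\setminus\{\gamma_{0,x}\}}z_{\mathbf{h}}(\gamma)$.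
   Context: Spin operators: $|a\rangle$, $a=-S,\dots,S$, eigenbasis of $S^3$ with $S^3|a\rangle=a|a\rangle$; $S^1$ the standard spin-$S$ operator ($\langle a|S^1|b\rangle=\tfrac12\sqrt{S(S+1)-ab}$ if $a=b\pm1$, else $0$); $T_{xy}|a\rangle_x\otimes|b\rangle_y=|b\rangle_x\otimes|a\rangle_y$; $\langle a|_x\otimes\langle b|_yQ_{xy}|c\rangle_x\otimes|d\rangle_y=\delta_{a,b}\delta_{c,d}$. Random loops: regard $[0,\beta)$ as a circle of length $\beta$. Let $\rho$ be the joint law of two independent Poisson point processes on $\mathcal{E}_\Lambda\times[0,\beta)$ (with respect to counting measure times Lebesgue measure): a process of "crosses" of intensity $u$ and a process of "double bars" of intensity $1-u$; a realization is $\omega$. A bridge (cross or bar) at $(xy,t)$ joins the points $(x,t)$ and $(y,t)$. The realization $\omega$ decomposes $\Lambda\times[0,\beta)$ into disjoint loops, forming the collection $\mathcal{L}(\omega)$: starting at a point $(x,t)$ one moves vertically (in time, say upwards) until hitting an endpoint of a bridge, then jumps to the other endpoint of that bridge and continues in the same time direction if it was a cross, or in the reversed time direction if it was a double bar; the loop is complete upon returning to the start. For a loop $\gamma$ and $y\in\Lambda$, $\ell_y(\gamma)$ is the length (Lebesgue measure) of $\gamma\cap(\{y\}\times[0,\beta))$. $1_{0\leftrightarrow x}(\omega)$ is the indicator that $(0,0)$ and $(x,0)$ lie in the same loop, denoted $\gamma_{0,x}$. On this event, $\ell^+_y(\gamma_{0,x})$ is the vertical length at $y$ of the part of $\gamma_{0,x}$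 traversed starting at $(0,0)$ in the upward direction until the first visit to $(x,0)$, and $\ell^-_y(\gamma_{0,x})$ the vertical length at $y$ of the other part (from $(0,0)$ downwards to $(x,0)$), so $\ell_y=\ell^+_y+\ell^-_y$. Activities (sums over $a$ in steps of $1$): \[ z_{\mathbf{h}}(\gamma)=\sum_{a=-S}^{S}\exp\Bigl(a\sum_yh_y\ell_y(\gamma)\Bigr), \] \[ \tilde z_{\mathbf{h}}(\gamma_{0,x})=\tfrac14\sum_{a=-S}^{S-1}\bigl(S(S+1)-a(a+1)\bigr)\Bigl[e^{(a+1)\sum_yh_y\ell^+_y(\gamma_{0,x})+a\sum_yh_y\ell^-_y(\gamma_{0,x})}+e^{a\sum_yh_y\ell^+_y(\gamma_{0,x})+(a+1)\sum_yh_y\ell^-_y(\gamma_{0,x})}\Bigr]. \] *)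

theory Defs
  imports "HOL-Analysis.Analysis"
begin

type_synonym site = "nat \<Rightarrow> int"

definition lattice :: "nat \<Rightarrow> nat \<Rightarrow> site set" where
  "lattice d L = {x. (\<forall>i<d. \<bar>x i\<bar> \<le> int L div 2) \<and> (\<forall>i. d \<le> i \<longrightarrow> x i = 0)}"

definition origin :: site where "origin = (\<lambda>_. 0)"

text \<open>Nearest-neighbour pairs, each unordered pair {x,y} listed once as (x, x + e_i).\<close>
definition nn_edges :: "nat \<Rightarrow> nat \<Rightarrow> (site \<times> site) set" where
  "nn_edges d L = {(x, y). x \<in> lattice d L \<and> y \<in> lattice d L \<and> (\<exists>i<d. y = x(i := x i + 1))}"

text \<open>Spin S = twoS/2; basis index k in {0..twoS} stands for the S^3 eigenvalue a = k - S.\<close>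
type_synonym cfg = "site \<Rightarrow> nat"
type_synonym op = "cfg \<Rightarrow> cfg \<Rightarrow> complex"

definition spinval :: "nat \<Rightarrow> nat \<Rightarrow> real" where
  "spinval twoS k = real k - real twoS / 2"

definition configs :: "site set \<Rightarrow> nat \<Rightarrow> cfg set" where
  "configs Lam twoS = Lam \<rightarrow>\<^sub>E {..twoS}"

definition op_id :: op where
  "op_id = (\<lambda>\<sigma> \<tau>. if \<sigma> = \<tau> then 1 else 0)"

definition op_mult :: "cfg set \<Rightarrow> op \<Rightarrow> op \<Rightarrow> op" where
  "op_mult C A B = (\<lambda>\<sigma> \<tau>. \<Sum>\<rho>\<in>C. A \<sigma> \<rho> * B \<rho> \<tau>)"

definition op_pow :: "cfg set \<Rightarrow> op \<Rightarrow> nat \<Rightarrow> op" where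
  "op_pow C A n = (op_mult C A ^^ n) op_id"

definition op_exp :: "cfg set \<Rightarrow> op \<Rightarrow> op" where
  "op_exp C A = (\<lambda>\<sigma> \<tau>. \<Sum>n. op_pow C A n \<sigma> \<tau> / of_nat (fact n))"

definition op_trace :: "cfg set \<Rightarrow> op \<Rightarrow> complex" where
  "op_trace C A = (\<Sum>\<sigma>\<in>C. A \<sigma> \<sigma>)"

definition S3 :: "nat \<Rightarrow> site \<Rightarrow> op" where
  "S3 twoS x = (\<lambda>\<sigma> \<tau>. if \<sigma> = \<tau> then complex_of_real (spinval twoS (\<sigma> x)) else 0)"

definition S1 :: "nat \<Rightarrow> site \<Rightarrow> op" where
  "S1 twoS x = (\<lambda>\<sigma> \<tau>.
     if (\<forall>v. v \<noteq> x \<longrightarrow> \<sigma> v = \<tau> v) \<and> (\<sigma> x = \<tau> x + 1 \<or> \<tau> x = \<sigma> x + 1)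
     then complex_of_real (sqrt (real twoS / 2 * (real twoS / 2 + 1)
                                 - spinval twoS (\<sigma> x) * spinval twoS (\<tau> x)) / 2)
     else 0)"

definition Tswap :: "site \<Rightarrow> site \<Rightarrow> op" where
  "Tswap x y = (\<lambda>\<sigma> \<tau>.
     if \<sigma> x = \<tau> y \<and> \<sigma> y = \<tau> x \<and> (\<forall>v. v \<noteq> x \<and> v \<noteq> y \<longrightarrow> \<sigma> v = \<tau> v) then 1 else 0)"

definition Qop :: "site \<Rightarrow> site \<Rightarrow> op" where
  "Qop x y = (\<lambda>\<sigma> \<tau>.
     if \<sigma> x = \<sigma> y \<and> \<tau> x = \<tau> y \<and> (\<forall>v. v \<noteq> x \<and> v \<noteq> y \<longrightarrow> \<sigma> v = \<tau> v) then 1 else 0)"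

definition hamiltonian :: "nat \<Rightarrow> nat \<Rightarrow> nat \<Rightarrow> real \<Rightarrow> (site \<Rightarrow> real) \<Rightarrow> op" where
  "hamiltonian d L twoS u h = (\<lambda>\<sigma> \<tau>.
     - (\<Sum>(x, y)\<in>nn_edges d L. complex_of_real u * Tswap x y \<sigma> \<tau>
            + complex_of_real (1 - u) * Qop x y \<sigma> \<tau> - op_id \<sigma> \<tau>)
     - (\<Sum>x\<in>lattice d L. complex_of_real (h x) * S3 twoS x \<sigma> \<tau>))"

definition gibbs :: "nat \<Rightarrow> nat \<Rightarrow> nat \<Rightarrow> real \<Rightarrow> real \<Rightarrow> (site \<Rightarrow> real) \<Rightarrow> op" where
  "gibbs d L twoS u \<beta> h =
     op_exp (configs (lattice d L) twoS)
            (\<lambda>\<sigma> \<tau>. - complex_of_real \<beta> * hamiltonian d L twoS u h \<sigma> \<tau>)"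

definition Zpart :: "nat \<Rightarrow> nat \<Rightarrow> nat \<Rightarrow> real \<Rightarrow> real \<Rightarrow> (site \<Rightarrow> real) \<Rightarrow> complex" where
  "Zpart d L twoS u \<beta> h = op_trace (configs (lattice d L) twoS) (gibbs d L twoS u \<beta> h)"

definition expval :: "nat \<Rightarrow> nat \<Rightarrow> nat \<Rightarrow> real \<Rightarrow> real \<Rightarrow> (site \<Rightarrow> real) \<Rightarrow> op \<Rightarrow> complex" where
  "expval d L twoS u \<beta> h M =
     op_trace (configs (lattice d L) twoS)
       (op_mult (configs (lattice d L) twoS) M (gibbs d L twoS u \<beta> h)) / Zpart d L twoS u \<beta> h"

text \<open>A realisation is a finite list of bridges (x, y, t, c): edge (x,y), time t,
  c = True for a cross, c = False for a double bar.\<close>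
type_synonym bridges = "(site \<times> site \<times> real \<times> bool) list"

text \<open>Law rho of the superposition of the two Poisson processes (intensity u for crosses,
  1 - u for double bars, on E x [0,beta)): explicit expectation of F under rho.\<close>
definition rho_int :: "(site \<times> site) set \<Rightarrow> real \<Rightarrow> real \<Rightarrow> (bridges \<Rightarrow> real) \<Rightarrow> real" where
  "rho_int E \<beta> u F = exp (- real (card E) * \<beta>) *
     (\<Sum>n. (1 / fact n) *
       (\<Sum>es\<in>{..<n} \<rightarrow>\<^sub>E E. \<Sum>cs\<in>{..<n} \<rightarrow>\<^sub>E (UNIV :: bool set).
          (\<Prod>i<n. if cs i then u else 1 - u) *
          (LINT ts : ({..<n} \<rightarrow>\<^sub>E {0..<\<beta>}) | PiM {..<n} (\<lambda>_. lborel).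
             F (map (\<lambda>i. (fst (es i), snd (es i), ts i, cs i)) [0..<n]))))"

definition cut_times :: "bridges \<Rightarrow> site \<Rightarrow> real set" where
  "cut_times \<omega> v = {0} \<union> {t. \<exists>x y c. (x, y, t, c) \<in> set \<omega> \<and> (v = x \<or> v = y)}"

definition nxt :: "real \<Rightarrow> bridges \<Rightarrow> site \<Rightarrow> real \<Rightarrow> real" where
  "nxt \<beta> \<omega> v s = Min ({t \<in> cut_times \<omega> v. s < t} \<union> {\<beta>})"

text \<open>Vertical segments (v, s): {v} x [s, nxt s).\<close>
definition segs :: "site set \<Rightarrow> real \<Rightarrow> bridges \<Rightarrow> (site \<times> real) set" where
  "segs Lam \<beta> \<omega> = {(v, s). v \<in> Lam \<and> s \<in> cut_times \<omega> v \<and> s < \<beta>}"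

definition seglen :: "real \<Rightarrow> bridges \<Rightarrow> site \<times> real \<Rightarrow> real" where
  "seglen \<beta> \<omega> p = nxt \<beta> \<omega> (fst p) (snd p) - snd p"

text \<open>Adjacency of segments.  Wrap-around at time beta~0 at the sites not in M (M is the set of
  sites where the loop is cut open at time 0); a cross at (xy,t) joins the top (at t) of the
  segment below t at one endpoint with the bottom (at t) of the segment above t at the other;
  a double bar joins the two tops, and the two bottoms.\<close>
definition seg_link :: "site set \<Rightarrow> real \<Rightarrow> bridges \<Rightarrow> site set \<Rightarrow> ((site \<times> real) \<times> (site \<times> real)) set" where
  "seg_link Lam \<beta> \<omega> M = {(p, q). p \<in> segs Lam \<beta> \<omega> \<and> q \<in> segs Lam \<beta> \<omega> \<and>
     ((fst p = fst q \<and> snd q = 0 \<and> nxt \<beta> \<omega> (fst p) (snd p) = \<beta> \<and> fst p \<notin> M)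
      \<or> (\<exists>x y t c. (x, y, t, c) \<in> set \<omega> \<and>
           (\<exists>v w. ((v, w) = (x, y) \<or> (v, w) = (y, x)) \<and>
              (if c then fst p = v \<and> nxt \<beta> \<omega> v (snd p) = t \<and> q = (w, t)
               else (fst p = v \<and> nxt \<beta> \<omega> v (snd p) = t \<and> fst q = w \<and> nxt \<beta> \<omega> w (snd q) = t)
                    \<or> (p = (v, t) \<and> q = (w, t))))))}"

definition seg_conn :: "site set \<Rightarrow> real \<Rightarrow> bridges \<Rightarrow> site set \<Rightarrow> ((site \<times> real) \<times> (site \<times> real)) set" where
  "seg_conn Lam \<beta> \<omega> M = (segs Lam \<beta> \<omega> \<times> segs Lam \<beta> \<omega>) \<inter>
     (seg_link Lam \<beta> \<omega> M \<union> (seg_link Lam \<beta> \<omega> M)\<inverse>)\<^sup>*"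

text \<open>The loops L(omega): each loop is represented by the set of segments it consists of.\<close>
definition loops :: "site set \<Rightarrow> real \<Rightarrow> bridges \<Rightarrow> (site \<times> real) set set" where
  "loops Lam \<beta> \<omega> = segs Lam \<beta> \<omega> // seg_conn Lam \<beta> \<omega> {}"

definition connected0 :: "site set \<Rightarrow> real \<Rightarrow> bridges \<Rightarrow> site \<Rightarrow> bool" where
  "connected0 Lam \<beta> \<omega> x \<longleftrightarrow> ((origin, 0), (x, 0)) \<in> seg_conn Lam \<beta> \<omega> {}"

definition loop0x :: "site set \<Rightarrow> real \<Rightarrow> bridges \<Rightarrow> (site \<times> real) set" where
  "loop0x Lam \<beta> \<omega> = seg_conn Lam \<beta> \<omega> {} `` {(origin, 0)}"

text \<open>The part of gamma_{0,x} traversed from (0,0) upwards until the first visit to (x,0):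
  the component of the segment starting at (0,0) after cutting open at (0,0) and (x,0).\<close>
definition arc_plus :: "site set \<Rightarrow> real \<Rightarrow> bridges \<Rightarrow> site \<Rightarrow> (site \<times> real) set" where
  "arc_plus Lam \<beta> \<omega> x = seg_conn Lam \<beta> \<omega> {origin, x} `` {(origin, 0)}"

definition hlen :: "real \<Rightarrow> bridges \<Rightarrow> (site \<Rightarrow> real) \<Rightarrow> (site \<times> real) set \<Rightarrow> real" where
  "hlen \<beta> \<omega> h \<gamma> = (\<Sum>p\<in>\<gamma>. h (fst p) * seglen \<beta> \<omega> p)"

definition zact :: "nat \<Rightarrow> real \<Rightarrow> bridges \<Rightarrow> (site \<Rightarrow> real) \<Rightarrow> (site \<times> real) set \<Rightarrow> real" where
  "zact twoS \<beta> \<omega> h \<gamma> = (\<Sum>k\<le>twoS. exp (spinval twoS k * hlen \<beta> \<omega> h \<gamma>))"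

definition ztilde :: "nat \<Rightarrow> site set \<Rightarrow> real \<Rightarrow> bridges \<Rightarrow> (site \<Rightarrow> real) \<Rightarrow> site \<Rightarrow> real" where
  "ztilde twoS Lam \<beta> \<omega> h x =
     (let Wp = hlen \<beta> \<omega> h (arc_plus Lam \<beta> \<omega> x);
          Wm = hlen \<beta> \<omega> h (loop0x Lam \<beta> \<omega>) - Wp;
          S = real twoS / 2
      in (1 / 4) * (\<Sum>k<twoS. (S * (S + 1) - spinval twoS k * (spinval twoS k + 1)) *
            (exp ((spinval twoS k + 1) * Wp + spinval twoS k * Wm)
             + exp (spinval twoS k * Wp + (spinval twoS k + 1) * Wm))))"

end

theory Submission
  imports Defs
begin

text \<open>
  Since the magnetic term is diagonal, the Dyson expansion of the Gibbs operator in the bridge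
  terms is a Poisson integral over bridges: peeling off the bridge with the latest time from an
  unordered family of bridges reproduces the recursion for the Dyson terms. The matrix element
  attached to a realization is a sum over assignments of a spin to every vertical segment that
  are constant across bridges. Taking the trace glues time 0 to time \<beta>, so the spin is constant
  on every loop and the sum factorizes into the product of the activities. For the two-point
  function the loops stay cut at the origin and at x, where the spin jumps by one; the four
  free ends that remain are paired by the cut loops, so the jump is possible exactly when both
  points lie in the same loop, whose two arcs then carry neighbouring spin values.
\<close>

section \<open>Dyson expansion of a matrix exponential\<close>

text \<open>Three obstacles shape the details. The integral of a function that is not integrable has
  the default value 0, so measurability of the loop integrands has to be proved, on all of
  [0,\<beta>)^n with ties included; the key is that the loop structure depends only on the order of
  the bridge times. Ties and bridges at time 0 would spoil the pairing of ends, so the combinatorics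
  is done for \<open>good_bridges\<close>, which almost every realization satisfies. Finally,
  \<open>seg_conn\<close> is an unoriented equivalence of segments that forgets how a loop is
  traversed; the fact that an open component has exactly two ends is recovered by counting ends of a
  matching. The constant: crosses and double bars together have intensity u + (1 - u) = 1 per edge,
  whence the normalization exp(-|E| \<beta>) of the Poisson law; it is produced on the quantum side
  by the summand -1 that each edge contributes to the bracket in the Hamiltonian.\<close>

primrec mpow :: "'c set \<Rightarrow> ('c \<Rightarrow> 'c \<Rightarrow> real) \<Rightarrow> nat \<Rightarrow> 'c \<Rightarrow> 'c \<Rightarrow> real" where
  "mpow C R 0 \<sigma> \<tau> = (if \<sigma> = \<tau> then 1 else 0)"
| "mpow C R (Suc n) \<sigma> \<tau> = (\<Sum>\<rho>\<in>C. R \<sigma> \<rho> * mpow C R n \<rho> \<tau>)"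

text \<open>Real counterpart of \<open>op_exp\<close>, with the time split off as the variable of a
  power series so that it can be differentiated termwise. All entries of \<open>hamiltonian\<close>
  are real.\<close>

definition mexp :: "'c set \<Rightarrow> ('c \<Rightarrow> 'c \<Rightarrow> real) \<Rightarrow> real \<Rightarrow> 'c \<Rightarrow> 'c \<Rightarrow> real" where
  "mexp C R t \<sigma> \<tau> = (\<Sum>n. mpow C R n \<sigma> \<tau> / fact n * t ^ n)"

text \<open>The sum of all absolute entries dominates every row sum, so each factor in
  \<open>mpow\<close> costs at most one factor of it. The bound is crude but geometric in
  \<open>n\<close>, and the factorial beats it.\<close>

lemma abs_mpow_le:
  assumes "finite C" "\<sigma> \<in> C"
  shows "\<bar>mpow C R n \<sigma> \<tau>\<bar> \<le> (\<Sum>\<sigma>\<in>C. \<Sum>\<rho>\<in>C. \<bar>R \<sigma> \<rho>\<bar>) ^ n"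
  using assms(2)
proof (induction n arbitrary: \<sigma>)
  case (Suc n)
  let ?B = "\<Sum>\<sigma>\<in>C. \<Sum>\<rho>\<in>C. \<bar>R \<sigma> \<rho>\<bar>"
  have "\<bar>mpow C R (Suc n) \<sigma> \<tau>\<bar> \<le> (\<Sum>\<rho>\<in>C. \<bar>R \<sigma> \<rho>\<bar> * \<bar>mpow C R n \<rho> \<tau>\<bar>)"
    by (simp add: abs_mult[symmetric])
  also have "\<dots> \<le> (\<Sum>\<rho>\<in>C. \<bar>R \<sigma> \<rho>\<bar> * ?B ^ n)"
    using Suc.IH by (intro sum_mono mult_left_mono) auto
  also have "\<dots> = (\<Sum>\<rho>\<in>C. \<bar>R \<sigma> \<rho>\<bar>) * ?B ^ n"
    by (simp add: sum_distrib_right)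
  also have "\<dots> \<le> ?B * ?B ^ n"
    using assms(1) Suc.prems
    by (intro mult_right_mono member_le_sum[of \<sigma> C "\<lambda>\<sigma>. \<Sum>\<rho>\<in>C. \<bar>R \<sigma> \<rho>\<bar>"] zero_le_power sum_nonneg)
        (auto intro!: sum_nonneg)
  finally show ?case by simp
qed simp

lemma summable_mexp:
  assumes "finite C" "\<sigma> \<in> C"
  shows "summable (\<lambda>n. mpow C R n \<sigma> \<tau> / fact n * t ^ n)"
proof (rule summable_comparison_test')
  let ?B = "\<Sum>\<sigma>\<in>C. \<Sum>\<rho>\<in>C. \<bar>R \<sigma> \<rho>\<bar>"
  show "summable (\<lambda>n. inverse (fact n) * (?B * \<bar>t\<bar>) ^ n)"
    by (rule summable_exp)
  show "norm (mpow C R n \<sigma> \<tau> / fact n * t ^ n) \<le> inverse (fact n) * (?B * \<bar>t\<bar>) ^ n" for n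
  proof -
    have "norm (mpow C R n \<sigma> \<tau> / fact n * t ^ n) = inverse (fact n) * (\<bar>mpow C R n \<sigma> \<tau>\<bar> * \<bar>t\<bar> ^ n)"
      by (simp add: abs_mult power_abs divide_inverse mult_ac)
    also have "\<dots> \<le> inverse (fact n) * (?B ^ n * \<bar>t\<bar> ^ n)"
      using abs_mpow_le[OF assms] by (intro mult_left_mono mult_right_mono) auto
    finally show ?thesis by (simp add: power_mult_distrib)
  qed
qed

lemma mexp_0 [simp]: "mexp C R 0 \<sigma> \<tau> = (if \<sigma> = \<tau> then 1 else 0)"
  unfolding mexp_def by (subst powser_zero) simp

text \<open>Shifting the coefficients uses up one factor of the factorial, and \<open>mpow\<close>
  splits off its matrix on the left. Hence \<open>R\<close> acts from the left, the side on which
  the latest bridge enters the Dyson recursion.\<close>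

lemma has_real_derivative_mexp:
  assumes "finite C" "\<sigma> \<in> C"
  shows "((\<lambda>t. mexp C R t \<sigma> \<tau>) has_real_derivative (\<Sum>\<rho>\<in>C. R \<sigma> \<rho> * mexp C R t \<rho> \<tau>)) (at t)"
proof -
  have "((\<lambda>t. mexp C R t \<sigma> \<tau>) has_real_derivative
      (\<Sum>n. diffs (\<lambda>n. mpow C R n \<sigma> \<tau> / fact n) n * t ^ n)) (at t)"
    unfolding mexp_def by (rule termdiffs_strong_converges_everywhere) (rule summable_mexp[OF
        assms])
  also have "(\<lambda>n. diffs (\<lambda>n. mpow C R n \<sigma> \<tau> / fact n) n * t ^ n)
      = (\<lambda>n. \<Sum>\<rho>\<in>C. R \<sigma> \<rho> * (mpow C R n \<rho> \<tau> / fact n * t ^ n))"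
    by (rule ext) (simp add: diffs_def sum_distrib_right sum_distrib_left sum_divide_distrib
        field_simps del: of_nat_Suc)
  also have "suminf \<dots> = (\<Sum>\<rho>\<in>C. R \<sigma> \<rho> * mexp C R t \<rho> \<tau>)"
    unfolding mexp_def
    using summable_mexp[OF assms(1)]
    by (subst suminf_sum) (intro summable_mult sum.cong refl suminf_mult; simp)+
  finally show ?thesis .
qed

lemma op_pow_of_real:
  "op_pow C (\<lambda>\<sigma> \<tau>. complex_of_real (t * R \<sigma> \<tau>)) n \<sigma> \<tau> = complex_of_real (t ^ n * mpow C R n \<sigma> \<tau>)"
  by (induction n arbitrary: \<sigma>)
     (simp_all add: op_pow_def op_id_def op_mult_def sum_distrib_left mult_ac)

lemma op_exp_of_real:
  assumes "finite C" "\<sigma> \<in> C"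
  shows "op_exp C (\<lambda>\<sigma> \<tau>. complex_of_real (t * R \<sigma> \<tau>)) \<sigma> \<tau> = complex_of_real (mexp C R t \<sigma> \<tau>)"
proof -
  have "(\<lambda>n. op_pow C (\<lambda>\<sigma> \<tau>. complex_of_real (t * R \<sigma> \<tau>)) n \<sigma> \<tau> / of_nat (fact n))
      = (\<lambda>n. complex_of_real (mpow C R n \<sigma> \<tau> / fact n * t ^ n))"
    unfolding op_pow_of_real by (simp add: mult_ac)
  then show ?thesis
    unfolding op_exp_def mexp_def by (simp only: suminf_of_real[OF summable_mexp[OF assms]])
qed

text \<open>Serves twice: to sum separately over the mark of the latest bridge, and to single out
  the spins on the two arcs of a cut loop.\<close>

lemma sum_PiE_remove:
  assumes "i \<in> I"
  shows "sum f (I \<rightarrow>\<^sub>E X) = (\<Sum>y\<in>X. \<Sum>g\<in>(I - {i}) \<rightarrow>\<^sub>E X. f (g(i := y)))"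
proof -
  have "I \<rightarrow>\<^sub>E X = (\<lambda>(y, g). g(i := y)) ` (X \<times> ((I - {i}) \<rightarrow>\<^sub>E X))"
    using assms PiE_insert_eq[of i "I - {i}" "\<lambda>_. X"] by (simp add: insert_absorb)
  then show ?thesis
    using inj_combinator[of i "I - {i}" "\<lambda>_. X"]
    by (simp add: sum.reindex sum.cartesian_product split_def)
qed

interpretation lborel_prod: product_sigma_finite "\<lambda>_. lborel :: real measure"
  by standard

text \<open>\<open>b\<close> is the diagonal generator; a mark in \<open>X\<close> is an edge with a
  bridge type, \<open>w\<close> is its intensity and \<open>A\<close> the matrix that such a bridge
  inserts. Nonnegativity of \<open>A\<close> and \<open>w\<close> lets the interchanges of sums and
  integrals go through Tonelli.\<close>

locale dyson =
  fixes C :: "'c set" and b :: "'c \<Rightarrow> real" and A :: "'m \<Rightarrow> 'c \<Rightarrow> 'c \<Rightarrow> real"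
    and X :: "'m set" and w :: "'m \<Rightarrow> real"
  assumes finite_C: "finite C" and finite_X: "finite X"
    and A_nonneg: "\<And>m \<sigma> \<rho>. 0 \<le> A m \<sigma> \<rho>" and w_nonneg: "\<And>m. m \<in> X \<Longrightarrow> 0 \<le> w m"
begin

definition A_tot :: "'c \<Rightarrow> 'c \<Rightarrow> real" where
  "A_tot \<sigma> \<rho> = (\<Sum>m\<in>X. w m * A m \<sigma> \<rho>)"

text \<open>The growth factor stands outside so that the integrand does not depend on the upper
  limit; continuity in \<open>t\<close> is then that of an indefinite integral.
  \<open>dyson_term_Suc\<close> gives the convolution form used afterwards.\<close>

primrec dyson_term :: "nat \<Rightarrow> real \<Rightarrow> 'c \<Rightarrow> 'c \<Rightarrow> real" where
  "dyson_term 0 t \<sigma> \<tau> = (if \<sigma> = \<tau> then exp (t * b \<sigma>) else 0)"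
| "dyson_term (Suc n) t \<sigma> \<tau> =
     exp (t * b \<sigma>) * integral {0..t} (\<lambda>s. exp (- s * b \<sigma>) * (\<Sum>\<rho>\<in>C. A_tot \<sigma> \<rho> * dyson_term n s \<rho> \<tau>))"

text \<open>For a set of bridges with pairwise distinct times only the sequence of indices that
  removes the latest bridge at each step contributes to the sum.\<close>

primrec ordered_weight :: "('i \<Rightarrow> 'm) \<Rightarrow> nat \<Rightarrow> 'i set \<Rightarrow> real \<Rightarrow> ('i \<Rightarrow> real) \<Rightarrow> 'c \<Rightarrow> 'c \<Rightarrow> real" where
  "ordered_weight m 0 I t ts \<sigma> \<tau> = (if \<sigma> = \<tau> then exp (t * b \<sigma>) else 0)"
| "ordered_weight m (Suc n) I t ts \<sigma> \<tau> =
     (\<Sum>i\<in>I. indicator {0..<t} (ts i) * (exp ((t - ts i) * b \<sigma>) *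
        (\<Sum>\<rho>\<in>C. A (m i) \<sigma> \<rho> * ordered_weight m n (I - {i}) (ts i) ts \<rho> \<tau>)))"

lemma A_tot_nonneg: "0 \<le> A_tot \<sigma> \<rho>"
  unfolding A_tot_def by (intro sum_nonneg mult_nonneg_nonneg A_nonneg w_nonneg)

lemma continuous_dyson_term: "continuous_on {0..T} (\<lambda>t. dyson_term n t \<sigma> \<tau>)"
proof (induction n arbitrary: \<sigma>)
  case 0
  then show ?case by (cases "\<sigma> = \<tau>") (auto intro!: continuous_intros)
next
  case (Suc n)
  have "(\<lambda>s. exp (- s * b \<sigma>) * (\<Sum>\<rho>\<in>C. A_tot \<sigma> \<rho> * dyson_term n s \<rho> \<tau>)) integrable_on {0..T}"
    by (intro integrable_continuous_interval continuous_intros Suc)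
  from indefinite_integral_continuous_1[OF this] show ?case
    by (auto intro!: continuous_intros)
qed

lemma integrable_dyson_step:
  "(\<lambda>s. exp (c - s * b \<sigma>) * (\<Sum>\<rho>\<in>C. A_tot \<sigma> \<rho> * dyson_term n s \<rho> \<tau>)) integrable_on {0..T}"
  by (intro integrable_continuous_interval continuous_intros continuous_dyson_term)

lemma dyson_term_Suc:
  "dyson_term (Suc n) t \<sigma> \<tau> =
     integral {0..t} (\<lambda>s. exp ((t - s) * b \<sigma>) * (\<Sum>\<rho>\<in>C. A_tot \<sigma> \<rho> * dyson_term n s \<rho> \<tau>))"
proof -
  have "exp ((t - s) * b \<sigma>) = exp (t * b \<sigma>) * exp (- s * b \<sigma>)" for s
    by (simp add: exp_add[symmetric] algebra_simps)
  then show ?thesis by (simp add: mult.assoc)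
qed

declare dyson_term.simps(2) [simp del]

lemma dyson_term_nonneg: "0 \<le> dyson_term n t \<sigma> \<tau>"
proof (induction n arbitrary: t \<sigma>)
  case (Suc n)
  show ?case
    unfolding dyson_term_Suc left_diff_distrib
    by (intro integral_nonneg integrable_dyson_step mult_nonneg_nonneg sum_nonneg A_tot_nonneg
        Suc) auto
qed simp

text \<open>Every solution of the linear equation obeys Duhamel's formula, hence the remainder after
  \<open>N\<close> terms obeys the same recursion as the Dyson terms. Iterating it integrates over
  ordered times and produces T^N / N!, which forces the remainder to 0.\<close>

lemma dyson_sums:
  assumes deriv: "\<And>t \<sigma>. \<sigma> \<in> C \<Longrightarrow> ((\<lambda>t. G t \<sigma>) has_real_derivative
        (b \<sigma> * G t \<sigma> + (\<Sum>\<rho>\<in>C. A_tot \<sigma> \<rho> * G t \<rho>))) (at t)"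
    and init: "\<And>\<sigma>. \<sigma> \<in> C \<Longrightarrow> G 0 \<sigma> = (if \<sigma> = \<tau> then 1 else 0)"
    and T: "0 \<le> T" and \<sigma>: "\<sigma> \<in> C"
  shows "(\<lambda>n. dyson_term n T \<sigma> \<tau>) sums G T \<sigma>"
proof -
  have contG: "continuous_on S (\<lambda>t. G t \<rho>)" if "\<rho> \<in> C" for \<rho> S
    using deriv[OF that] by (meson DERIV_isCont continuous_at_imp_continuous_on)
  define R where "R N t \<sigma> = G t \<sigma> - (\<Sum>n<N. dyson_term n t \<sigma> \<tau>)" for N t \<sigma>
  \<comment> \<open>Variation of constants: in the derivative of
    \<open>exp ((t - s) * b \<sigma>) * G s \<sigma>\<close> with respect to \<open>s\<close> the
    diagonal term cancels and only the \<open>A_tot\<close> term survives.\<close>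
  have duhamel: "((\<lambda>s. exp ((t - s) * b \<sigma>) * (\<Sum>\<rho>\<in>C. A_tot \<sigma> \<rho> * G s \<rho>)) has_integral
      (G t \<sigma> - dyson_term 0 t \<sigma> \<tau>)) {0..t}" if "0 \<le> t" "\<sigma> \<in> C" for t \<sigma>
  proof -
    have "((\<lambda>s. exp ((t - s) * b \<sigma>) * (\<Sum>\<rho>\<in>C. A_tot \<sigma> \<rho> * G s \<rho>)) has_integral
        (exp ((t - t) * b \<sigma>) * G t \<sigma> - exp ((t - 0) * b \<sigma>) * G 0 \<sigma>)) {0..t}"
    proof (rule fundamental_theorem_of_calculus[OF that(1)])
      fix s
      have "((\<lambda>s. exp ((t - s) * b \<sigma>) * G s \<sigma>) has_real_derivative
         (exp ((t - s) * b \<sigma>) * (\<Sum>\<rho>\<in>C. A_tot \<sigma> \<rho> * G s \<rho>))) (at s)"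
        by (rule derivative_eq_intros deriv[OF that(2)] refl | simp add: algebra_simps)+
      then show "((\<lambda>s. exp ((t - s) * b \<sigma>) * G s \<sigma>) has_vector_derivative
         (exp ((t - s) * b \<sigma>) * (\<Sum>\<rho>\<in>C. A_tot \<sigma> \<rho> * G s \<rho>))) (at s within {0..t})"
        by (simp add: has_real_derivative_iff_has_vector_derivative has_vector_derivative_at_within)
    qed
    then show ?thesis using init[OF that(2)] by auto
  qed
  have R_Suc: "((\<lambda>s. exp ((t - s) * b \<sigma>) * (\<Sum>\<rho>\<in>C. A_tot \<sigma> \<rho> *
      R N s \<rho>)) has_integral R (Suc N) t \<sigma>) {0..t}"
    if "0 \<le> t" "\<sigma> \<in> C" for N t \<sigma>
  proof -
    have "((\<lambda>s. exp ((t - s) * b \<sigma>) * (\<Sum>\<rho>\<in>C. A_tot \<sigma> \<rho> * dyson_term n s \<rho> \<tau>)) has_integral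
        dyson_term (Suc n) t \<sigma> \<tau>) {0..t}" for n
      unfolding dyson_term_Suc left_diff_distrib
      using integrable_dyson_step by (simp add: integrable_integral)
    then have "((\<lambda>s. exp ((t - s) * b \<sigma>) * (\<Sum>\<rho>\<in>C. A_tot \<sigma> \<rho> * G s \<rho>) -
        (\<Sum>n<N. exp ((t - s) * b \<sigma>) * (\<Sum>\<rho>\<in>C. A_tot \<sigma> \<rho> * dyson_term n s \<rho> \<tau>))) has_integral
        (G t \<sigma> - dyson_term 0 t \<sigma> \<tau> - (\<Sum>n<N. dyson_term (Suc n) t \<sigma> \<tau>))) {0..t}"
      by (intro has_integral_diff duhamel that has_integral_sum) auto
    also have "G t \<sigma> - dyson_term 0 t \<sigma> \<tau> - (\<Sum>n<N. dyson_term (Suc n) t \<sigma> \<tau>) = R (Suc N) t \<sigma>"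
      unfolding R_def sum.lessThan_Suc_shift by simp
    also have "(\<lambda>s. exp ((t - s) * b \<sigma>) * (\<Sum>\<rho>\<in>C. A_tot \<sigma> \<rho> * G s \<rho>) -
        (\<Sum>n<N. exp ((t - s) * b \<sigma>) * (\<Sum>\<rho>\<in>C. A_tot \<sigma> \<rho> * dyson_term n s \<rho> \<tau>)))
       = (\<lambda>s. exp ((t - s) * b \<sigma>) * (\<Sum>\<rho>\<in>C. A_tot \<sigma> \<rho> * R N s \<rho>))"
      unfolding R_def
      by (rule ext) (simp add: sum_distrib_left sum_subtractf right_diff_distrib
          sum.swap[of _ _ "{..<N}"])
    finally show ?thesis .
  qed
  define Bm where "Bm = (\<Sum>\<sigma>\<in>C. \<bar>b \<sigma>\<bar>)"
  \<comment> \<open>Cost of one step of the recursion, uniformly on [0,T]: the exponential bounds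
    the diagonal propagator, the double sum bounds every row sum of \<open>A_tot\<close>.\<close>
  define a where "a = exp (T * Bm) * (\<Sum>\<sigma>\<in>C. \<Sum>\<rho>\<in>C. A_tot \<sigma> \<rho>)"
  have a: "0 \<le> a" unfolding a_def by (intro mult_nonneg_nonneg sum_nonneg A_tot_nonneg) auto
  have bB: "\<bar>b \<sigma>\<bar> \<le> Bm" if "\<sigma> \<in> C" for \<sigma>
    unfolding Bm_def using that finite_C by (intro member_le_sum) auto
  have coef: "exp ((t - s) * b \<sigma>) * (\<Sum>\<rho>\<in>C. A_tot \<sigma> \<rho>) \<le> a"
    if "0 \<le> s" "s \<le> t" "t \<le> T" "\<sigma> \<in> C" for s t \<sigma>
    unfolding a_def
  proof (intro mult_mono)
    have "(t - s) * b \<sigma> \<le> (t - s) * Bm"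
      using that bB[of \<sigma>] by (intro mult_left_mono) auto
    also have "\<dots> \<le> T * Bm" using that by (intro mult_right_mono) (auto simp: Bm_def sum_nonneg)
    finally show "exp ((t - s) * b \<sigma>) \<le> exp (T * Bm)" by simp
    show "sum (A_tot \<sigma>) C \<le> (\<Sum>\<sigma>\<in>C. \<Sum>\<rho>\<in>C. A_tot \<sigma> \<rho>)"
      using that finite_C by (intro member_le_sum[of \<sigma> C "\<lambda>\<sigma>. sum (A_tot \<sigma>) C"] sum_nonneg
          A_tot_nonneg) auto
  qed (auto intro!: sum_nonneg A_tot_nonneg)
  obtain g where g: "\<And>t \<sigma>. t \<in> {0..T} \<Longrightarrow> \<sigma> \<in> C \<Longrightarrow> \<bar>G t \<sigma>\<bar> \<le> g" and g0: "0 \<le> g"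
  proof -
    have "\<exists>B. \<forall>t\<in>{0..T}. \<bar>G t \<sigma>\<bar> \<le> B" if "\<sigma> \<in> C" for \<sigma>
      using compact_imp_bounded[OF compact_continuous_image[OF contG[OF that] compact_Icc[of 0 T]]]
      by (auto simp: bounded_iff)
    then obtain B where B: "\<And>\<sigma> t. \<sigma> \<in> C \<Longrightarrow> t \<in> {0..T} \<Longrightarrow> \<bar>G t \<sigma>\<bar> \<le> B \<sigma>" by metis
    show thesis
    proof (rule that[of "\<Sum>\<sigma>\<in>C. \<bar>B \<sigma>\<bar>"])
      fix t \<sigma> assume "t \<in> {0..T}" "\<sigma> \<in> C"
      then have "\<bar>G t \<sigma>\<bar> \<le> \<bar>B \<sigma>\<bar>" using B by fastforce
      also have "\<dots> \<le> (\<Sum>\<sigma>\<in>C. \<bar>B \<sigma>\<bar>)" using \<open>\<sigma> \<in> C\<close> finite_C by (intro member_le_sum) auto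
      finally show "\<bar>G t \<sigma>\<bar> \<le> (\<Sum>\<sigma>\<in>C. \<bar>B \<sigma>\<bar>)" .
    qed (auto intro: sum_nonneg)
  qed
  \<comment> \<open>\<open>g\<close> bounds the solution on the compact interval and starts the
    induction. The integral of \<open>a\<close> times this bound is the bound for
    \<open>Suc N\<close>, which is how the factorial arises.\<close>
  have bound: "\<bar>R N t \<sigma>\<bar> \<le> g * (a * t) ^ N / fact N" if "t \<in> {0..T}" "\<sigma> \<in> C" for N t \<sigma>
    using that
  proof (induction N arbitrary: t \<sigma>)
    case 0
    then show ?case using g by (simp add: R_def)
  next
    case (Suc N)
    let ?f = "\<lambda>s. a * (g * (a * s) ^ N / fact N)"
    have "(?f has_integral (g * (a * t) ^ Suc N / fact (Suc N) - g * (a *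
        0) ^ Suc N / fact (Suc N))) {0..t}"
    proof (rule fundamental_theorem_of_calculus)
      show "0 \<le> t" using Suc.prems by simp
      fix s
      have "((\<lambda>s. g * (a * s) ^ Suc N / fact (Suc N)) has_real_derivative ?f s) (at s)"
        by (rule derivative_eq_intros refl | simp add: field_simps del: of_nat_Suc)+
      then show "((\<lambda>s. g * (a * s) ^ Suc N / fact (Suc N)) has_vector_derivative ?f s) (at s
          within {0..t})"
        by (simp only: has_real_derivative_iff_has_vector_derivative
            has_vector_derivative_at_within)
    qed
    then have F: "(?f has_integral (g * (a * t) ^ Suc N / fact (Suc N))) {0..t}" by simp
    have le: "norm (exp ((t - s) * b \<sigma>) * (\<Sum>\<rho>\<in>C. A_tot \<sigma> \<rho> * R N s \<rho>)) \<le> ?f s" if s: "s \<in> {0..t}"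
        for s
    proof -
      have "\<bar>\<Sum>\<rho>\<in>C. A_tot \<sigma> \<rho> * R N s \<rho>\<bar> \<le> (\<Sum>\<rho>\<in>C. A_tot \<sigma> \<rho> * \<bar>R N s \<rho>\<bar>)"
        by (rule order_trans[OF sum_abs]) (simp add: abs_mult A_tot_nonneg)
      also have "\<dots> \<le> (\<Sum>\<rho>\<in>C. A_tot \<sigma> \<rho> * (g * (a * s) ^ N / fact N))"
        using s Suc.prems by (intro sum_mono mult_left_mono Suc.IH A_tot_nonneg) auto
      finally have "norm (exp ((t - s) * b \<sigma>) * (\<Sum>\<rho>\<in>C. A_tot \<sigma> \<rho> * R N s \<rho>))
          \<le> exp ((t - s) * b \<sigma>) * (\<Sum>\<rho>\<in>C. A_tot \<sigma> \<rho> * (g * (a * s) ^ N / fact N))"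
        by (simp add: abs_mult)
      also have "\<dots> = (exp ((t - s) * b \<sigma>) * (\<Sum>\<rho>\<in>C. A_tot \<sigma> \<rho>)) * (g * (a * s) ^ N / fact N)"
        by (simp only: sum_distrib_right[symmetric] mult.assoc)
      also have "\<dots> \<le> ?f s"
        using s Suc.prems a g0 by (intro mult_right_mono coef) auto
      finally show ?thesis .
    qed
    have RS: "R (Suc N) t \<sigma> = integral {0..t} (\<lambda>s. exp ((t - s) * b \<sigma>) * (\<Sum>\<rho>\<in>C. A_tot \<sigma> \<rho> *
        R N s \<rho>))"
      using R_Suc[of t \<sigma> N] Suc.prems by (simp add: integral_unique)
    have "norm (R (Suc N) t \<sigma>) \<le> integral {0..t} ?f"
      unfolding RS using R_Suc[of t \<sigma> N] Suc.prems F le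
      by (intro integral_norm_bound_integral) (auto intro: has_integral_integrable)
    then show ?case unfolding integral_unique[OF F] real_norm_def .
  qed
  have "(\<lambda>N. g * ((a * T) ^ N / fact N)) \<longlonglongrightarrow> g * 0"
    using summable_LIMSEQ_zero[OF summable_exp[of "a * T"]]
    by (intro tendsto_mult_left) (simp add: divide_inverse mult.commute)
  then have "(\<lambda>N. R N T \<sigma>) \<longlonglongrightarrow> 0"
    using bound[of T \<sigma>] T \<sigma>
    by (intro Lim_null_comparison[of "\<lambda>N. R N T \<sigma>" "\<lambda>N. g * ((a *
        T) ^ N / fact N)"] always_eventually) auto
  then have "(\<lambda>N. G T \<sigma> - R N T \<sigma>) \<longlonglongrightarrow> G T \<sigma> - 0"
    by (intro tendsto_diff tendsto_const)
  then show ?thesis by (simp add: sums_def R_def)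
qed

section \<open>Integrating the weights over unordered bridge times\<close>

lemma ordered_weight_nonneg: "0 \<le> ordered_weight m n I t ts \<sigma> \<tau>"
  by (induction n arbitrary: I t \<sigma>) (auto intro!: sum_nonneg mult_nonneg_nonneg A_nonneg)

text \<open>The weight reads marks and times only on \<open>I\<close>. Once index \<open>i\<close>
  is removed, its time and mark may therefore be changed freely; this separates the variables in the
  recursion.\<close>

lemma ordered_weight_cong:
  assumes "\<And>i. i \<in> I \<Longrightarrow> m i = m' i" "\<And>i. i \<in> I \<Longrightarrow> ts i = ts' i"
  shows "ordered_weight m n I t ts \<sigma> \<tau> = ordered_weight m' n I t ts' \<sigma> \<tau>"
  using assms
proof (induction n arbitrary: I t \<sigma>)
  case (Suc n)
  have "ordered_weight m n (I - {i}) t ts \<rho> \<tau> = ordered_weight m' n (I - {i}) t ts' \<rho> \<tau>" for i t \<rho>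
    by (rule Suc.IH) (auto simp: Suc.prems)
  then show ?case using Suc.prems by (auto intro!: sum.cong)
qed simp

text \<open>The recursion substitutes the time of the removed bridge for the end time, so the
  induction goes through only if the end time is itself an arbitrary measurable function of the
  parameter.\<close>

lemma ordered_weight_measurable:
  assumes "f \<in> borel_measurable M" "\<And>i. i \<in> I \<Longrightarrow> (\<lambda>x. g x i) \<in> borel_measurable M"
  shows "(\<lambda>x. ordered_weight m n I (f x) (g x) \<sigma> \<tau>) \<in> borel_measurable M"
  using assms
proof (induction n arbitrary: I f \<sigma>)
  case 0
  note 0(1)[measurable]
  show ?case by simp
next
  case (Suc n)
  note Suc.prems(1)[measurable]
  show ?case
    unfolding ordered_weight.simps
  proof (rule borel_measurable_sum)
    fix i assume "i \<in> I"
    then have [measurable]: "(\<lambda>x. g x i) \<in> borel_measurable M" by (rule Suc.prems)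
    have [measurable]: "(\<lambda>x. ordered_weight m n (I - {i}) (g x i) (g x) \<rho> \<tau>) \<in> borel_measurable M"
        for \<rho>
      by (rule Suc.IH) (auto intro: Suc.prems \<open>i \<in> I\<close>)
    have "(\<lambda>x. indicator {0..<f x} (g x i) :: real) = (\<lambda>x. if 0 \<le> g x i \<and>
        g x i < f x then 1 else 0)"
      by (auto simp: fun_eq_iff indicator_def)
    moreover have "\<dots> \<in> borel_measurable M" by measurable
    ultimately have [measurable]: "(\<lambda>x. indicator {0..<f x} (g x i) :: real) \<in> borel_measurable M"
        by simp
    show "(\<lambda>x. indicator {0..<f x} (g x i) * (exp ((f x - g x i) * b \<sigma>) *
           (\<Sum>\<rho>\<in>C. A (m i) \<sigma> \<rho> * ordered_weight m n (I -
               {i}) (g x i) (g x) \<rho> \<tau>))) \<in> borel_measurable M"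
      by measurable
  qed
qed

lemma ordered_weight_measurable_PiM:
  "(\<lambda>ts. ordered_weight m n I t ts \<sigma> \<tau>) \<in> borel_measurable (PiM I (\<lambda>_. lborel))"
  by (rule ordered_weight_measurable) (auto intro!: measurable_component_singleton)

text \<open>Values in \<open>ennreal\<close> free the recursion from integrability conditions;
  finiteness follows later by comparison with the Dyson terms. The step count \<open>card I\<close>
  makes every bridge be used.\<close>

definition weight_integral :: "('i \<Rightarrow> 'm) \<Rightarrow> 'i set \<Rightarrow> real \<Rightarrow> 'c \<Rightarrow> 'c \<Rightarrow> ennreal" where
  "weight_integral m I t \<sigma> \<tau> =
     (\<integral>\<^sup>+ ts. ennreal (ordered_weight m (card I) I t ts \<sigma> \<tau>) \<partial>PiM I (\<lambda>_. lborel))"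

lemma weight_integral_measurable [measurable]:
  assumes "finite I"
  shows "(\<lambda>t. weight_integral m I t \<sigma> \<tau>) \<in> borel_measurable borel"
proof -
  interpret S: sigma_finite_measure "PiM I (\<lambda>_. lborel :: real measure)"
    using assms by (rule lborel_prod.sigma_finite)
  have "(\<lambda>z. ordered_weight m (card I) I (fst z) (snd z) \<sigma> \<tau>)
      \<in> borel_measurable (borel \<Otimes>\<^sub>M PiM I (\<lambda>_. lborel :: real measure))"
    by (rule ordered_weight_measurable)
       (auto intro!: measurable_compose[OF measurable_snd] measurable_component_singleton)
  then show ?thesis
    unfolding weight_integral_def
    by (intro S.borel_measurable_nn_integral) (simp add: split_beta')
qed

text \<open>The index removed first carries the latest time. Tonelli makes its coordinate the outer
  variable \<open>s\<close>, and the remaining weight does not see that coordinate except as its end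
  time.\<close>

lemma weight_integral_rec:
  assumes I: "finite I" "I \<noteq> {}"
  shows "weight_integral m I t \<sigma> \<tau> =
    (\<Sum>i\<in>I. \<integral>\<^sup>+ s. indicator {0..<t} s * (ennreal (exp ((t - s) * b \<sigma>)) *
       (\<Sum>\<rho>\<in>C. ennreal (A (m i) \<sigma> \<rho>) * weight_integral m (I - {i}) s \<rho> \<tau>)) \<partial>lborel)"
proof -
  obtain n where n: "card I = Suc n" using I by (metis card_gt_0_iff gr0_implies_Suc)
  let ?g = "\<lambda>i ts. ennreal (indicator {0..<t} (ts i) * (exp ((t - ts i) * b \<sigma>) *
        (\<Sum>\<rho>\<in>C. A (m i) \<sigma> \<rho> * ordered_weight m n (I - {i}) (ts i) ts \<rho> \<tau>)))"
  have gm: "?g i \<in> borel_measurable (PiM I (\<lambda>_. lborel))" if "i \<in> I" for i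
  proof -
    have [measurable]: "(\<lambda>ts. ts i) \<in> borel_measurable (PiM I (\<lambda>_. lborel :: real measure))"
      using that measurable_component_singleton[of i I "\<lambda>_. lborel :: real measure"] by simp
    have [measurable]: "(\<lambda>ts. ordered_weight m n (I -
        {i}) (ts i) ts \<rho> \<tau>) \<in> borel_measurable (PiM I (\<lambda>_. lborel))" for \<rho>
      using measurable_component_singleton[of _ I "\<lambda>_. lborel :: real measure"]
      by (intro ordered_weight_measurable) auto
    show ?thesis by measurable
  qed
  have "weight_integral m I t \<sigma> \<tau> = (\<integral>\<^sup>+ ts. (\<Sum>i\<in>I. ?g i ts) \<partial>PiM I (\<lambda>_. lborel))"
    unfolding weight_integral_def n ordered_weight.simps
    by (subst sum_ennreal) (auto intro!: mult_nonneg_nonneg sum_nonneg A_nonneg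
        ordered_weight_nonneg)
  also have "\<dots> = (\<Sum>i\<in>I. \<integral>\<^sup>+ ts. ?g i ts \<partial>PiM I (\<lambda>_. lborel))"
    by (rule nn_integral_sum) (rule gm)
  also have "\<dots> = (\<Sum>i\<in>I. \<integral>\<^sup>+ s. indicator {0..<t} s * (ennreal (exp ((t - s) * b \<sigma>)) *
       (\<Sum>\<rho>\<in>C. ennreal (A (m i) \<sigma> \<rho>) * weight_integral m (I - {i}) s \<rho> \<tau>)) \<partial>lborel)"
  proof (rule sum.cong[OF refl])
    fix i assume i: "i \<in> I"
    have cI: "card (I - {i}) = n" using n i I by simp
    have "(\<integral>\<^sup>+ ts. ?g i ts \<partial>PiM I (\<lambda>_. lborel)) = (\<integral>\<^sup>+ ts. ?g i ts \<partial>PiM (insert i (I -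
        {i})) (\<lambda>_. lborel))"
      using i by (simp add: insert_absorb)
    also have "\<dots> = (\<integral>\<^sup>+ s. \<integral>\<^sup>+ ts. ?g i (ts(i := s)) \<partial>PiM (I - {i}) (\<lambda>_. lborel) \<partial>lborel)"
      using i I gm[OF i] by (intro lborel_prod.product_nn_integral_insert_rev) (auto simp:
          insert_absorb)
    also have "\<dots> = (\<integral>\<^sup>+ s. indicator {0..<t} s * (ennreal (exp ((t - s) * b \<sigma>)) *
       (\<Sum>\<rho>\<in>C. ennreal (A (m i) \<sigma> \<rho>) * weight_integral m (I - {i}) s \<rho> \<tau>)) \<partial>lborel)"
    proof (rule nn_integral_cong)
      fix s :: real
      have eq: "?g i (ts(i := s)) = indicator {0..<t} s * (ennreal (exp ((t - s) * b \<sigma>)) *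
         (\<Sum>\<rho>\<in>C. ennreal (A (m i) \<sigma> \<rho>) * ennreal (ordered_weight m n (I - {i}) s ts \<rho> \<tau>)))" for ts
      proof -
        have "ordered_weight m n (I - {i}) s (ts(i := s)) \<rho> \<tau> = ordered_weight m n (I -
            {i}) s ts \<rho> \<tau>" for \<rho>
          by (rule ordered_weight_cong) auto
        then show ?thesis
          by (simp add: ennreal_mult sum_nonneg A_nonneg ordered_weight_nonneg ennreal_indicator
              sum_ennreal[symmetric] del: sum_ennreal)
      qed
      show "(\<integral>\<^sup>+ ts. ?g i (ts(i := s)) \<partial>PiM (I - {i}) (\<lambda>_. lborel)) =
         indicator {0..<t} s * (ennreal (exp ((t - s) * b \<sigma>)) *
       (\<Sum>\<rho>\<in>C. ennreal (A (m i) \<sigma> \<rho>) * weight_integral m (I - {i}) s \<rho> \<tau>))"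
        unfolding eq weight_integral_def cI
        using ordered_weight_measurable_PiM[of m n "I - {i}"]
        by (simp add: nn_integral_cmult nn_integral_sum)
    qed
    finally show "(\<integral>\<^sup>+ ts. ?g i ts \<partial>PiM I (\<lambda>_. lborel)) = \<dots>" .
  qed
  finally show ?thesis .
qed

lemma weight_integral_cong:
  "(\<And>i. i \<in> I \<Longrightarrow> m i = m' i) \<Longrightarrow> weight_integral m I t \<sigma> \<tau> = weight_integral m' I t \<sigma> \<tau>"
  unfolding weight_integral_def by (auto intro!: nn_integral_cong arg_cong[of _ _ ennreal]
      ordered_weight_cong)

text \<open>The weights use [0,t), the Dyson terms the closed interval; the two differ at the single
  point \<open>t\<close>.\<close>

lemma nn_integral_dyson_step:
  assumes "0 \<le> t"
  shows "(\<integral>\<^sup>+ s. indicator {0..<t} s * ennreal (exp ((t - s) * b \<sigma>) *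
       (\<Sum>\<rho>\<in>C. A_tot \<sigma> \<rho> * dyson_term n s \<rho> \<tau>)) \<partial>lborel) = ennreal (dyson_term (Suc n) t \<sigma> \<tau>)"
proof -
  let ?f = "\<lambda>s. exp ((t - s) * b \<sigma>) * (\<Sum>\<rho>\<in>C. A_tot \<sigma> \<rho> * dyson_term n s \<rho> \<tau>)"
  have f0: "0 \<le> ?f s" for s by (intro mult_nonneg_nonneg sum_nonneg A_tot_nonneg
      dyson_term_nonneg) auto
  have cont: "continuous_on {0..t} ?f"
    by (intro continuous_intros continuous_dyson_term)
  have "(?f has_integral dyson_term (Suc n) t \<sigma> \<tau>) {0..t}"
    unfolding dyson_term_Suc using cont by (intro integrable_integral
        integrable_continuous_interval)
  then have hi: "((\<lambda>s. indicator {0..t} s * ?f s) has_integral dyson_term (Suc n) t \<sigma> \<tau>) UNIV"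
    by (subst (asm) has_integral_restrict_UNIV[symmetric]) (simp add: indicator_def of_bool_def
        if_distrib[of "\<lambda>c. c * _"] cong: if_cong)
  have meas: "(\<lambda>s. indicator {0..t} s * ?f s) \<in> borel_measurable borel"
    using borel_measurable_continuous_on_indicator[OF _ cont] by simp
  have "(\<integral>\<^sup>+ s. indicator {0..<t} s * ennreal (?f s) \<partial>lborel) =
      (\<integral>\<^sup>+ s. ennreal (indicator {0..t} s * ?f s) \<partial>lborel)"
  proof (rule nn_integral_cong_AE)
    show "AE s in lborel. indicator {0..<t} s * ennreal (?f s) = ennreal (indicator {0..t} s *
        ?f s)"
      using AE_lborel_singleton[of t] by eventually_elim (auto simp: indicator_def)
  qed
  also have "\<dots> = ennreal (dyson_term (Suc n) t \<sigma> \<tau>)"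
    using f0 by (intro nn_integral_has_integral_lborel meas hi) auto
  finally show ?thesis .
qed

text \<open>Any index may carry the latest time, and by induction all of them contribute the same
  value. Each level thus gives a factor equal to the number of remaining indices, in total n!, the
  number of orderings of the bridges.\<close>

lemma sum_weight_integral:
  assumes "finite I" "card I = n" "0 \<le> t"
  shows "(\<Sum>m\<in>I \<rightarrow>\<^sub>E X. ennreal (\<Prod>i\<in>I. w (m i)) * weight_integral m I t \<sigma> \<tau>) =
     ennreal (fact n * dyson_term n t \<sigma> \<tau>)"
  using assms
proof (induction n arbitrary: I t \<sigma>)
  case 0
  then show ?case
    by (simp add: weight_integral_def PiM_empty)
next
  case (Suc n)
  let ?W = "\<lambda>m J. ennreal (\<Prod>j\<in>J. w (m j))"
  have I: "I \<noteq> {}" using Suc.prems by auto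
  let ?h = "\<lambda>i m s. indicator {0..<t} s * (ennreal (exp ((t - s) * b \<sigma>)) *
       (\<Sum>\<rho>\<in>C. ennreal (A (m i) \<sigma> \<rho>) * weight_integral m (I - {i}) s \<rho> \<tau>))"
  have fin: "finite (I - {i})" for i using Suc.prems by simp
  note weight_integral_measurable[OF fin, measurable]
  have [measurable]: "?h i m \<in> borel_measurable borel" for i m by measurable
  have "(\<Sum>m\<in>I \<rightarrow>\<^sub>E X. ?W m I * weight_integral m I t \<sigma> \<tau>)
      = (\<Sum>m\<in>I \<rightarrow>\<^sub>E X. ?W m I * (\<Sum>i\<in>I. \<integral>\<^sup>+ s. ?h i m s \<partial>lborel))"
    using weight_integral_rec[OF Suc.prems(1) I] by simp
  also have "\<dots> = (\<Sum>i\<in>I. \<Sum>m\<in>I \<rightarrow>\<^sub>E X. \<integral>\<^sup>+ s. ?W m I * ?h i m s \<partial>lborel)"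
  proof -
    have "(\<integral>\<^sup>+ s. ?W m I * ?h i m s \<partial>lborel) = ?W m I * (\<integral>\<^sup>+ s. ?h i m s \<partial>lborel)" for i m
      by (rule nn_integral_cmult) measurable
    then show ?thesis by (subst sum.swap) (simp only: sum_distrib_left)
  qed
  also have "\<dots> = (\<Sum>i\<in>I. \<integral>\<^sup>+ s. (\<Sum>m\<in>I \<rightarrow>\<^sub>E X. ?W m I * ?h i m s) \<partial>lborel)"
    by (intro sum.cong refl nn_integral_sum[symmetric]) measurable
  \<comment> \<open>The summand no longer depends on \<open>i\<close>; the sum over \<open>I\<close>
    will supply the missing factor \<open>Suc n\<close>.\<close>
  also have "\<dots> = (\<Sum>i\<in>I. ennreal (fact n * dyson_term (Suc n) t \<sigma> \<tau>))"
  proof (rule sum.cong[OF refl])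
    fix i assume i: "i \<in> I"
    have cI: "card (I - {i}) = n" using Suc.prems i by simp
    have split: "(\<Sum>m\<in>I \<rightarrow>\<^sub>E X. ?W m I * ?h i m s) =
        ennreal (fact n) * (indicator {0..<t} s * ennreal (exp ((t - s) * b \<sigma>) *
       (\<Sum>\<rho>\<in>C. A_tot \<sigma> \<rho> * dyson_term n s \<rho> \<tau>)))" for s
    \<comment> \<open>The induction hypothesis needs a nonnegative time; outside the interval the
      indicator makes both sides 0.\<close>
    proof (cases "s \<in> {0..<t}")
      case True
      have "(\<Sum>m\<in>I \<rightarrow>\<^sub>E X. ?W m I * ?h i m s) =
         (\<Sum>y\<in>X. \<Sum>m\<in>(I - {i}) \<rightarrow>\<^sub>E X. (ennreal (w y) * ?W m (I - {i})) * (ennreal (exp ((t - s) *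
             b \<sigma>)) *
       (\<Sum>\<rho>\<in>C. ennreal (A y \<sigma> \<rho>) * weight_integral m (I - {i}) s \<rho> \<tau>)))"
        unfolding sum_PiE_remove[OF i]
      proof (intro sum.cong refl)
        fix y m assume y: "y \<in> X" and m: "m \<in> (I - {i}) \<rightarrow>\<^sub>E X"
        have "(\<Prod>j\<in>I. w ((m(i := y)) j)) = w y * (\<Prod>j\<in>I - {i}. w ((m(i := y)) j))"
          using i Suc.prems by (subst prod.remove[of _ i]) auto
        also have "(\<Prod>j\<in>I - {i}. w ((m(i := y)) j)) = (\<Prod>j\<in>I - {i}. w (m j))"
          by (intro prod.cong) auto
        finally have W: "?W (m(i := y)) I = ennreal (w y) * ?W m (I - {i})"
          using y m by (simp only:) (intro ennreal_mult prod_nonneg ballI w_nonneg; auto simp: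
              PiE_mem)
        have "weight_integral (m(i := y)) (I - {i}) s \<rho> \<tau> = weight_integral m (I - {i}) s \<rho> \<tau>" for \<rho>
          by (rule weight_integral_cong) auto
        then show "?W (m(i := y)) I * ?h i (m(i := y)) s = (ennreal (w y) * ?W m (I - {i})) *
            (ennreal (exp ((t - s) * b \<sigma>)) *
       (\<Sum>\<rho>\<in>C. ennreal (A y \<sigma> \<rho>) * weight_integral m (I - {i}) s \<rho> \<tau>))"
          using True W by simp
      qed
      also have "\<dots> = ennreal (exp ((t - s) * b \<sigma>)) * (\<Sum>\<rho>\<in>C. (\<Sum>y\<in>X. ennreal (w y) *
          ennreal (A y \<sigma> \<rho>)) *
          (\<Sum>m\<in>(I - {i}) \<rightarrow>\<^sub>E X. ?W m (I - {i}) * weight_integral m (I - {i}) s \<rho> \<tau>))"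
      proof -
        \<comment> \<open>The sum over the mark of the removed index separates from the sum over the
          other marks; the first becomes \<open>A_tot\<close>, the second is the induction
          hypothesis.\<close>
        have e: "(\<Sum>y\<in>X. \<Sum>m\<in>P. (wy y * W m) * (e * (\<Sum>\<rho>\<in>C. a y \<rho> * N m \<rho>))) =
           e * (\<Sum>\<rho>\<in>C. (\<Sum>y\<in>X. wy y * a y \<rho>) * (\<Sum>m\<in>P. W m * N m \<rho>))"
          for P :: "('b \<Rightarrow> 'm) set" and wy W e a and N :: "('b \<Rightarrow> 'm) \<Rightarrow> 'c \<Rightarrow> ennreal"
        proof -
          have "(\<Sum>y\<in>X. \<Sum>m\<in>P. (wy y * W m) * (e * (\<Sum>\<rho>\<in>C. a y \<rho> * N m \<rho>))) =
             (\<Sum>y\<in>X. \<Sum>m\<in>P. \<Sum>\<rho>\<in>C. e * ((wy y * a y \<rho>) * (W m * N m \<rho>)))"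
            by (simp add: sum_distrib_left mult_ac)
          also have "\<dots> = (\<Sum>y\<in>X. \<Sum>\<rho>\<in>C. \<Sum>m\<in>P. e * ((wy y * a y \<rho>) * (W m * N m \<rho>)))"
            by (intro sum.cong refl sum.swap)
          also have "\<dots> = (\<Sum>\<rho>\<in>C. \<Sum>y\<in>X. \<Sum>m\<in>P. e * ((wy y * a y \<rho>) * (W m * N m \<rho>)))"
            by (rule sum.swap)
          also have "\<dots> = e * (\<Sum>\<rho>\<in>C. (\<Sum>y\<in>X. wy y * a y \<rho>) * (\<Sum>m\<in>P. W m * N m \<rho>))"
            by (simp only: sum_distrib_left[symmetric] sum_distrib_right[symmetric])
          finally show ?thesis .
        qed
        show ?thesis by (rule e)
      qed
      also have "\<dots> = ennreal (exp ((t - s) * b \<sigma>)) *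
          (\<Sum>\<rho>\<in>C. ennreal (A_tot \<sigma> \<rho>) * (ennreal (fact n) * ennreal (dyson_term n s \<rho> \<tau>)))"
      proof -
        have "(\<Sum>y\<in>X. ennreal (w y) * ennreal (A y \<sigma> \<rho>)) = ennreal (A_tot \<sigma> \<rho>)" for \<rho>
          unfolding A_tot_def
          by (subst sum_ennreal[symmetric]) (auto simp: ennreal_mult A_nonneg w_nonneg intro!:
              sum.cong)
        moreover have "(\<Sum>m\<in>(I - {i}) \<rightarrow>\<^sub>E X. ?W m (I - {i}) * weight_integral m (I - {i}) s \<rho> \<tau>) =
            ennreal (fact n) * ennreal (dyson_term n s \<rho> \<tau>)" for \<rho>
          using True by (subst Suc.IH[OF fin cI]) (auto simp: ennreal_mult dyson_term_nonneg)
        ultimately show ?thesis by (simp only:)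
      qed
      also have "\<dots> = ennreal (fact n) * (ennreal (exp ((t - s) * b \<sigma>)) *
          (\<Sum>\<rho>\<in>C. ennreal (A_tot \<sigma> \<rho>) * ennreal (dyson_term n s \<rho> \<tau>)))"
        by (simp add: sum_distrib_left mult_ac)
      also have "\<dots> = ennreal (fact n) * (indicator {0..<t} s * ennreal (exp ((t - s) * b \<sigma>) *
       (\<Sum>\<rho>\<in>C. A_tot \<sigma> \<rho> * dyson_term n s \<rho> \<tau>)))"
      proof -
        have "ennreal (\<Sum>\<rho>\<in>C. A_tot \<sigma> \<rho> * dyson_term n s \<rho> \<tau>) = (\<Sum>\<rho>\<in>C. ennreal (A_tot \<sigma> \<rho>) *
            ennreal (dyson_term n s \<rho> \<tau>))"
          by (subst sum_ennreal[symmetric]) (auto simp: ennreal_mult A_tot_nonneg dyson_term_nonneg)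
        moreover have "0 \<le> (\<Sum>\<rho>\<in>C. A_tot \<sigma> \<rho> * dyson_term n s \<rho> \<tau>)"
          by (intro sum_nonneg mult_nonneg_nonneg A_tot_nonneg dyson_term_nonneg)
        ultimately show ?thesis using True by (simp add: ennreal_mult)
      qed
      finally show ?thesis .
    qed simp
    have [measurable]: "(\<lambda>s. indicator {0..<t} s * ennreal (exp ((t - s) * b \<sigma>) *
       (\<Sum>\<rho>\<in>C. A_tot \<sigma> \<rho> * dyson_term n s \<rho> \<tau>))) \<in> borel_measurable borel"
    proof -
      have "continuous_on {0..<t} (\<lambda>s. exp ((t - s) * b \<sigma>) * (\<Sum>\<rho>\<in>C. A_tot \<sigma> \<rho> *
          dyson_term n s \<rho> \<tau>))"
        by (intro continuous_intros continuous_on_subset[OF continuous_dyson_term[of t]]) auto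
      then have "(\<lambda>s. indicator {0..<t} s *\<^sub>R (exp ((t - s) * b \<sigma>) * (\<Sum>\<rho>\<in>C. A_tot \<sigma> \<rho> *
          dyson_term n s \<rho> \<tau>))) \<in> borel_measurable borel"
        by (intro borel_measurable_continuous_on_indicator) auto
      then have "(\<lambda>s. ennreal (indicator {0..<t} s *\<^sub>R (exp ((t - s) * b \<sigma>) * (\<Sum>\<rho>\<in>C. A_tot \<sigma> \<rho> *
          dyson_term n s \<rho> \<tau>)))) \<in> borel_measurable borel"
        by measurable
      also have "(\<lambda>s. ennreal (indicator {0..<t} s *\<^sub>R (exp ((t - s) * b \<sigma>) * (\<Sum>\<rho>\<in>C. A_tot \<sigma> \<rho> *
          dyson_term n s \<rho> \<tau>)))) =
         (\<lambda>s. indicator {0..<t} s * ennreal (exp ((t - s) * b \<sigma>) *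
       (\<Sum>\<rho>\<in>C. A_tot \<sigma> \<rho> * dyson_term n s \<rho> \<tau>)))"
        by (auto simp: fun_eq_iff indicator_def)
      finally show ?thesis .
    qed
    show "(\<integral>\<^sup>+ s. (\<Sum>m\<in>I \<rightarrow>\<^sub>E X. ?W m I * ?h i m s) \<partial>lborel) = ennreal (fact n *
        dyson_term (Suc n) t \<sigma> \<tau>)"
      unfolding split
      by (subst nn_integral_cmult) (simp_all add: nn_integral_dyson_step Suc.prems ennreal_mult
          dyson_term_nonneg)
  qed
  also have "\<dots> = ennreal (fact (Suc n) * dyson_term (Suc n) t \<sigma> \<tau>)"
    using Suc.prems by (simp add: ennreal_of_nat_eq_real_of_nat ennreal_mult[symmetric]
        dyson_term_nonneg mult.assoc del: of_nat_Suc)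
  finally show ?case .
qed

end

section \<open>Segments and spin paths\<close>

text \<open>The almost sure event: bridge times strictly inside (0,t), with no two different bridges
  at the same time. The end \<open>t\<close> is a parameter because removing the latest bridge
  shortens the interval.\<close>

definition good_bridges :: "site set \<Rightarrow> real \<Rightarrow> bridges \<Rightarrow> bool" where
  "good_bridges Lam t \<omega> \<longleftrightarrow> 0 < t \<and>
     (\<forall>x y s c. (x, y, s, c) \<in> set \<omega> \<longrightarrow> x \<in> Lam \<and> y \<in> Lam \<and> x \<noteq> y \<and> 0 < s \<and> s < t) \<and>
     (\<forall>x y s c x' y' c'. (x, y, s, c) \<in> set \<omega> \<longrightarrow> (x', y', s, c') \<in> set \<omega> \<longrightarrow> x = x' \<and> y = y' \<and> c = c')"

text \<open>The start of the segment at \<open>v\<close> that ends at time \<open>s\<close>; for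
  \<open>s = t\<close> it is the topmost segment. This inverts \<open>nxt\<close>.\<close>

definition prevcut :: "bridges \<Rightarrow> site \<Rightarrow> real \<Rightarrow> real" where
  "prevcut \<omega> v s = Max {r \<in> cut_times \<omega> v. r < s}"

lemma finite_cut_times [simp]: "finite (cut_times \<omega> v)"
proof -
  have "cut_times \<omega> v \<subseteq> insert 0 ((\<lambda>(x, y, t, c). t) ` set \<omega>)"
    unfolding cut_times_def by force
  then show ?thesis by (rule finite_subset) simp
qed

lemma zero_in_cut_times [simp]: "0 \<in> cut_times \<omega> v"
  by (simp add: cut_times_def)

lemma segs_Sigma: "segs Lam t \<omega> = (SIGMA v:Lam. {s \<in> cut_times \<omega> v. s < t})"
  by (auto simp: segs_def)

lemma finite_segs [simp]: "finite Lam \<Longrightarrow> finite (segs Lam t \<omega>)"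
  unfolding segs_Sigma by (intro finite_SigmaI) auto

lemma seg_link_segs: "(p, q) \<in> seg_link Lam t \<omega> M \<Longrightarrow> p \<in> segs Lam t \<omega> \<and> q \<in> segs Lam t \<omega>"
  by (simp add: seg_link_def)

context
  fixes Lam t \<omega>
  assumes good: "good_bridges Lam t \<omega>"
begin

lemma good_pos: "0 < t"
  using good by (simp add: good_bridges_def)

lemma good_bridgeD:
  assumes "(x, y, s, c) \<in> set \<omega>"
  shows "x \<in> Lam" "y \<in> Lam" "x \<noteq> y" "0 < s" "s < t"
  using good assms by (auto simp: good_bridges_def)

lemma good_bridge_unique:
  "(x, y, s, c) \<in> set \<omega> \<Longrightarrow> (x', y', s, c') \<in> set \<omega> \<Longrightarrow> x = x' \<and> y = y' \<and> c = c'"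
  using good unfolding good_bridges_def by blast

lemma cut_times_bounds:
  assumes "r \<in> cut_times \<omega> v"
  shows "0 \<le> r" "r < t"
proof -
  have "r = 0 \<or> (\<exists>x y c. (x, y, r, c) \<in> set \<omega>)"
    using assms unfolding cut_times_def by blast
  then have "0 \<le> r \<and> r < t"
  proof (elim disjE exE)
    fix x y c assume "(x, y, r, c) \<in> set \<omega>"
    from good_bridgeD(4,5)[OF this] show ?thesis by simp
  qed (simp add: good_pos)
  then show "0 \<le> r" "r < t" by auto
qed

lemma segs_good: "segs Lam t \<omega> = (SIGMA v:Lam. cut_times \<omega> v)"
  using cut_times_bounds by (auto simp: segs_def)

lemma prevcut_less:
  assumes "0 < s"
  shows "prevcut \<omega> v s \<in> cut_times \<omega> v" "prevcut \<omega> v s < s"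
proof -
  have "prevcut \<omega> v s \<in> {r \<in> cut_times \<omega> v. r < s}"
    unfolding prevcut_def using assms by (intro Max_in) (auto intro!: exI[of _ 0])
  then show "prevcut \<omega> v s \<in> cut_times \<omega> v" "prevcut \<omega> v s < s" by auto
qed

lemma prevcut_ge: "r \<in> cut_times \<omega> v \<Longrightarrow> r < s \<Longrightarrow> r \<le> prevcut \<omega> v s"
  unfolding prevcut_def by (intro Max_ge) auto

text \<open>On a good realization \<open>nxt\<close> and \<open>prevcut\<close> are mutually inverse
  between starts and ends of segments. The conditions \<open>nxt ... = s\<close> in
  \<open>seg_link\<close> can thus be solved for the segment.\<close>

lemma nxt_eq_iff:
  assumes "r \<in> cut_times \<omega> v" "s \<in> cut_times \<omega> v \<or> s = t" "0 < s"
  shows "nxt t \<omega> v r = s \<longleftrightarrow> r = prevcut \<omega> v s"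
proof
  let ?A = "{c \<in> cut_times \<omega> v. r < c} \<union> {t}"
  assume n: "nxt t \<omega> v r = s"
  have "Min ?A \<in> ?A" by (intro Min_in) auto
  then have rs: "r < s" using n cut_times_bounds(2)[OF assms(1)] by (auto simp: nxt_def)
  have "r = prevcut \<omega> v s"
  proof (rule ccontr)
    assume "r \<noteq> prevcut \<omega> v s"
    then have "r < prevcut \<omega> v s" using prevcut_ge[OF assms(1) rs] by simp
    then have "Min ?A \<le> prevcut \<omega> v s" using prevcut_less[OF assms(3)] by (intro Min_le) auto
    then show False using n prevcut_less(2)[OF assms(3), of v] by (auto simp: nxt_def)
  qed
  then show "r = prevcut \<omega> v s" .
next
  assume r: "r = prevcut \<omega> v s"
  show "nxt t \<omega> v r = s"
    unfolding nxt_def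
  proof (rule Min_eqI)
    show "s \<in> {c \<in> cut_times \<omega> v. r < c} \<union> {t}"
      using assms prevcut_less(2)[OF assms(3)] r by auto
    fix c assume "c \<in> {c \<in> cut_times \<omega> v. r < c} \<union> {t}"
    then show "s \<le> c"
      using assms(2) cut_times_bounds(2)[of s v] prevcut_ge[of c v s] r by force
  qed simp
qed

lemma nxt_in: 
  assumes "r \<in> cut_times \<omega> v"
  shows "nxt t \<omega> v r \<in> cut_times \<omega> v \<or> nxt t \<omega> v r = t" "r < nxt t \<omega> v r" "0 < nxt t \<omega> v r"
proof -
  let ?A = "{c \<in> cut_times \<omega> v. r < c} \<union> {t}"
  have "Min ?A \<in> ?A" by (intro Min_in) auto
  then show "nxt t \<omega> v r \<in> cut_times \<omega> v \<or> nxt t \<omega> v r = t" and *: "r < nxt t \<omega> v r"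
    using cut_times_bounds(2)[OF assms] by (auto simp: nxt_def)
  show "0 < nxt t \<omega> v r" using * cut_times_bounds(1)[OF assms] by simp
qed

lemma bridge_cut:
  assumes "(x, y, s, c) \<in> set \<omega>" "v = x \<or> v = y"
  shows "s \<in> cut_times \<omega> v"
  using assms unfolding cut_times_def by blast

text \<open>At a bridge time \<open>s\<close> the segment below is
  \<open>(v, prevcut \<omega> v s)\<close> and the one above is \<open>(v, s)\<close>; in these
  terms every link is an explicit pair.\<close>

lemma seg_link_iff:
  "(p, q) \<in> seg_link Lam t \<omega> M \<longleftrightarrow>
     (\<exists>v\<in>Lam - M. p = (v, prevcut \<omega> v t) \<and> q = (v, 0)) \<or>
     (\<exists>x y s c v w. (x, y, s, c) \<in> set \<omega> \<and> ((v, w) = (x, y) \<or> (v, w) = (y, x)) \<and>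
        (if c then p = (v, prevcut \<omega> v s) \<and> q = (w, s)
         else p = (v, prevcut \<omega> v s) \<and> q = (w, prevcut \<omega> w s) \<or> p = (v, s) \<and> q = (w, s)))"
    (is "_ \<longleftrightarrow> ?W \<or> ?B")
proof
  assume L: "(p, q) \<in> seg_link Lam t \<omega> M"
  have p: "fst p \<in> Lam" "snd p \<in> cut_times \<omega> (fst p)" and q: "fst q \<in> Lam"
      "snd q \<in> cut_times \<omega> (fst q)"
    using seg_link_segs[OF L] by (auto simp: segs_good)
  from L consider
      "fst p = fst q \<and> snd q = 0 \<and> nxt t \<omega> (fst p) (snd p) = t \<and> fst p \<notin> M"
    | x y s c v w where "(x, y, s, c) \<in> set \<omega>" "(v, w) = (x, y) \<or> (v, w) = (y, x)"
       "if c then fst p = v \<and> nxt t \<omega> v (snd p) = s \<and> q = (w, s)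
        else (fst p = v \<and> nxt t \<omega> v (snd p) = s \<and> fst q = w \<and> nxt t \<omega> w (snd q) = s)
                    \<or> (p = (v, s) \<and> q = (w, s))"
    unfolding seg_link_def by blast
  then show "?W \<or> ?B"
  proof cases
    case 1
    then have "snd p = prevcut \<omega> (fst p) t"
      using nxt_eq_iff[OF p(2), of t] good_pos by simp
    then have ?W using 1 p by (intro bexI[of _ "fst p"]) (auto simp: prod_eq_iff)
    then show ?thesis ..
  next
    case 2
    have cuts: "s \<in> cut_times \<omega> v" "s \<in> cut_times \<omega> w" "0 < s"
      using bridge_cut[OF 2(1)] good_bridgeD[OF 2(1)] 2(2) by auto
    have "snd p = prevcut \<omega> v s" if "fst p = v" "nxt t \<omega> v (snd p) = s"
      using nxt_eq_iff[of "snd p" v s] p(2) cuts that by auto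
    moreover have "snd q = prevcut \<omega> w s" if "fst q = w" "nxt t \<omega> w (snd q) = s"
      using nxt_eq_iff[of "snd q" w s] q(2) cuts that by auto
    ultimately have "if c then p = (v, prevcut \<omega> v s) \<and> q = (w, s)
         else p = (v, prevcut \<omega> v s) \<and> q = (w, prevcut \<omega> w s) \<or> p = (v, s) \<and> q = (w, s)"
      using 2(3) by (cases c) (auto simp: prod_eq_iff)
    then have ?B using 2(1,2) by blast
    then show ?thesis ..
  qed
next
  assume "?W \<or> ?B"
  then show "(p, q) \<in> seg_link Lam t \<omega> M"
  proof
    assume ?W
    then obtain v where v: "v \<in> Lam" "v \<notin> M" "p = (v, prevcut \<omega> v t)" "q = (v, 0)" by auto
    have "nxt t \<omega> v (prevcut \<omega> v t) = t"
      using nxt_eq_iff[of "prevcut \<omega> v t" v t] prevcut_less[OF good_pos] good_pos by auto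
    then show ?thesis using v prevcut_less[OF good_pos, of v] good_pos
      by (auto simp: seg_link_def segs_good)
  next
    assume ?B
    then obtain x y s c v w where b: "(x, y, s, c) \<in> set \<omega>" "(v, w) = (x, y) \<or> (v, w) = (y, x)"
      and pq: "if c then p = (v, prevcut \<omega> v s) \<and> q = (w, s)
         else p = (v, prevcut \<omega> v s) \<and> q = (w, prevcut \<omega> w s) \<or> p = (v, s) \<and> q = (w, s)"
      by blast
    have cuts: "s \<in> cut_times \<omega> v" "s \<in> cut_times \<omega> w" "0 < s" "v \<in> Lam" "w \<in> Lam"
      using bridge_cut[OF b(1)] good_bridgeD[OF b(1)] b(2) by auto
    note pl = prevcut_less(1)[OF cuts(3)]
    have n: "nxt t \<omega> v (prevcut \<omega> v s) = s" "nxt t \<omega> w (prevcut \<omega> w s) = s"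
      using nxt_eq_iff[OF pl _ cuts(3)] cuts by auto
    have "p \<in> segs Lam t \<omega>" "q \<in> segs Lam t \<omega>"
      using pq pl cuts by (auto simp: segs_good split: if_splits)
    moreover have "if c then fst p = v \<and> nxt t \<omega> v (snd p) = s \<and> q = (w, s)
               else (fst p = v \<and> nxt t \<omega> v (snd p) = s \<and> fst q = w \<and> nxt t \<omega> w (snd q) = s)
                    \<or> (p = (v, s) \<and> q = (w, s))"
      using pq n by (auto split: if_splits)
    ultimately show ?thesis unfolding seg_link_def using b by blast
  qed
qed

lemma seg_link_bridgeI:
  assumes "(x, y, s, c) \<in> set \<omega>" "(v, w) = (x, y) \<or> (v, w) = (y, x)"
    "if c then p = (v, prevcut \<omega> v s) \<and> q = (w, s)
     else p = (v, prevcut \<omega> v s) \<and> q = (w, prevcut \<omega> w s) \<or> p = (v, s) \<and> q = (w, s)"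
  shows "(p, q) \<in> seg_link Lam t \<omega> M"
  unfolding seg_link_iff using assms by blast

text \<open>By symmetry of the equations a bridge need only be read in its listed orientation. The
  two equations of a bridge are those under which the matrix entry of T or Q at its two sites is
  1.\<close>

lemma respects_seg_link_iff:
  "(\<forall>(p, q)\<in>seg_link Lam t \<omega> M. f p = f q) \<longleftrightarrow>
     (\<forall>v\<in>Lam - M. f (v, prevcut \<omega> v t) = f (v, 0)) \<and>
     (\<forall>x y s c. (x, y, s, c) \<in> set \<omega> \<longrightarrow>
        (if c then f (x, prevcut \<omega> x s) = f (y, s) \<and> f (y, prevcut \<omega> y s) = f (x, s)
         else f (x, prevcut \<omega> x s) = f (y, prevcut \<omega> y s) \<and> f (x, s) = f (y, s)))"
   (is "?L \<longleftrightarrow> ?W \<and> ?B")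
proof (rule iffI)
  assume L: ?L
  show "?W \<and> ?B"
  proof (intro conjI ballI allI impI)
    show "f (v, prevcut \<omega> v t) = f (v, 0)" if "v \<in> Lam - M" for v
      using L that seg_link_iff[of "(v, prevcut \<omega> v t)" "(v, 0)" M] by blast
    fix x y s c assume b: "(x, y, s, c) \<in> set \<omega>"
    show "if c then f (x, prevcut \<omega> x s) = f (y, s) \<and> f (y, prevcut \<omega> y s) = f (x, s)
           else f (x, prevcut \<omega> x s) = f (y, prevcut \<omega> y s) \<and> f (x, s) = f (y, s)"
    proof (cases c)
      case True
      then have "((x, prevcut \<omega> x s), (y, s)) \<in> seg_link Lam t \<omega> M" "((y, prevcut \<omega> y s), (x,
          s)) \<in> seg_link Lam t \<omega> M"
        using seg_link_bridgeI[OF b, of x y] seg_link_bridgeI[OF b, of y x] by auto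
      then show ?thesis using L True by auto
    next
      case False
      then have "((x, prevcut \<omega> x s), (y, prevcut \<omega> y s)) \<in> seg_link Lam t \<omega> M" "((x, s), (y,
          s)) \<in> seg_link Lam t \<omega> M"
        using seg_link_bridgeI[OF b, of x y] by auto
      then show ?thesis using L False by auto
    qed
  qed
next
  assume R: "?W \<and> ?B"
  have "f p = f q" if "(p, q) \<in> seg_link Lam t \<omega> M" for p q
    using that unfolding seg_link_iff
  proof (elim disjE exE conjE bexE)
    fix x y s c v w
    assume b: "(x, y, s, c) \<in> set \<omega>" "(v, w) = (x, y)"
      "if c then p = (v, prevcut \<omega> v s) \<and> q = (w, s)
         else p = (v, prevcut \<omega> v s) \<and> q = (w, prevcut \<omega> w s) \<or> p = (v, s) \<and> q = (w, s)"
    show "f p = f q" using R[THEN conjunct2, rule_format, OF b(1)] b(2,3) by (cases c) auto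
  next
    fix x y s c v w
    assume b: "(x, y, s, c) \<in> set \<omega>" "(v, w) = (y, x)"
      "if c then p = (v, prevcut \<omega> v s) \<and> q = (w, s)
         else p = (v, prevcut \<omega> v s) \<and> q = (w, prevcut \<omega> w s) \<or> p = (v, s) \<and> q = (w, s)"
    show "f p = f q" using R[THEN conjunct2, rule_format, OF b(1)] b(2,3) by (cases c) auto
  qed (use R in auto)
  then show ?L by auto
qed

end

section \<open>Spin assignments and their weights\<close>

definition energy :: "site set \<Rightarrow> nat \<Rightarrow> (site \<Rightarrow> real) \<Rightarrow> real \<Rightarrow> bridges \<Rightarrow> (site \<times> real \<Rightarrow> nat) \<Rightarrow>
    real" where
  "energy Lam twoS h t \<omega> f = (\<Sum>p\<in>segs Lam t \<omega>. h (fst p) * seglen t \<omega> p * spinval twoS (f p))"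

text \<open>\<open>M\<close> is the set of sites left open at time 0: \<open>M = Lam\<close> gives
  paths on a time interval, \<open>M = {}\<close> paths on the time circle, and two open sites serve
  the two-point function.\<close>

definition spin_paths :: "site set \<Rightarrow> nat \<Rightarrow> real \<Rightarrow> bridges \<Rightarrow> site set \<Rightarrow> (site \<times> real \<Rightarrow> nat) set"
    where
  "spin_paths Lam twoS t \<omega> M = {f \<in> segs Lam t \<omega> \<rightarrow>\<^sub>E {..twoS}. \<forall>(p, q)\<in>seg_link Lam t \<omega> M. f p =
      f q}"

definition bottom_cfg :: "site set \<Rightarrow> (site \<times> real \<Rightarrow> nat) \<Rightarrow> cfg" where
  "bottom_cfg Lam f = (\<lambda>v\<in>Lam. f (v, 0))"

definition top_cfg :: "site set \<Rightarrow> real \<Rightarrow> bridges \<Rightarrow> (site \<times> real \<Rightarrow> nat) \<Rightarrow> cfg" where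
  "top_cfg Lam t \<omega> f = (\<lambda>v\<in>Lam. f (v, prevcut \<omega> v t))"

text \<open>Matrix element of the time-ordered product for a fixed realization.
  \<open>\<tau>\<close> sits at time 0 and \<open>\<sigma>\<close> at time \<open>t\<close>, so
  later bridges act further to the left.\<close>

definition path_weight :: "site set \<Rightarrow> nat \<Rightarrow> (site \<Rightarrow> real) \<Rightarrow> real \<Rightarrow> bridges \<Rightarrow> cfg \<Rightarrow> cfg \<Rightarrow> real" where
  "path_weight Lam twoS h t \<omega> \<sigma> \<tau> =
     (\<Sum>f | f \<in> spin_paths Lam twoS t \<omega> Lam \<and> top_cfg Lam t \<omega> f = \<sigma> \<and> bottom_cfg Lam f = \<tau>.
        exp (energy Lam twoS h t \<omega> f))"

definition field_energy :: "site set \<Rightarrow> nat \<Rightarrow> (site \<Rightarrow> real) \<Rightarrow> cfg \<Rightarrow> real" where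
  "field_energy Lam twoS h \<sigma> = (\<Sum>v\<in>Lam. h v * spinval twoS (\<sigma> v))"

text \<open>T and Q as one family of real matrices indexed by marks: type \<open>True\<close> is the
  transposition, type \<open>False\<close> is Q.\<close>

definition bridge_op :: "(site \<times> site) \<times> bool \<Rightarrow> cfg \<Rightarrow> cfg \<Rightarrow> real" where
  "bridge_op = (\<lambda>((x, y), c) \<sigma> \<rho>.
     if (if c then \<sigma> x = \<rho> y \<and> \<sigma> y = \<rho> x else \<sigma> x = \<sigma> y \<and> \<rho> x = \<rho> y) \<and>
        (\<forall>v. v \<noteq> x \<and> v \<noteq> y \<longrightarrow> \<sigma> v = \<rho> v) then 1 else 0)"

lemma finite_spin_paths: "finite Lam \<Longrightarrow> finite (spin_paths Lam twoS t \<omega> M)"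
  unfolding spin_paths_def by (rule finite_subset[of _ "segs Lam t \<omega> \<rightarrow>\<^sub>E {..twoS}"]) (auto intro!:
      finite_PiE)

lemma finite_configs: "finite Lam \<Longrightarrow> finite (configs Lam twoS)"
  unfolding configs_def by (intro finite_PiE) auto

lemma top_cfg_in_configs:
  assumes "good_bridges Lam t \<omega>" "f \<in> spin_paths Lam twoS t \<omega> M"
  shows "top_cfg Lam t \<omega> f \<in> configs Lam twoS" "bottom_cfg Lam f \<in> configs Lam twoS"
proof -
  have "(v, prevcut \<omega> v t) \<in> segs Lam t \<omega>" "(v, 0) \<in> segs Lam t \<omega>" if "v \<in> Lam" for v
    using that prevcut_less[OF assms(1) good_pos[OF assms(1)],
        of v] by (auto simp: segs_good[OF assms(1)])
  then show "top_cfg Lam t \<omega> f \<in> configs Lam twoS" "bottom_cfg Lam f \<in> configs Lam twoS"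
    using assms(2) unfolding top_cfg_def bottom_cfg_def configs_def spin_paths_def
    by (auto simp del: atMost_iff intro: PiE_mem)
qed

section \<open>Removing the latest bridge\<close>

context
  fixes Lam :: "site set" and t s :: real and \<omega> \<omega>' :: bridges and x y :: site and c :: bool
    and twoS :: nat and h :: "site \<Rightarrow> real"
  assumes good: "good_bridges Lam t \<omega>" and set_\<omega>: "set \<omega> = insert (x, y, s, c) (set \<omega>')"
    and latest: "\<And>x' y' s' c'. (x', y', s', c') \<in> set \<omega>' \<Longrightarrow> s' < s"
    and fin: "finite Lam"
begin

lemma last_bridge: "(x, y, s, c) \<in> set \<omega>" "x \<in> Lam" "y \<in> Lam" "x \<noteq> y" "0 < s" "s < t"
  using good_bridgeD[OF good, of x y s c] set_\<omega> by auto

lemma good': "good_bridges Lam s \<omega>'"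
  unfolding good_bridges_def
proof (intro conjI allI impI)
  fix x' y' s' c' assume b: "(x', y', s', c') \<in> set \<omega>'"
  then have b': "(x', y', s', c') \<in> set \<omega>" by (simp add: set_\<omega>)
  show "x' \<in> Lam" "y' \<in> Lam" "x' \<noteq> y'" "0 < s'" "s' < s"
    using good_bridgeD[OF good b'] latest[OF b] by auto
  fix x'' y'' c'' assume "(x'', y'', s', c'') \<in> set \<omega>'"
  then have "(x'', y'', s', c'') \<in> set \<omega>" by (simp add: set_\<omega>)
  from good_bridge_unique[OF good b' this] show "x' = x''" "y' = y''" "c' = c''" by auto
qed (rule last_bridge(5))

lemma cut_times_last: "cut_times \<omega> v = (if v = x \<or> v =
    y then insert s (cut_times \<omega>' v) else cut_times \<omega>' v)"
  unfolding cut_times_def set_\<omega> by auto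

lemma segs_last: "segs Lam t \<omega> = insert (x, s) (insert (y, s) (segs Lam s \<omega>'))"
  unfolding segs_good[OF good] segs_good[OF good'] cut_times_last using last_bridge by (auto
      split: if_splits)

lemma last_notin: "(v, s) \<notin> segs Lam s \<omega>'"
  by (simp add: segs_def)

lemma prevcut_last_less: "s' \<le> s \<Longrightarrow> prevcut \<omega> v s' = prevcut \<omega>' v s'"
  unfolding prevcut_def cut_times_last by (rule arg_cong[of _ _ Max]) auto

text \<open>The latest bridge opens a new top segment at its two sites; at all other sites the old
  top segment is prolonged from \<open>s\<close> to \<open>t\<close>.\<close>

lemma prevcut_last: "prevcut \<omega> v t = (if v = x \<or> v = y then s else prevcut \<omega>' v s)"
proof (cases "v = x \<or> v = y")
  case True
  show ?thesis using True last_bridge(6) cut_times_bounds(2)[OF good']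
    unfolding prevcut_def cut_times_last by (auto intro!: Max_eqI intro: less_imp_le)
next
  case False
  have "{r \<in> cut_times \<omega>' v. r < t} = {r \<in> cut_times \<omega>' v. r < s}"
    using cut_times_bounds(2)[OF good', of _ v] last_bridge(6) by force
  then show ?thesis using False unfolding prevcut_def cut_times_last by simp
qed

text \<open>Up to time \<open>s\<close> the cuts of both realizations agree, so earlier bridges keep
  their equations and the latest one adds its own two. With every site open there are no wrap-around
  equations.\<close>

lemma respects_last:
  "(\<forall>(p, q)\<in>seg_link Lam t \<omega> Lam. f p = f q) \<longleftrightarrow>
   (\<forall>(p, q)\<in>seg_link Lam s \<omega>' Lam. f p = f q) \<and>
   (if c then f (x, prevcut \<omega>' x s) = f (y, s) \<and> f (y, prevcut \<omega>' y s) = f (x, s)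
         else f (x, prevcut \<omega>' x s) = f (y, prevcut \<omega>' y s) \<and> f (x, s) = f (y, s))"
proof -
  define B where "B \<eta> x y s c \<longleftrightarrow> (if c then f (x, prevcut \<eta> x s) = f (y, s) \<and> f (y,
      prevcut \<eta> y s) = f (x, s)
         else f (x, prevcut \<eta> x s) = f (y, prevcut \<eta> y s) \<and> f (x, s) = f (y, s))" for \<eta> x y s c
  have *: "B \<omega> x' y' s' c' = B \<omega>' x' y' s' c'" if "(x', y', s', c') \<in> set \<omega>" for x' y' s' c'
  proof -
    have "s' \<le> s" using that latest[of x' y' s' c'] by (auto simp: set_\<omega>)
    then show ?thesis unfolding B_def by (simp only: prevcut_last_less)
  qed
  have "(\<forall>x y s c. (x, y, s, c) \<in> set \<omega> \<longrightarrow> B \<omega> x y s c) \<longleftrightarrow>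
     (\<forall>x y s c. (x, y, s, c) \<in> set \<omega>' \<longrightarrow> B \<omega>' x y s c) \<and> B \<omega>' x y s c"
    using * unfolding set_\<omega> by (metis insert_iff prod.inject)
  then show ?thesis
    unfolding respects_seg_link_iff[OF good] respects_seg_link_iff[OF good'] B_def by simp
qed

lemma nxt_last:
  assumes r: "r \<in> cut_times \<omega>' v"
  shows "nxt t \<omega> v r = nxt s \<omega>' v r + (if r = prevcut \<omega>' v s \<and> v \<noteq> x \<and> v \<noteq> y then t - s else 0)"
proof -
  have rc: "r \<in> cut_times \<omega> v" using r by (auto simp: cut_times_last)
  have n: "nxt s \<omega>' v r \<in> cut_times \<omega>' v \<or> nxt s \<omega>' v r = s" "0 < nxt s \<omega>' v r"
    using nxt_in[OF good' r] by auto
  have le: "nxt s \<omega>' v r \<le> s" using n cut_times_bounds(2)[OF good', of _ v] by force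
  show ?thesis
  proof (cases "r = prevcut \<omega>' v s \<and> v \<noteq> x \<and> v \<noteq> y")
    case True
    have "nxt s \<omega>' v r = s" using nxt_eq_iff[OF good' r, of s] last_bridge True by auto
    moreover have "nxt t \<omega> v r = t"
      using nxt_eq_iff[OF good rc, of t] last_bridge True prevcut_last by auto
    ultimately show ?thesis using True by simp
  next
    case False
    have "nxt s \<omega>' v r \<in> cut_times \<omega> v"
    proof (cases "nxt s \<omega>' v r = s")
      case True
      then have "r = prevcut \<omega>' v s" using nxt_eq_iff[OF good' r, of s] last_bridge by auto
      then show ?thesis using False True by (auto simp: cut_times_last)
    qed (use n in \<open>auto simp: cut_times_last\<close>)
    then have "nxt t \<omega> v r = nxt s \<omega>' v r \<longleftrightarrow> r = prevcut \<omega> v (nxt s \<omega>' v r)"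
      using nxt_eq_iff[OF good rc] n by blast
    also have "\<dots> \<longleftrightarrow> nxt s \<omega>' v r = nxt s \<omega>' v r"
      using nxt_eq_iff[OF good' r n] prevcut_last_less[OF le] by simp
    finally show ?thesis using False by auto
  qed
qed

text \<open>Passing from \<open>s\<close> to \<open>t\<close> adds at each site a piece of length
  \<open>t - s\<close> that carries the top spin: a new segment at the two sites of the bridge, a
  prolongation elsewhere.\<close>

lemma energy_last:
  "energy Lam twoS h t \<omega> f = energy Lam twoS h s \<omega>' f + (t - s) *
      field_energy Lam twoS h (top_cfg Lam t \<omega> f)"
proof -
  have E: "energy Lam twoS h t \<omega> f = (\<Sum>v\<in>Lam. \<Sum>r\<in>cut_times \<omega> v. h v * (nxt t \<omega> v r - r) *
      spinval twoS (f (v, r)))"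
    if "good_bridges Lam t \<omega>" for t \<omega>
    unfolding energy_def segs_good[OF that] seglen_def using fin by (subst sum.Sigma) (auto simp:
        split_def)
  show ?thesis
    unfolding E[OF good] E[OF good'] field_energy_def sum_distrib_left sum.distrib[symmetric]
  proof (rule sum.cong[OF refl])
    fix v assume v: "v \<in> Lam"
    have top: "top_cfg Lam t \<omega> f v = f (v, prevcut \<omega> v t)" using v by (simp add: top_cfg_def)
    let ?g = "\<lambda>r. h v * (nxt s \<omega>' v r - r) * spinval twoS (f (v, r))"
    show "(\<Sum>r\<in>cut_times \<omega> v. h v * (nxt t \<omega> v r - r) * spinval twoS (f (v, r))) =
       (\<Sum>r\<in>cut_times \<omega>' v. ?g r) + (t - s) * (h v * spinval twoS (top_cfg Lam t \<omega> f v))"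
    proof (cases "v = x \<or> v = y")
      case True
      have "s \<notin> cut_times \<omega>' v" using cut_times_bounds(2)[OF good'] by blast
      moreover have "nxt t \<omega> v s = t"
        using nxt_eq_iff[OF good, of s v t] True prevcut_last last_bridge by (auto simp:
            cut_times_last)
      ultimately show ?thesis
        using True nxt_last[of _ v] unfolding cut_times_last top prevcut_last
        by (auto simp: algebra_simps intro!: sum.cong)
    next
      case False
      let ?p = "prevcut \<omega>' v s"
      have p: "?p \<in> cut_times \<omega>' v" using prevcut_less[OF good'] last_bridge by blast
      have "(\<Sum>r\<in>cut_times \<omega>' v. h v * (nxt t \<omega> v r - r) * spinval twoS (f (v, r))) =
        (\<Sum>r\<in>cut_times \<omega>' v. ?g r + (if r = ?p then (t - s) * (h v * spinval twoS (f (v,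
            r))) else 0))"
        using False nxt_last[of _ v] by (intro sum.cong refl) (auto simp: algebra_simps)
      also have "\<dots> = (\<Sum>r\<in>cut_times \<omega>' v. ?g r) + (t - s) * (h v * spinval twoS (f (v, ?p)))"
        using p by (simp add: sum.distrib sum.delta)
      finally show ?thesis using False unfolding cut_times_last top prevcut_last by simp
    qed
  qed
qed

lemma energy_restrict: "energy Lam twoS h s \<omega>' (restrict f (segs Lam s \<omega>')) =
    energy Lam twoS h s \<omega>' f"
  unfolding energy_def by (intro sum.cong) auto

text \<open>Cutting a path just above the latest bridge leaves a path of the shorter realization,
  and the part cut off is determined by the top configuration. This is the step of the Dyson
  recursion for a fixed realization.\<close>

lemma path_weight_last:
  assumes \<sigma>: "\<sigma> \<in> configs Lam twoS"
  shows "path_weight Lam twoS h t \<omega> \<sigma> \<tau> = exp ((t - s) * field_energy Lam twoS h \<sigma>) *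
    (\<Sum>\<rho>\<in>configs Lam twoS. bridge_op ((x, y), c) \<sigma> \<rho> * path_weight Lam twoS h s \<omega>' \<rho> \<tau>)"
proof -
  let ?S = "segs Lam s \<omega>'" and ?S' = "segs Lam t \<omega>"
  let ?P = "{f. f \<in> spin_paths Lam twoS t \<omega> Lam \<and> top_cfg Lam t \<omega> f = \<sigma> \<and> bottom_cfg Lam f = \<tau>}"
  \<comment> \<open>The matrix entry takes only the values 0 and 1, so \<open>= 1\<close> says that
    the configuration just below the bridge is compatible with \<open>\<sigma>\<close> above
    it.\<close>
  let ?Q = "{f. f \<in> spin_paths Lam twoS s \<omega>' Lam \<and> bridge_op ((x, y), c) \<sigma> (top_cfg Lam s \<omega>' f) =
      1 \<and> bottom_cfg Lam f = \<tau>}"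
  \<comment> \<open>The two new segments must carry the spins prescribed by the top
    configuration.\<close>
  let ?ext = "\<lambda>f. f((x, s) := \<sigma> x, (y, s) := \<sigma> y)"
  let ?E = "field_energy Lam twoS h \<sigma>"
  have \<sigma>K: "\<sigma> v \<le> twoS" if "v \<in> Lam" for v using \<sigma> that by (auto simp: configs_def PiE_iff)
  have \<sigma>0: "\<sigma> v = undefined" if "v \<notin> Lam" for v using \<sigma> that by (auto simp: configs_def PiE_iff
      extensional_def)
  have pS: "(v, prevcut \<omega>' v s) \<in> ?S" if "v \<in> Lam" for v
    using that prevcut_less[OF good'] last_bridge by (auto simp: segs_good[OF good'])
  have zS: "(v, 0) \<in> ?S" if "v \<in> Lam" for v
    using that by (auto simp: segs_good[OF good'])
  have linkS: "p \<in> ?S \<and> q \<in> ?S" if "(p, q) \<in> seg_link Lam s \<omega>' Lam" for p q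
    using seg_link_segs[OF that] .
  have n0: "s \<noteq> 0" "prevcut \<omega>' v s \<noteq> s" for v
    using last_bridge prevcut_less(2)[OF good', of s v] by auto
  have top_iff: "top_cfg Lam t \<omega> f = \<sigma> \<longleftrightarrow> f (x, s) = \<sigma> x \<and> f (y, s) = \<sigma> y \<and>
     (\<forall>v. v \<noteq> x \<and> v \<noteq> y \<longrightarrow> \<sigma> v = top_cfg Lam s \<omega>' f v)" for f
    unfolding fun_eq_iff[of "top_cfg Lam t \<omega> f" \<sigma>] top_cfg_def prevcut_last
    using \<sigma>0 last_bridge(2,3) by (auto simp: restrict_def)
  have bridge_iff: "bridge_op ((x, y), c) \<sigma> (top_cfg Lam s \<omega>' f) = 1 \<longleftrightarrow>
      (if c then f (x, prevcut \<omega>' x s) = \<sigma> y \<and> f (y, prevcut \<omega>' y s) = \<sigma> x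
         else f (x, prevcut \<omega>' x s) = f (y, prevcut \<omega>' y s) \<and> \<sigma> x = \<sigma> y) \<and>
      (\<forall>v. v \<noteq> x \<and> v \<noteq> y \<longrightarrow> \<sigma> v = top_cfg Lam s \<omega>' f v)" for f
  proof -
    define Q where "Q \<longleftrightarrow> (\<forall>v. v \<noteq> x \<and> v \<noteq> y \<longrightarrow> \<sigma> v = top_cfg Lam s \<omega>' f v)"
    have "top_cfg Lam s \<omega>' f x = f (x, prevcut \<omega>' x s)" "top_cfg Lam s \<omega>' f y = f (y,
        prevcut \<omega>' y s)"
      using last_bridge(2,3) by (simp_all add: top_cfg_def)
    then show ?thesis
      unfolding bridge_op_def prod.case Q_def[symmetric] by (cases c; cases Q) auto
  qed
  have "path_weight Lam twoS h t \<omega> \<sigma> \<tau> = (\<Sum>f\<in>?Q. exp ((t - s) * ?E) *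
      exp (energy Lam twoS h s \<omega>' f))"
    unfolding path_weight_def
  proof (rule sum.reindex_bij_witness[of _ ?ext "\<lambda>f. restrict f ?S"])
    fix f assume f: "f \<in> ?P"
    have fE: "f \<in> ?S' \<rightarrow>\<^sub>E {..twoS}" and resp: "\<forall>(p, q)\<in>seg_link Lam t \<omega> Lam. f p = f q"
      and top: "top_cfg Lam t \<omega> f = \<sigma>" and bot: "bottom_cfg Lam f = \<tau>"
      using f by (auto simp: spin_paths_def)
    show "?ext (restrict f ?S) = f"
    proof (rule ext)
      fix p
      have "f (x, s) = \<sigma> x" "f (y, s) = \<sigma> y" using top unfolding top_iff by auto
      moreover have "f p = undefined" if "p \<notin> ?S" "p \<noteq> (x, s)" "p \<noteq> (y, s)"
        using PiE_arb[OF fE, of p] that unfolding segs_last by simp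
      ultimately show "?ext (restrict f ?S) p = f p" using last_notin by auto
    qed
    have "top_cfg Lam s \<omega>' (restrict f ?S) = top_cfg Lam s \<omega>' f" "bottom_cfg Lam (restrict f ?S) =
        bottom_cfg Lam f"
      unfolding top_cfg_def bottom_cfg_def by (auto intro!: ext simp: restrict_def pS zS)
    moreover have "restrict f ?S \<in> spin_paths Lam twoS s \<omega>' Lam"
      using fE resp linkS unfolding respects_last spin_paths_def segs_last
      by (fastforce simp: restrict_PiE_iff PiE_iff)
    moreover have "bridge_op ((x, y), c) \<sigma> (top_cfg Lam s \<omega>' f) = 1"
      unfolding bridge_iff using top resp unfolding top_iff respects_last by (auto split: if_splits)
    ultimately show "restrict f ?S \<in> ?Q" using bot by simp
    show "exp ((t - s) * ?E) * exp (energy Lam twoS h s \<omega>' (restrict f ?S)) =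
        exp (energy Lam twoS h t \<omega> f)"
      unfolding energy_restrict energy_last top by (simp add: exp_add)
  next
    fix f assume f: "f \<in> ?Q"
    have fE: "f \<in> ?S \<rightarrow>\<^sub>E {..twoS}" and resp: "\<forall>(p, q)\<in>seg_link Lam s \<omega>' Lam. f p = f q"
      and br: "bridge_op ((x, y), c) \<sigma> (top_cfg Lam s \<omega>' f) = 1" and bot: "bottom_cfg Lam f = \<tau>"
      using f by (auto simp: spin_paths_def)
    show "restrict (?ext f) ?S = f"
      using PiE_arb[OF fE] last_notin by (intro ext) (auto simp: restrict_def)
    have t1: "top_cfg Lam s \<omega>' (?ext f) = top_cfg Lam s \<omega>' f" "bottom_cfg Lam (?ext f) =
        bottom_cfg Lam f"
      unfolding top_cfg_def bottom_cfg_def using n0 by (auto intro!: ext simp: restrict_def)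
    have top: "top_cfg Lam t \<omega> (?ext f) = \<sigma>"
      unfolding top_iff t1 using br last_bridge(4) unfolding bridge_iff by auto
    have "\<forall>(p, q)\<in>seg_link Lam s \<omega>' Lam. ?ext f p = ?ext f q"
    proof (clarify)
      fix a b a' b' assume l: "((a, b), (a', b')) \<in> seg_link Lam s \<omega>' Lam"
      have "b \<noteq> s" "b' \<noteq> s" using linkS[OF l] last_notin by auto
      then show "?ext f (a, b) = ?ext f (a', b')" using l resp by auto
    qed
    then have "\<forall>(p, q)\<in>seg_link Lam t \<omega> Lam. ?ext f p = ?ext f q"
      unfolding respects_last using br n0 last_bridge(4) unfolding bridge_iff by (auto split:
          if_splits)
    moreover have "?ext f \<in> ?S' \<rightarrow>\<^sub>E {..twoS}"
      unfolding segs_last using fE \<sigma>K last_bridge(2,3)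
      by (auto simp: PiE_iff extensional_def)
    ultimately show "?ext f \<in> ?P" using top bot t1 by (simp add: spin_paths_def)
  qed
  also have "\<dots> = exp ((t - s) * ?E) * (\<Sum>f\<in>?Q. exp (energy Lam twoS h s \<omega>' f))"
    by (simp add: sum_distrib_left)
  also have "(\<Sum>f\<in>?Q. exp (energy Lam twoS h s \<omega>' f)) =
      (\<Sum>f | f \<in> spin_paths Lam twoS s \<omega>' Lam \<and> bottom_cfg Lam f = \<tau>.
         bridge_op ((x, y), c) \<sigma> (top_cfg Lam s \<omega>' f) * exp (energy Lam twoS h s \<omega>' f))"
    using finite_spin_paths[OF fin]
    by (intro sum.mono_neutral_cong_left) (auto simp: bridge_op_def split: if_splits)
  \<comment> \<open>Sorting the paths by their configuration just below the bridge produces the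
    matrix product.\<close>
  also have "\<dots> = (\<Sum>\<rho>\<in>configs Lam twoS. \<Sum>f | f \<in> {f. f \<in> spin_paths Lam twoS s \<omega>' Lam \<and>
      bottom_cfg Lam f = \<tau>} \<and> top_cfg Lam s \<omega>' f = \<rho>.
         bridge_op ((x, y), c) \<sigma> (top_cfg Lam s \<omega>' f) * exp (energy Lam twoS h s \<omega>' f))"
    using finite_spin_paths[OF fin] fin top_cfg_in_configs[OF good']
    by (intro sum.group[symmetric]) (auto simp: finite_configs)
  also have "\<dots> = (\<Sum>\<rho>\<in>configs Lam twoS. bridge_op ((x, y), c) \<sigma> \<rho> * path_weight Lam twoS h s \<omega>' \<rho> \<tau>)"
    unfolding path_weight_def sum_distrib_left by (intro sum.cong) auto
  finally show ?thesis .
qed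

end

text \<open>Without bridges each site carries a single segment, so top and bottom configurations
  coincide and determine the path.\<close>

lemma path_weight_Nil:
  assumes "0 < t" "finite Lam" "\<sigma> \<in> configs Lam twoS"
  shows "path_weight Lam twoS h t [] \<sigma> \<tau> = (if \<sigma> = \<tau> then exp (t *
      field_energy Lam twoS h \<sigma>) else 0)"
proof -
  have cut: "cut_times [] v = {0}" for v by (simp add: cut_times_def)
  have prev: "prevcut [] v t = 0" for v
    unfolding prevcut_def cut using assms(1) by (intro Max_eqI) auto
  have good: "good_bridges Lam t []" using assms(1) by (simp add: good_bridges_def)
  have S: "segs Lam t [] = Lam \<times> {0}" by (simp add: segs_good[OF good] cut)
  have nxt: "nxt t [] v 0 = t" for v using nxt_eq_iff[OF good,
      of 0 v t] assms(1) by (simp add: prev)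
  have tb: "top_cfg Lam t [] f = bottom_cfg Lam f"
      for f by (simp add: top_cfg_def bottom_cfg_def prev)
  let ?f = "\<lambda>p\<in>Lam \<times> {0}. \<sigma> (fst p)"
  have bt: "bottom_cfg Lam f = \<sigma> \<longleftrightarrow> f = ?f" if "f \<in> Lam \<times> {0} \<rightarrow>\<^sub>E {..twoS}" for f
  proof
    assume "bottom_cfg Lam f = \<sigma>"
    then have "f (v, 0) = \<sigma> v" if "v \<in> Lam" for v
      using that by (auto simp: bottom_cfg_def dest: fun_cong[of _ _ v])
    then show "f = ?f" using that by (auto simp: fun_eq_iff PiE_iff extensional_def restrict_def)
  next
    assume "f = ?f"
    then show "bottom_cfg Lam f = \<sigma>"
      using assms(3) by (auto simp: bottom_cfg_def configs_def fun_eq_iff PiE_iff extensional_def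
          restrict_def)
  qed
  have fP: "?f \<in> Lam \<times> {0} \<rightarrow>\<^sub>E {..twoS}"
    using assms(3) by (auto simp: configs_def PiE_iff)
  have "spin_paths Lam twoS t [] Lam = Lam \<times> {0} \<rightarrow>\<^sub>E {..twoS}"
    unfolding spin_paths_def S respects_seg_link_iff[OF good] by simp
  then have "f \<in> spin_paths Lam twoS t [] Lam \<and> top_cfg Lam t [] f = \<sigma> \<and> bottom_cfg Lam f = \<tau> \<longleftrightarrow>
      f = ?f \<and> \<sigma> = \<tau>" for f
    using bt[of f] bt[OF fP] fP unfolding tb by metis
  then have "{f. f \<in> spin_paths Lam twoS t [] Lam \<and> top_cfg Lam t [] f = \<sigma> \<and> bottom_cfg Lam f = \<tau>}
      = (if \<sigma> = \<tau> then {?f} else {})"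
    by (simp only: Collect_conj_eq singleton_conv) simp
  moreover have "energy Lam twoS h t [] ?f = t * field_energy Lam twoS h \<sigma>"
    unfolding energy_def S field_energy_def
    unfolding sum_distrib_left
    by (rule sum.reindex_bij_witness[of _ "\<lambda>v. (v, 0)" fst]) (auto simp: seglen_def nxt)
  ultimately show ?thesis unfolding path_weight_def by (simp only:) auto
qed

section \<open>Pairing of the free ends\<close>

text \<open>Glue the links one at a time: joining two free ends of different components leaves
  two free ends, and joining the two free ends of a component leaves none.\<close>

lemma matching_component_card:
  fixes EL :: "(('v \<times> bool) \<times> ('v \<times> bool)) set"
  assumes "finite V" "EL \<subseteq> (V \<times> UNIV) \<times> (V \<times> UNIV)" "sym EL" "single_valued EL" "irrefl EL" "v \<in> V"
  shows "card {e \<in> V \<times> UNIV - Domain EL. (v, fst e) \<in> (map_prod fst fst ` EL)\<^sup>*} \<in> {0, 2}"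
  using assms(2-)
proof (induction "card EL" arbitrary: EL v rule: less_induct)
  case less
  have finEL: "finite EL"
    using less.prems(1) assms(1) by (auto intro: finite_subset)
  show ?case
  proof (cases "EL = {}")
    case True
    have "{e \<in> V \<times> UNIV - Domain EL. (v, fst e) \<in> (map_prod fst fst ` EL)\<^sup>*} =
        {v} \<times> (UNIV :: bool set)"
      using True less.prems(5) by auto
    then show ?thesis by (simp add: card_cartesian_product)
  next
    case False
    then obtain a b where ab: "(a, b) \<in> EL" by auto
    then have ba: "(b, a) \<in> EL" using less.prems(2) by (auto dest: symD)
    have neq: "a \<noteq> b" using ab less.prems(4) by (metis irrefl_def)
    \<comment> \<open>Both orientations of one link are removed, so that what remains is again a
      symmetric matching.\<close>
    define EL' where "EL' = EL - {(a, b), (b, a)}"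
    define r where "r = map_prod fst fst ` EL"
    define r' where "r' = map_prod fst fst ` EL'"
    let ?U = "V \<times> UNIV - Domain EL" and ?U' = "V \<times> UNIV - Domain EL'"
    have EL: "EL = insert (a, b) (insert (b, a) EL')" using ab ba by (auto simp: EL'_def)
    have sv: "z = b" if "(a, z) \<in> EL" for z using that ab less.prems(3) by (auto dest:
        single_valuedD)
    have sv': "z = a" if "(b, z) \<in> EL" for z using that ba less.prems(3) by (auto dest:
        single_valuedD)
    have sym': "sym EL'" using less.prems(2) unfolding EL'_def sym_def by auto
    have small: "card EL' < card EL"
      using ab finEL unfolding EL'_def by (intro psubset_card_mono) auto
    have IH: "card {e \<in> ?U'. (v, fst e) \<in> r'\<^sup>*} \<in> {0, 2}" if "v \<in> V" for v
      unfolding r'_def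
    proof (rule less.hyps[OF small _ sym' _ _ that])
      show "EL' \<subseteq> (V \<times> UNIV) \<times> V \<times> UNIV" using less.prems(1) unfolding EL'_def by blast
      show "single_valued EL'" using less.prems(3) unfolding EL'_def single_valued_def by blast
      show "irrefl EL'" using less.prems(4) unfolding EL'_def irrefl_def by (metis DiffD1)
    qed
    have abV: "fst a \<in> V" "fst b \<in> V" "a \<in> V \<times> UNIV" "b \<in> V \<times> UNIV" using ab less.prems(1) by auto
    have "z \<in> Domain EL' \<longleftrightarrow> z \<in> Domain EL \<and> z \<noteq> a \<and> z \<noteq> b" for z
      unfolding EL'_def Domain_iff using sv sv' by blast
    then have "Domain EL' = Domain EL - {a, b}" by blast
    moreover have "a \<in> Domain EL" "b \<in> Domain EL" using ab ba by blast+
    ultimately have U': "?U' = insert a (insert b ?U)" and aU: "a \<notin> ?U" "b \<notin> ?U"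
      using abV(3,4) by blast+
    have "sym r'" using sym' unfolding r'_def sym_def by force
    then have symr: "(p, q) \<in> r'\<^sup>* \<Longrightarrow> (q, p) \<in> r'\<^sup>*" for p q
      by (metis sym_rtrancl symD)
    have r: "r = insert (fst a, fst b) (insert (fst b, fst a) r')"
        unfolding r_def r'_def by (subst EL) simp
    \<comment> \<open>A chain that uses the added link can be shortened so that it crosses it only
      once, in one of the two directions.\<close>
    have conn: "(p, q) \<in> r\<^sup>* \<longleftrightarrow> (p, q) \<in> r'\<^sup>* \<or> (p, fst a) \<in> r'\<^sup>* \<and> (fst b, q) \<in> r'\<^sup>* \<or>
        (p, fst b) \<in> r'\<^sup>* \<and> (fst a, q) \<in> r'\<^sup>*" for p q
      unfolding r rtrancl_insert by (auto intro: rtrancl_trans symr)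
    define L where "L z = {e \<in> ?U. (z, fst e) \<in> r'\<^sup>*}" for z
    have finL: "finite (L z)" for z unfolding L_def using assms(1) by simp
    \<comment> \<open>\<open>L z\<close> collects the ends that stay free after the link is added.
      The induction hypothesis counts them together with those of \<open>a\<close>, \<open>b\<close>
      that lie in the component of \<open>z\<close>.\<close>
    have cL: "card (L z) + of_bool ((z, fst a) \<in> r'\<^sup>*) + of_bool ((z, fst b) \<in> r'\<^sup>*) \<in> {0, 2}"
        if "z \<in> V" for z
    proof -
      have "{e \<in> ?U'. (z, fst e) \<in> r'\<^sup>*} = L z \<union> ((if (z, fst a) \<in> r'\<^sup>* then {a} else {}) \<union>
          (if (z, fst b) \<in> r'\<^sup>* then {b} else {}))"
        unfolding U' L_def by auto
      moreover have "a \<notin> L z" "b \<notin> L z" using aU by (auto simp: L_def)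
      ultimately have "card {e \<in> ?U'. (z, fst e) \<in> r'\<^sup>*} =
          card (L z) + of_bool ((z, fst a) \<in> r'\<^sup>*) + of_bool ((z, fst b) \<in> r'\<^sup>*)"
        using finL neq by (auto simp: card_insert_if)
      then show ?thesis using IH[OF that] by simp
    qed
    \<comment> \<open>Two different components are joined. Each had two free ends, since it contains
      at least one, and the link uses one of each; one plus one remain.\<close>
    have one: "card {e \<in> ?U. (v, fst e) \<in> r\<^sup>*} = 2"
      if v: "v \<in> V" and va: "(v, fst a') \<in> r'\<^sup>*" and vb: "(v, fst b') \<notin> r'\<^sup>*"
      and a': "(a', b') = (a, b) \<or> (a', b') = (b, a)" for v a' b'
    proof -
      have ba: "(fst b', fst a') \<notin> r'\<^sup>*" using va vb by (auto intro: rtrancl_trans symr)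
      have bV: "fst b' \<in> V" using a' abV by auto
      have eq: "{e \<in> ?U. (v, fst e) \<in> r\<^sup>*} = L v \<union> L (fst b')"
        unfolding L_def conn using va vb a' by auto
      have disj: "L v \<inter> L (fst b') = {}"
        unfolding L_def using vb by (auto intro: rtrancl_trans symr)
      have "card (L v) = 1" using cL[OF v] va vb a' by auto
      moreover have "card (L (fst b')) = 1" using cL[OF bV] ba a' by auto
      ultimately show ?thesis unfolding eq using disj finL by (simp add: card_Un_disjoint)
    qed
    have v: "v \<in> V" by (rule less.prems)
    have "card {e \<in> ?U. (v, fst e) \<in> r\<^sup>*} \<in> {0, 2}"
    \<comment> \<open>If both glued ends lie in the component of \<open>v\<close>, it closes up and
      no free end is left; if neither does, the component is unchanged.\<close>
    proof (cases "(v, fst a) \<in> r'\<^sup>* \<longleftrightarrow> (v, fst b) \<in> r'\<^sup>*")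
      case True
      have "{e \<in> ?U. (v, fst e) \<in> r\<^sup>*} = L v"
        unfolding L_def conn using True by (auto intro: rtrancl_trans)
      then show ?thesis using cL[OF v] True by (cases "(v, fst a) \<in> r'\<^sup>*") auto
    next
      case False
      then show ?thesis using one[OF v, of a b] one[OF v, of b a] by auto
    qed
    then show ?thesis unfolding r_def .
  qed
qed

text \<open>An end is a segment together with a side, \<open>True\<close> for its top. This is the
  end that meets time \<open>s\<close> at \<open>v\<close>, from below if \<open>d\<close> and from
  above otherwise.\<close>

definition tip :: "bridges \<Rightarrow> site \<Rightarrow> real \<Rightarrow> bool \<Rightarrow> (site \<times> real) \<times> bool" where
  "tip \<omega> v s d = (if d then ((v, prevcut \<omega> v s), True) else ((v, s), False))"

text \<open>The side \<open>d \<noteq> c\<close> encodes the bridge type: a cross joins ends of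
  opposite sides, a double bar ends of the same side. Recording sides, which \<open>seg_link\<close>
  forgets, is what makes the relation a matching.\<close>

definition end_links :: "site set \<Rightarrow> real \<Rightarrow> bridges \<Rightarrow> site set \<Rightarrow> (((site \<times> real) \<times> bool) \<times> ((site \<times>
    real) \<times> bool)) set" where
  "end_links Lam t \<omega> M =
     {(tip \<omega> v s d, tip \<omega> w s (d \<noteq> c)) | v w s c d. (v, w, s, c) \<in> set \<omega> \<or> (w, v, s, c) \<in> set \<omega>} \<union>
     {(tip \<omega> v t True, tip \<omega> v 0 False) | v. v \<in> Lam - M} \<union>
     {(tip \<omega> v 0 False, tip \<omega> v t True) | v. v \<in> Lam - M}"

lemma sym_end_links: "sym (end_links Lam t \<omega> M)"
proof (rule symI)
  fix a b assume "(a, b) \<in> end_links Lam t \<omega> M"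
  then consider v w s c d where "a = tip \<omega> v s d" "b = tip \<omega> w s (d \<noteq> c)" "(v, w, s, c) \<in> set \<omega> \<or>
      (w, v, s, c) \<in> set \<omega>"
    | v where "v \<in> Lam - M" "a = tip \<omega> v t True \<and> b = tip \<omega> v 0 False \<or> a = tip \<omega> v 0 False \<and> b =
        tip \<omega> v t True"
    unfolding end_links_def by blast
  then show "(b, a) \<in> end_links Lam t \<omega> M"
  proof cases
    case 1
    have "((d \<noteq> c) \<noteq> c) = d" by blast
    then have "b = tip \<omega> w s (d \<noteq> c)" "a = tip \<omega> v s ((d \<noteq> c) \<noteq> c)" using 1 by simp_all
    then show ?thesis unfolding end_links_def using 1(3) by blast
  next
    case 2
    then show ?thesis unfolding end_links_def by blast
  qed
qed

context
  fixes Lam :: "site set" and t :: real and \<omega> :: bridges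
  assumes good: "good_bridges Lam t \<omega>"
begin

text \<open>For a top end the time is recovered as the \<open>nxt\<close> of its segment, for a
  bottom end it is the start of the segment.\<close>

lemma tip_inj:
  assumes "tip \<omega> v s d = tip \<omega> v' s' d'" "s \<in> cut_times \<omega> v \<or> s = t" "s' \<in> cut_times \<omega> v' \<or> s' = t"
    "d \<Longrightarrow> 0 < s" "d' \<Longrightarrow> 0 < s'"
  shows "v = v' \<and> s = s' \<and> d = d'"
proof (cases d)
  case True
  have eq: "v = v'" "d'" "prevcut \<omega> v s = prevcut \<omega> v s'"
      using assms(1) True by (auto simp: tip_def split: if_splits)
  have pos: "0 < s" "0 < s'" using True eq assms by auto
  have "nxt t \<omega> v (prevcut \<omega> v s) = s" 
    using nxt_eq_iff[OF good prevcut_less(1)[OF good pos(1)] assms(2) pos(1)] by simp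
  moreover have "nxt t \<omega> v (prevcut \<omega> v s') = s'"
    using nxt_eq_iff[OF good prevcut_less(1)[OF good pos(2)] _ pos(2)] assms(3) eq by simp
  ultimately show ?thesis using eq True by metis
next
  case False
  then show ?thesis using assms(1) by (auto simp: tip_def split: if_splits)
qed

lemma end_linksE:
  assumes "(a, b) \<in> end_links Lam t \<omega> M"
  obtains (bridge) v w s c d where "a = tip \<omega> v s d" "b = tip \<omega> w s (d \<noteq> c)"
      "(v, w, s, c) \<in> set \<omega> \<or> (w, v, s, c) \<in> set \<omega>"
      "s \<in> cut_times \<omega> v" "s \<in> cut_times \<omega> w" "0 < s" "s < t" "v \<in> Lam" "w \<in> Lam" "v \<noteq> w"
    | (up) v where "v \<in> Lam - M" "a = tip \<omega> v t True" "b = tip \<omega> v 0 False"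
    | (down) v where "v \<in> Lam - M" "a = tip \<omega> v 0 False" "b = tip \<omega> v t True"
proof -
  from assms consider v w s c d where "a = tip \<omega> v s d" "b = tip \<omega> w s (d \<noteq> c)" "(v, w, s,
      c) \<in> set \<omega> \<or> (w, v, s, c) \<in> set \<omega>"
    | v where "v \<in> Lam - M" "a = tip \<omega> v t True" "b = tip \<omega> v 0 False"
    | v where "v \<in> Lam - M" "a = tip \<omega> v 0 False" "b = tip \<omega> v t True"
    unfolding end_links_def by blast
  then show thesis
  proof cases
    case 1
    show thesis
    proof (rule bridge[OF 1])
      show "s \<in> cut_times \<omega> v" "s \<in> cut_times \<omega> w" using 1(3) by (auto simp: cut_times_def)
      show "0 < s" "s < t" "v \<in> Lam" "w \<in> Lam" "v \<noteq> w"
        using 1(3) good_bridgeD[OF good, of v w s c] good_bridgeD[OF good, of w v s c] by auto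
    qed
  qed (use up down in auto)
qed

text \<open>An end determines its site and time, and at most one bridge has that time. Wrap-around
  links live at times 0 and \<open>t\<close>, where a good realization has no bridge.\<close>

lemma single_valued_end_links: "single_valued (end_links Lam t \<omega> M)"
proof (rule single_valuedI)
  fix a b b' assume ab: "(a, b) \<in> end_links Lam t \<omega> M" and ab': "(a, b') \<in> end_links Lam t \<omega> M"
  note pos = good_pos[OF good]
  show "b = b'"
    using ab
  proof (cases rule: end_linksE)
    case (bridge v w s c d)
    note B = this
    from ab' show ?thesis
    proof (cases rule: end_linksE)
      case (bridge v' w' s' c' d')
      have eq: "v = v'" "s = s'" "d = d'" using tip_inj[of v s d v' s' d'] B bridge by auto
      have "w = w' \<and> c = c'"
        using B(3) bridge(3) B(10) unfolding eq[symmetric]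
        using good_bridge_unique[OF good, of v w s c] good_bridge_unique[OF good,
            of w v s c] by blast
      then show ?thesis using B bridge eq by simp
    next
      case (up v')
      then show ?thesis using tip_inj[of v s d v' t True] B pos by auto
    next
      case (down v')
      then show ?thesis using tip_inj[of v s d v' 0 False] B pos by auto
    qed
  next
    case (up v)
    note B = this
    from ab' show ?thesis
    proof (cases rule: end_linksE)
      case (bridge v' w' s' c' d')
      then show ?thesis using tip_inj[of v t True v' s' d'] B pos by auto
    next
      case (up v')
      then show ?thesis using B tip_inj[of v t True v' t True] pos by auto
    next
      case (down v')
      then show ?thesis using B by (auto simp: tip_def)
    qed
  next
    case (down v)
    note B = this
    from ab' show ?thesis
    proof (cases rule: end_linksE)
      case (bridge v' w' s' c' d')
      then show ?thesis using tip_inj[of v 0 False v' s' d'] B pos by auto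
    next
      case (up v')
      then show ?thesis using B by (auto simp: tip_def)
    next
      case (down v')
      then show ?thesis using B by (auto simp: tip_def)
    qed
  qed
qed

lemma irrefl_end_links: "irrefl (end_links Lam t \<omega> M)"
  unfolding irrefl_def
proof (intro allI notI)
  fix a assume "(a, a) \<in> end_links Lam t \<omega> M"
  then show False by (cases rule: end_linksE) (auto simp: tip_def split: if_splits)
qed

lemma fst_tip_in_segs:
  assumes "v \<in> Lam" "s \<in> cut_times \<omega> v \<or> d" "d \<Longrightarrow> 0 < s"
  shows "fst (tip \<omega> v s d) \<in> segs Lam t \<omega>"
  using assms prevcut_less[OF good, of s v] by (auto simp: tip_def segs_good[OF good])

lemma end_links_segs: "end_links Lam t \<omega> M \<subseteq> (segs Lam t \<omega> \<times> UNIV) \<times> (segs Lam t \<omega> \<times> UNIV)"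
proof (rule subrelI)
  fix a b assume "(a, b) \<in> end_links Lam t \<omega> M"
  then have "fst a \<in> segs Lam t \<omega> \<and> fst b \<in> segs Lam t \<omega>"
    by (cases rule: end_linksE) (auto intro!: fst_tip_in_segs simp: good_pos[OF good])
  then show "(a, b) \<in> (segs Lam t \<omega> \<times> UNIV) \<times> (segs Lam t \<omega> \<times> UNIV)"
    by (cases a; cases b) auto
qed

text \<open>Forgetting sides carries the matching to the symmetrized adjacency, so the count of free
  ends per component applies to \<open>seg_conn\<close>.\<close>

lemma seg_link_eq_end_links:
  "seg_link Lam t \<omega> M \<union> (seg_link Lam t \<omega> M)\<inverse> = map_prod fst fst ` end_links Lam t \<omega> M"
proof -
  define E where "E = map_prod fst fst ` end_links Lam t \<omega> M"
  have I: "(fst a, fst b) \<in> E" if "(a, b) \<in> end_links Lam t \<omega> M" for a b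
    using that unfolding E_def by force
  have tipI: "(tip \<omega> v s d, tip \<omega> w s (d \<noteq> c)) \<in> end_links Lam t \<omega> M"
    if "(v, w, s, c) \<in> set \<omega> \<or> (w, v, s, c) \<in> set \<omega>" for v w s c d
    using that unfolding end_links_def by blast
  have sub: "(p, q) \<in> E" if "(p, q) \<in> seg_link Lam t \<omega> M" for p q
    using that unfolding seg_link_iff[OF good]
  proof (elim disjE exE conjE bexE)
    fix v assume "v \<in> Lam - M" "p = (v, prevcut \<omega> v t)" "q = (v, 0)"
    then have "(tip \<omega> v t True, tip \<omega> v 0 False) \<in> end_links Lam t \<omega> M" "p = fst (tip \<omega> v t True)"
        "q = fst (tip \<omega> v 0 False)"
      unfolding end_links_def by (auto simp: tip_def)
    then show ?thesis using I by metis
  next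
    fix x y s c v w
    assume b: "(x, y, s, c) \<in> set \<omega>" "(v, w) = (x, y)" and *: "if c then p = (v, prevcut \<omega> v s) \<and>
        q = (w, s)
         else p = (v, prevcut \<omega> v s) \<and> q = (w, prevcut \<omega> w s) \<or> p = (v, s) \<and> q = (w, s)"
    have "(v, w, s, c) \<in> set \<omega> \<or> (w, v, s, c) \<in> set \<omega>" using b by auto
    from I[OF tipI[OF this, of True]] I[OF tipI[OF this, of False]] * show ?thesis unfolding tip_def
      by (cases c) auto
  next
    fix x y s c v w
    assume b: "(x, y, s, c) \<in> set \<omega>" "(v, w) = (y, x)" and *: "if c then p = (v, prevcut \<omega> v s) \<and>
        q = (w, s)
         else p = (v, prevcut \<omega> v s) \<and> q = (w, prevcut \<omega> w s) \<or> p = (v, s) \<and> q = (w, s)"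
    have "(v, w, s, c) \<in> set \<omega> \<or> (w, v, s, c) \<in> set \<omega>" using b by auto
    from I[OF tipI[OF this, of True]] I[OF tipI[OF this, of False]] * show ?thesis unfolding tip_def
      by (cases c) auto
  qed
  have sup: "(fst a, fst b) \<in> seg_link Lam t \<omega> M \<union> (seg_link Lam t \<omega> M)\<inverse>" if "(a,
      b) \<in> end_links Lam t \<omega> M" for a b
    using that
  proof (cases rule: end_linksE)
    case (bridge v w s c d)
    obtain x y where b: "(x, y, s, c) \<in> set \<omega>" and vw: "(v, w) = (x, y) \<or> (v, w) = (y, x)"
        and wv: "(w, v) = (x, y) \<or> (w, v) = (y, x)"
      using bridge(3) by auto
    show ?thesis
      using seg_link_bridgeI[OF good b vw, of "fst a" "fst b" M] seg_link_bridgeI[OF good b wv,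
          of "fst b" "fst a" M]
      using bridge(1,2) by (cases c; cases d) (auto simp: tip_def)
  next
    case (up v)
    then have "(fst a, fst b) \<in> seg_link Lam t \<omega> M"
        unfolding seg_link_iff[OF good] by (auto simp: tip_def)
    then show ?thesis ..
  next
    case (down v)
    then have "(fst b, fst a) \<in> seg_link Lam t \<omega> M"
        unfolding seg_link_iff[OF good] by (auto simp: tip_def)
    then show ?thesis by auto
  qed
  have symm: "sym (E)"
    using sym_end_links[of Lam t \<omega> M] unfolding sym_def E_def by force
  show ?thesis
    unfolding E_def[symmetric]
  proof (intro equalityI subrelI)
    fix p q assume "(p, q) \<in> seg_link Lam t \<omega> M \<union> (seg_link Lam t \<omega> M)\<inverse>"
    then show "(p, q) \<in> E" using sub[of p q] sub[of q p] symD[OF symm, of q p] by blast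
  next
    fix p q assume "(p, q) \<in> E"
    then show "(p, q) \<in> seg_link Lam t \<omega> M \<union> (seg_link Lam t \<omega> M)\<inverse>"
        using sup unfolding E_def by force
  qed
qed

text \<open>Every end lies at time 0, at time \<open>t\<close> or at a bridge. Ends at bridges are
  always linked, and those at 0 and \<open>t\<close> are linked to each other unless their site is
  cut open.\<close>

lemma free_ends:
  assumes "M \<subseteq> Lam"
  shows "segs Lam t \<omega> \<times> UNIV - Domain (end_links Lam t \<omega> M) =
    (\<lambda>v. ((v, 0), False)) ` M \<union> (\<lambda>v. ((v, prevcut \<omega> v t), True)) ` M" (is "?L = ?R")
proof (intro equalityI subsetI)
  note pos = good_pos[OF good]
  fix e assume e: "e \<in> ?L"
  obtain v r d where e_eq: "e = ((v, r), d)" by (metis surj_pair)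
  have v: "v \<in> Lam" "r \<in> cut_times \<omega> v" using e e_eq by (auto simp: segs_good[OF good])
  \<comment> \<open>The time at which the given end lies: the top of the segment for
    \<open>d\<close>, its start otherwise.\<close>
  define s where "s = (if d then nxt t \<omega> v r else r)"
  have s: "s \<in> cut_times \<omega> v \<or> d \<and> s = t" "d \<Longrightarrow> 0 < s"
      using v nxt_in[OF good v(2)] by (auto simp: s_def)
  have tip: "e = tip \<omega> v s d"
    using nxt_eq_iff[OF good v(2), of s] s by (auto simp: e_eq tip_def s_def)
  consider "s = t" "d" | "s = 0" "\<not> d" | x y c where "(x, y, s, c) \<in> set \<omega>" "v = x \<or> v = y"
    using s unfolding cut_times_def by blast
  then show "e \<in> ?R"
  proof cases
    case 1
    have "v \<in> M"
    proof (rule ccontr)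
      assume "v \<notin> M"
      then have "(e, tip \<omega> v 0 False) \<in> end_links Lam t \<omega> M"
          using v 1 tip unfolding end_links_def by auto
      then show False using e by auto
    qed
    then show ?thesis using 1 tip by (auto simp: tip_def)
  next
    case 2
    have "v \<in> M"
    proof (rule ccontr)
      assume "v \<notin> M"
      then have "(e, tip \<omega> v t True) \<in> end_links Lam t \<omega> M"
          using v 2 tip unfolding end_links_def by auto
      then show False using e by auto
    qed
    then show ?thesis using 2 tip by (auto simp: tip_def)
  next
    case 3
    then obtain w where "(v, w, s, c) \<in> set \<omega> \<or> (w, v, s, c) \<in> set \<omega>" by blast
    then have "(e, tip \<omega> w s (d \<noteq> c)) \<in> end_links Lam t \<omega> M"
        using tip unfolding end_links_def by blast
    then show ?thesis using e by auto
  qed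
next
  note pos = good_pos[OF good]
  fix e assume "e \<in> ?R"
  then obtain v where "v \<in> M" "e = tip \<omega> v t True \<or> e = tip \<omega> v 0 False"
    by (auto simp: tip_def)
  then obtain s d where v: "v \<in> M" "s = t \<and> d \<or> s = 0 \<and> \<not> d" "e = tip \<omega> v s d"
    by blast
  have vL: "v \<in> Lam" using v assms by auto
  have s: "s \<in> cut_times \<omega> v \<or> s = t" "d \<Longrightarrow> 0 < s" using v pos by auto
  have "(e, b) \<notin> end_links Lam t \<omega> M" for b
  proof
    assume "(e, b) \<in> end_links Lam t \<omega> M"
    then show False
    proof (cases rule: end_linksE)
      case (bridge v' w s' c d')
      then show False using tip_inj[of v s d v' s' d'] v s by auto
    next
      case (up v')
      then show False using tip_inj[of v s d v' t True] v s pos by auto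
    next
      case (down v')
      then show False using tip_inj[of v s d v' 0 False] v s pos by auto
    qed
  qed
  moreover have "fst e \<in> segs Lam t \<omega>"
    unfolding v(3) using vL s v(2) pos by (intro fst_tip_in_segs) auto
  ultimately show "e \<in> ?L" by (cases e) auto
qed

end

lemma equiv_seg_conn: "equiv (segs Lam t \<omega>) (seg_conn Lam t \<omega> M)"
proof (rule equivI)
  let ?r = "seg_link Lam t \<omega> M \<union> (seg_link Lam t \<omega> M)\<inverse>"
  have "sym (?r\<^sup>*)" by (intro sym_rtrancl) (auto simp: sym_def)
  then show "sym (seg_conn Lam t \<omega> M)" unfolding seg_conn_def sym_def by blast
  show "trans (seg_conn Lam t \<omega> M)" unfolding seg_conn_def trans_def by (auto intro: rtrancl_trans)
qed (auto simp: seg_conn_def refl_on_def)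

lemma seg_link_subset_conn: "seg_link Lam t \<omega> M \<subseteq> seg_conn Lam t \<omega> M"
  unfolding seg_conn_def using seg_link_segs by auto

text \<open>\<open>seg_conn\<close> is the equivalence generated by the links; this universal
  property serves to compare it with explicitly given equivalences.\<close>

lemma seg_conn_least:
  assumes "equiv (segs Lam t \<omega>) T" "seg_link Lam t \<omega> M \<subseteq> T"
  shows "seg_conn Lam t \<omega> M \<subseteq> T"
proof (rule subrelI)
  fix p q assume pq: "(p, q) \<in> seg_conn Lam t \<omega> M"
  have symT: "sym T" and transT: "trans T" and reflT: "refl_on (segs Lam t \<omega>) T"
    using assms(1) by (auto simp: equiv_def)
  have "(p, q) \<in> (seg_link Lam t \<omega> M \<union> (seg_link Lam t \<omega> M)\<inverse>)\<^sup>*" "p \<in> segs Lam t \<omega>"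
    using pq by (auto simp: seg_conn_def)
  then show "(p, q) \<in> T"
  proof (induction rule: rtrancl_induct)
    case base
    then show ?case using reflT by (auto simp: refl_on_def)
  next
    case (step y z)
    then have "(y, z) \<in> T" using assms(2) symT by (auto dest: symD)
    then show ?case using step transT by (auto dest: transD)
  qed
qed

text \<open>Every component contains none or two of the four free ends, so these are paired. Either
  each site is paired with itself, or the ends at one site are paired with those at the other, in
  parallel or crosswise; which of the two depends on the direction in which the loop passes
  \<open>x\<close>.\<close>

lemma free_ends_pairing:
  assumes good: "good_bridges Lam t \<omega>" and fin: "finite Lam"
    and ox: "o' \<in> Lam" "x \<in> Lam" "x \<noteq> o'"
  defines "conn p q \<equiv> (p, q) \<in> seg_conn Lam t \<omega> {o', x}"
  defines "P \<equiv> (o', 0)" and "P' \<equiv> (o', prevcut \<omega> o' t)" and "Q \<equiv> (x, 0)" and "Q' \<equiv> (x,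
      prevcut \<omega> x t)"
  shows "conn P P' \<and> conn Q Q' \<and> \<not> conn P Q \<or>
         \<not> conn P P' \<and> (conn P Q \<and> conn P' Q' \<or> conn P Q' \<and> conn P' Q)"
proof -
  let ?M = "{o', x}"
  let ?EL = "end_links Lam t \<omega> ?M" and ?S = "segs Lam t \<omega>"
  have S: "P \<in> ?S" "P' \<in> ?S" "Q \<in> ?S" "Q' \<in> ?S"
    using ox prevcut_less[OF good good_pos[OF good]] unfolding P_def P'_def Q_def Q'_def
        segs_good[OF good] by auto
  \<comment> \<open>The side labels keep the four ends distinct even if a site has a single segment,
    in which case \<open>P = P'\<close> or \<open>Q = Q'\<close>.\<close>
  have free: "?S \<times> UNIV - Domain ?EL = {(P, False), (P', True), (Q, False), (Q', True)}"
    unfolding P_def P'_def Q_def Q'_def using free_ends[OF good, of ?M] ox by auto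
  have conn_iff: "conn p q \<longleftrightarrow> (p, q) \<in> (map_prod fst fst ` ?EL)\<^sup>*" if "p \<in> ?S" "q \<in> ?S" for p q
    using that unfolding conn_def seg_conn_def seg_link_eq_end_links[OF good] by auto
  have ne: "P \<noteq> Q" "P' \<noteq> Q'" using ox unfolding P_def P'_def Q_def Q'_def by auto
  \<comment> \<open>The component count, written as a sum of indicators over the four named ends, so
    that the pairing becomes a parity argument.\<close>
  have card4: "of_bool (conn z P) + of_bool (conn z P') + of_bool (conn z Q) +
      of_bool (conn z Q') \<in> {0, 2 :: nat}"
    if z: "z \<in> ?S" for z
  proof -
    have fS: "finite ?S" using fin by simp
    have "card {e \<in> {(P, False), (P', True), (Q, False), (Q', True)}. (z,
        fst e) \<in> (map_prod fst fst ` ?EL)\<^sup>*} \<in> {0, 2}"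
      using matching_component_card[OF fS end_links_segs[OF good,
          of ?M] sym_end_links single_valued_end_links[OF good]
          irrefl_end_links[OF good] z] unfolding free .
    also have "card {e \<in> {(P, False), (P', True), (Q, False), (Q', True)}. (z,
        fst e) \<in> (map_prod fst fst ` ?EL)\<^sup>*}
        = (\<Sum>e\<in>{(P, False), (P', True), (Q, False), (Q', True)}. of_bool ((z,
            fst e) \<in> (map_prod fst fst ` ?EL)\<^sup>*))"
      by (simp only: of_bool_def card_eq_sum sum.inter_filter[symmetric] finite.emptyI
          finite_insert)
    also have "\<dots> = of_bool (conn z P) + of_bool (conn z P') + of_bool (conn z Q) +
        of_bool (conn z Q')"
      using ne S z by (simp add: conn_iff)
    finally show ?thesis .
  qed
  have eq: "equiv ?S (seg_conn Lam t \<omega> ?M)" by (rule equiv_seg_conn)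
  have refl: "conn z z" if "z \<in> ?S" for z using eq that by (auto simp: conn_def equiv_def
      refl_on_def)
  have sym: "conn q p" if "conn p q" for p q using eq that by (auto simp: conn_def equiv_def dest:
      symD)
  have trans: "conn p r" if "conn p q" "conn q r"
      for p q r using eq that unfolding conn_def equiv_def by (blast dest: transD)
  have P: "1 + of_bool (conn P P') + of_bool (conn P Q) + of_bool (conn P Q') \<in> {0, 2 :: nat}"
    using card4[OF S(1)] refl[OF S(1)] by simp
  have P': "of_bool (conn P' P) + 1 + of_bool (conn P' Q) + of_bool (conn P' Q') \<in> {0, 2 :: nat}"
    using card4[OF S(2)] refl[OF S(2)] by simp
  have Q: "of_bool (conn Q P) + of_bool (conn Q P') + 1 + of_bool (conn Q Q') \<in> {0, 2 :: nat}"
    using card4[OF S(3)] refl[OF S(3)] by simp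
  show ?thesis
  proof (cases "conn P P'")
    case True
    have nPQ: "\<not> conn P Q" using P True by (auto simp: of_bool_def split: if_splits)
    then have "\<not> conn Q P" "\<not> conn Q P'" using True sym trans by blast+
    then have "conn Q Q'" using Q by (auto simp: of_bool_def split: if_splits)
    then show ?thesis using True nPQ by blast
  next
    case False
    then have nP: "\<not> conn P' P" using sym by blast
    have "conn P Q \<noteq> conn P Q'" using P False by (auto simp: of_bool_def split: if_splits)
    moreover have "conn P' Q \<noteq> conn P' Q'" using P' nP by (auto simp: of_bool_def split: if_splits)
    moreover have "\<not> (conn P Q \<and> conn P' Q)" "\<not> (conn P Q' \<and> conn P' Q')"
        using False sym trans by blast+
    ultimately show ?thesis using False by blast
  qed
qed

section \<open>Spin paths and loops\<close>

lemma quotient_memD: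
  assumes "equiv S r" "c \<in> S // r" "p \<in> c"
  shows "p \<in> S" "r `` {p} = c"
proof -
  obtain z where z: "z \<in> S" "c = r `` {z}" using assms(2) by (rule quotientE)
  then have zp: "(z, p) \<in> r" using assms(3) by auto
  show "p \<in> S" using zp assms(1) by (auto simp: equiv_def)
  show "r `` {p} = c" using equiv_class_eq[OF assms(1) zp] z by simp
qed

text \<open>Functions that are constant on classes are functions on the quotient; the inverse
  correspondence evaluates at a chosen representative.\<close>

lemma sum_respecting_quotient:
  assumes eq: "equiv S r"
  shows "(\<Sum>f | f \<in> S \<rightarrow>\<^sub>E K \<and> (\<forall>(p, q)\<in>r. f p = f q). G f) =
         (\<Sum>g\<in>(S // r) \<rightarrow>\<^sub>E K. G (\<lambda>p\<in>S. g (r `` {p})))"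
proof (rule sum.reindex_bij_witness[of _ "\<lambda>g. \<lambda>p\<in>S. g (r `` {p})"
    "\<lambda>f. \<lambda>c\<in>S // r. f (SOME p. p \<in> c)"])
  have some: "(SOME p. p \<in> c) \<in> c" if "c \<in> S // r" for c
    using in_quotient_imp_non_empty[OF eq that] by (auto intro: someI)
  fix f assume f: "f \<in> {f. f \<in> S \<rightarrow>\<^sub>E K \<and> (\<forall>(p, q)\<in>r. f p = f q)}"
  then have fE: "f \<in> S \<rightarrow>\<^sub>E K" and fr: "\<And>p q. (p, q) \<in> r \<Longrightarrow> f p = f q" by auto
  show *: "(\<lambda>p\<in>S. (\<lambda>c\<in>S // r. f (SOME p. p \<in> c)) (r `` {p})) = f"
  proof (rule ext)
    fix p
    show "(\<lambda>p\<in>S. (\<lambda>c\<in>S // r. f (SOME p. p \<in> c)) (r `` {p})) p = f p"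
    proof (cases "p \<in> S")
      case True
      have "(p, SOME q. q \<in> r `` {p}) \<in> r" using some[OF quotientI[OF True]] by simp
      then show ?thesis using True fr by (simp add: quotientI)
    qed (use PiE_arb[OF fE] in simp)
  qed
  show "(\<lambda>c\<in>S // r. f (SOME p. p \<in> c)) \<in> S // r \<rightarrow>\<^sub>E K"
    using some quotient_memD(1)[OF eq] fE by (auto intro!: PiE_mem[OF fE])
  show "G (\<lambda>p\<in>S. (\<lambda>c\<in>S // r. f (SOME p. p \<in> c)) (r `` {p})) = G f" unfolding * ..
next
  fix g assume g: "g \<in> S // r \<rightarrow>\<^sub>E K"
  have some: "(SOME p. p \<in> c) \<in> c" if "c \<in> S // r" for c
    using in_quotient_imp_non_empty[OF eq that] by (auto intro: someI)
  show "(\<lambda>c\<in>S // r. (\<lambda>p\<in>S. g (r `` {p})) (SOME p. p \<in> c)) = g"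
  proof (rule ext)
    fix c
    show "(\<lambda>c\<in>S // r. (\<lambda>p\<in>S. g (r `` {p})) (SOME p. p \<in> c)) c = g c"
    proof (cases "c \<in> S // r")
      case True
      then show ?thesis using quotient_memD[OF eq True some[OF True]] by simp
    qed (use PiE_arb[OF g, of c] in simp)
  qed
  have "r `` {p} = r `` {q}" if "(p, q) \<in> r" for p q using equiv_class_eq[OF eq that] .
  moreover have "p \<in> S \<longleftrightarrow> q \<in> S" if "(p, q) \<in> r" for p q using that eq by (auto simp: equiv_def)
  ultimately have "(\<lambda>p\<in>S. g (r `` {p})) p = (\<lambda>p\<in>S. g (r `` {p})) q" if "(p, q) \<in> r" for p q
    using that by (simp add: restrict_def)
  moreover have "(\<lambda>p\<in>S. g (r `` {p})) \<in> S \<rightarrow>\<^sub>E K" using g by (auto intro: PiE_mem quotientI)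
  ultimately show "(\<lambda>p\<in>S. g (r `` {p})) \<in> {f. f \<in> S \<rightarrow>\<^sub>E K \<and> (\<forall>(p, q)\<in>r. f p = f q)}" by blast
qed

lemma sum_quotient:
  assumes "finite S" "equiv S r"
  shows "(\<Sum>p\<in>S. F p) = (\<Sum>c\<in>S // r. \<Sum>p\<in>c. F p)"
proof -
  have "sum F (\<Union>(S // r)) = (sum \<circ> sum) F (S // r)"
    using assms quotient_disj[OF assms(2)] finite_equiv_class[OF assms(1)]
    by (intro sum.Union_disjoint) (auto simp: equiv_def dest: quotient_memD(1)[OF assms(2)] intro:
        finite_subset[OF _ assms(1)])
  then show ?thesis using Union_quotient[OF assms(2)] by simp
qed

text \<open>Having equal spins is an equivalence relation on segments, so if it contains the links
  it contains the equivalence they generate.\<close>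

lemma spin_paths_conn:
  "spin_paths Lam twoS t \<omega> M = {f. f \<in> segs Lam t \<omega> \<rightarrow>\<^sub>E {..twoS} \<and> (\<forall>(p,
      q)\<in>seg_conn Lam t \<omega> M. f p = f q)}"
proof -
  have "(\<forall>(p, q)\<in>seg_link Lam t \<omega> M. f p = f q) \<longleftrightarrow> (\<forall>(p, q)\<in>seg_conn Lam t \<omega> M. f p = f q)"
      for f :: "site \<times> real \<Rightarrow> nat"
  proof
    assume L: "\<forall>(p, q)\<in>seg_link Lam t \<omega> M. f p = f q"
    let ?T = "{(p, q). p \<in> segs Lam t \<omega> \<and> q \<in> segs Lam t \<omega> \<and> f p = f q}"
    have "equiv (segs Lam t \<omega>) ?T" by (auto simp: equiv_def refl_on_def sym_def trans_def)
    moreover have "seg_link Lam t \<omega> M \<subseteq> ?T"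
    proof (rule subrelI)
      fix p q assume "(p, q) \<in> seg_link Lam t \<omega> M"
      then show "(p, q) \<in> ?T" using L seg_link_segs[of p q] by simp blast
    qed
    ultimately show "\<forall>(p, q)\<in>seg_conn Lam t \<omega> M. f p = f q" using seg_conn_least by blast
  qed (use seg_link_subset_conn in blast)
  then show ?thesis unfolding spin_paths_def by simp
qed

lemma sum_spin_paths_quotient:
  "(\<Sum>f\<in>spin_paths Lam twoS t \<omega> M. G f) =
   (\<Sum>g\<in>(segs Lam t \<omega> // seg_conn Lam t \<omega> M) \<rightarrow>\<^sub>E {..twoS}.
      G (\<lambda>p\<in>segs Lam t \<omega>. g (seg_conn Lam t \<omega> M `` {p})))"
  unfolding spin_paths_conn by (rule sum_respecting_quotient[OF equiv_seg_conn])

lemma finite_segs_quotient: "finite Lam \<Longrightarrow> finite (segs Lam t \<omega> // seg_conn Lam t \<omega> M)"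
  using finite_quotient[OF finite_segs, of Lam] equiv_seg_conn by (auto simp: equiv_def)

text \<open>The energy is additive over segments and the spin is constant on a class, so only the
  weighted length \<open>hlen\<close> of the class enters.\<close>

lemma exp_energy_quotient:
  assumes "finite Lam"
  shows "exp (energy Lam twoS h t \<omega> (\<lambda>p\<in>segs Lam t \<omega>. g (seg_conn Lam t \<omega> M `` {p}))) =
    (\<Prod>c\<in>segs Lam t \<omega> // seg_conn Lam t \<omega> M. exp (spinval twoS (g c) * hlen t \<omega> h c))"
proof -
  let ?S = "segs Lam t \<omega>" and ?r = "seg_conn Lam t \<omega> M"
  have fS: "finite ?S" using assms by simp
  have "energy Lam twoS h t \<omega> (\<lambda>p\<in>?S. g (?r `` {p})) =
     (\<Sum>c\<in>?S // ?r. \<Sum>p\<in>c. h (fst p) * seglen t \<omega> p * spinval twoS ((\<lambda>p\<in>?S. g (?r `` {p})) p))"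
    unfolding energy_def by (rule sum_quotient[OF fS equiv_seg_conn])
  also have "\<dots> = (\<Sum>c\<in>?S // ?r. \<Sum>p\<in>c. h (fst p) * seglen t \<omega> p * spinval twoS (g c))"
    using quotient_memD[OF equiv_seg_conn] by (intro sum.cong refl) simp
  also have "\<dots> = (\<Sum>c\<in>?S // ?r. spinval twoS (g c) * hlen t \<omega> h c)"
    unfolding hlen_def by (intro sum.cong refl) (simp add: sum_distrib_left mult_ac)
  finally show ?thesis by (simp only: exp_sum[OF finite_segs_quotient[OF assms]])
qed

text \<open>The spins of different loops are chosen independently, and expanding the product of the
  single-loop sums lists all choices.\<close>

lemma sum_paths_loops:
  assumes "finite Lam"
  shows "(\<Sum>f\<in>spin_paths Lam twoS t \<omega> {}. exp (energy Lam twoS h t \<omega> f)) =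
     (\<Prod>\<gamma>\<in>loops Lam t \<omega>. zact twoS t \<omega> h \<gamma>)"
  unfolding sum_spin_paths_quotient exp_energy_quotient[OF assms] loops_def zact_def
  by (subst prod_sum_PiE) (auto simp: finite_segs_quotient assms)

text \<open>The observable couples the spins of only two classes, the two arcs; all other classes
  still factorize.\<close>

lemma sum_PiE_two:
  fixes e :: "'q \<Rightarrow> 'k \<Rightarrow> real"
  assumes fin: "finite Q" "finite K" and c: "c1 \<in> Q" "c2 \<in> Q" "c1 \<noteq> c2"
  shows "(\<Sum>g\<in>Q \<rightarrow>\<^sub>E K. \<phi> (g c1) (g c2) * (\<Prod>c\<in>Q. e c (g c))) =
    (\<Sum>k\<in>K. \<Sum>l\<in>K. \<phi> k l * (e c1 k * e c2 l)) * (\<Prod>c\<in>Q - {c1, c2}. \<Sum>k\<in>K. e c k)"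
proof -
  let ?Q = "Q - {c1} - {c2}"
  have c2: "c2 \<in> Q - {c1}" using c by auto
  have "(\<Sum>g\<in>Q \<rightarrow>\<^sub>E K. \<phi> (g c1) (g c2) * (\<Prod>c\<in>Q. e c (g c))) =
     (\<Sum>k\<in>K. \<Sum>l\<in>K. \<Sum>g\<in>?Q \<rightarrow>\<^sub>E K. \<phi> k l * (e c1 k * e c2 l) * (\<Prod>c\<in>?Q. e c (g c)))"
    unfolding sum_PiE_remove[OF c(1)] sum_PiE_remove[OF c2]
  proof (intro sum.cong refl)
    fix k l g
    have "(\<Prod>c\<in>Q. e c (((g(c2 := l))(c1 := k)) c)) =
       e c1 k * (\<Prod>c\<in>Q - {c1}. e c (((g(c2 := l))(c1 := k)) c))"
      using fin c by (subst prod.remove[of _ c1]) auto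
    also have "(\<Prod>c\<in>Q - {c1}. e c (((g(c2 := l))(c1 := k)) c)) = e c2 l *
        (\<Prod>c\<in>?Q. e c (((g(c2 := l))(c1 := k)) c))"
      using fin c by (subst prod.remove[of _ c2]) auto
    also have "(\<Prod>c\<in>?Q. e c (((g(c2 := l))(c1 := k)) c)) = (\<Prod>c\<in>?Q. e c (g c))"
      by (intro prod.cong) auto
    finally have E: "(\<Prod>c\<in>Q. e c (((g(c2 := l))(c1 := k)) c)) = e c1 k * (e c2 l *
        (\<Prod>c\<in>?Q. e c (g c)))" .
    show "\<phi> (((g(c2 := l))(c1 := k)) c1) (((g(c2 := l))(c1 := k)) c2) *
        (\<Prod>c\<in>Q. e c (((g(c2 := l))(c1 := k)) c)) =
       \<phi> k l * (e c1 k * e c2 l) * (\<Prod>c\<in>?Q. e c (g c))" unfolding E using c by simp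
  qed
  also have "\<dots> = (\<Sum>k\<in>K. \<Sum>l\<in>K. \<phi> k l * (e c1 k * e c2 l)) * (\<Sum>g\<in>?Q \<rightarrow>\<^sub>E K. \<Prod>c\<in>?Q. e c (g c))"
    by (simp only: sum_distrib_left[symmetric] sum_distrib_right[symmetric])
  also have "(\<Sum>g\<in>?Q \<rightarrow>\<^sub>E K. \<Prod>c\<in>?Q. e c (g c)) = (\<Prod>c\<in>?Q. \<Sum>k\<in>K. e c k)"
    using fin by (subst prod_sum_PiE) auto
  also have "?Q = Q - {c1, c2}" by auto
  finally show ?thesis .
qed

section \<open>The two-point sum for a fixed realization\<close>

definition s1_coeff :: "nat \<Rightarrow> nat \<Rightarrow> nat \<Rightarrow> real" where
  "s1_coeff twoS k l = (if k = l + 1 \<or> l = k + 1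
     then sqrt (real twoS / 2 * (real twoS / 2 + 1) - spinval twoS k * spinval twoS l) / 2 else 0)"

lemma s1_coeff_commute: "s1_coeff twoS k l = s1_coeff twoS l k"
  by (auto simp: s1_coeff_def mult.commute)

lemma s1_coeff_square:
  assumes "k \<le> twoS" "l \<le> twoS"
  shows "s1_coeff twoS k l * s1_coeff twoS k l = (if k = l + 1 \<or> l = k + 1
     then (real twoS / 2 * (real twoS / 2 + 1) - spinval twoS k * spinval twoS l) / 4 else 0)"
proof -
  have *: "spinval twoS (Suc j) * spinval twoS j \<le> real twoS / 2 * (real twoS / 2 + 1)"
      if "Suc j \<le> twoS" for j
  proof -
    have "real j + 1 \<le> real twoS" using that by linarith
    \<comment> \<open>With a = j - S one has S(S+1) - a(a+1) = (j + 1)(2S - j), so the radicand is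
      nonnegative.\<close>
    then have "0 \<le> (real j + 1) * (real twoS - real j)" by simp
    then show ?thesis by (simp add: spinval_def field_simps)
  qed
  then have "spinval twoS k * spinval twoS l \<le> real twoS / 2 * (real twoS / 2 + 1)" if "k = l +
      1 \<or> l = k + 1"
    using that assms by (auto simp: mult.commute)
  then show ?thesis by (auto simp: s1_coeff_def)
qed

text \<open>The two terms for each \<open>k\<close> are the two ways to place neighbouring spins on
  the two arcs; they become the two exponentials in \<open>ztilde\<close>.\<close>

lemma sum_neighbours:
  "(\<Sum>k\<le>n. \<Sum>l\<le>n. if k = l + 1 \<or> l = k + 1 then \<psi> k l else (0 :: real)) =
   (\<Sum>k<n. \<psi> (Suc k) k + \<psi> k (Suc k))"
proof -
  have "(\<Sum>k\<le>n. \<Sum>l\<le>n. if k = l + 1 \<or> l = k + 1 then \<psi> k l else (0 :: real)) =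
     (\<Sum>k\<le>n. \<Sum>l\<le>n. if k = Suc l then \<psi> k l else 0) + (\<Sum>k\<le>n. \<Sum>l\<le>n. if l = Suc k then \<psi> k l else 0)"
    unfolding sum.distrib[symmetric] by (intro sum.cong) auto
  also have "(\<Sum>k\<le>n. \<Sum>l\<le>n. if k = Suc l then \<psi> k l else 0) = (\<Sum>l\<le>n. \<Sum>k\<le>n. if k =
      Suc l then \<psi> k l else 0)"
    by (rule sum.swap)
  also have "\<dots> = (\<Sum>l\<le>n. if l < n then \<psi> (Suc l) l else 0)"
    by (intro sum.cong refl) (auto simp: Suc_le_eq)
  also have "\<dots> = (\<Sum>l<n. \<psi> (Suc l) l)"
    by (intro sum.mono_neutral_cong_right) auto
  also have "(\<Sum>k\<le>n. \<Sum>l\<le>n. if l = Suc k then \<psi> k l else 0) =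
      (\<Sum>k\<le>n. if k < n then \<psi> k (Suc k) else 0)"
    by (intro sum.cong refl) (auto simp: Suc_le_eq)
  also have "\<dots> = (\<Sum>k<n. \<psi> k (Suc k))"
    by (intro sum.mono_neutral_cong_right) auto
  finally show ?thesis by (simp add: sum.distrib)
qed

text \<open>If each site's ends are paired with each other, the spin cannot jump at the origin and
  the sum vanishes, while gluing creates no connection to \<open>x\<close>. Otherwise two open arcs
  run between the sites; gluing merges exactly these two into the loop through both points, and all
  other classes are already loops.\<close>

lemma sum_paths_two_point:
  assumes good: "good_bridges Lam t \<omega>" and fin: "finite Lam"
    and ox: "origin \<in> Lam" "x \<in> Lam" "x \<noteq> origin"
  shows "(\<Sum>f\<in>spin_paths Lam twoS t \<omega> {origin, x}.
      s1_coeff twoS (f (origin, 0)) (f (origin, prevcut \<omega> origin t)) *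
      s1_coeff twoS (f (x, 0)) (f (x, prevcut \<omega> x t)) * exp (energy Lam twoS h t \<omega> f)) =
    (if connected0 Lam t \<omega> x then 1 else 0) * ztilde twoS Lam t \<omega> h x *
      (\<Prod>\<gamma>\<in>loops Lam t \<omega> - {loop0x Lam t \<omega>}. zact twoS t \<omega> h \<gamma>)"
proof -
  let ?S = "segs Lam t \<omega>"
  define r where "r = seg_conn Lam t \<omega> {origin, x}"
  define r0 where "r0 = seg_conn Lam t \<omega> {}"
  define P where "P = (origin, 0 :: real)"
  define P' where "P' = (origin, prevcut \<omega> origin t)"
  define Q where "Q = (x, 0 :: real)"
  define Q' where "Q' = (x, prevcut \<omega> x t)"
  have fS: "finite ?S" using fin by simp
  have eqr: "equiv ?S r" unfolding r_def by (rule equiv_seg_conn)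
  have eqr0: "equiv ?S r0" unfolding r0_def by (rule equiv_seg_conn)
  have symr: "(p, q) \<in> r \<Longrightarrow> (q, p) \<in> r" for p q using eqr unfolding equiv_def by (meson symD)
  have transr: "(p, q) \<in> r \<Longrightarrow> (q, z) \<in> r \<Longrightarrow> (p, z) \<in> r"
      for p q z using eqr unfolding equiv_def by (meson transD)
  have transr0: "(p, q) \<in> r0 \<Longrightarrow> (q, z) \<in> r0 \<Longrightarrow> (p, z) \<in> r0"
      for p q z using eqr0 unfolding equiv_def by (meson transD)
  have symr0: "(p, q) \<in> r0 \<Longrightarrow> (q, p) \<in> r0" for p q using eqr0 unfolding equiv_def by (meson symD)
  have reflr: "p \<in> ?S \<Longrightarrow> (p, p) \<in> r" for p using eqr unfolding equiv_def refl_on_def by blast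
  have rS: "(p, q) \<in> r \<Longrightarrow> p \<in> ?S \<and> q \<in> ?S" for p q using eqr unfolding equiv_def by blast
  have S: "P \<in> ?S" "P' \<in> ?S" "Q \<in> ?S" "Q' \<in> ?S"
    using ox prevcut_less[OF good good_pos[OF good]] unfolding P_def P'_def Q_def Q'_def
        segs_good[OF good] by auto
  \<comment> \<open>Closing the cuts adds just two links, from the top to the bottom segment at each
    of the two sites.\<close>
  have link0: "(p, q) \<in> seg_link Lam t \<omega> {} \<longleftrightarrow>
      (p, q) \<in> seg_link Lam t \<omega> {origin, x} \<or> (p, q) = (P', P) \<or> (p, q) = (Q', Q)" for p q
    unfolding seg_link_iff[OF good] P_def P'_def Q_def Q'_def using ox by auto
  have r_r0: "r \<subseteq> r0" unfolding r_def
    using seg_link_subset_conn[of Lam t \<omega> "{}"] link0 eqr0 unfolding r0_def by (intro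
        seg_conn_least) auto
  have P0: "(P, P') \<in> r0" "(Q, Q') \<in> r0"
    using seg_link_subset_conn[of Lam t \<omega> "{}"] link0[of P' P] link0[of Q' Q] symr0 unfolding
        r0_def by blast+
  have conn0: "connected0 Lam t \<omega> x \<longleftrightarrow> (P, Q) \<in> r0" by (simp add: connected0_def r0_def P_def Q_def)
  have least: "r0 \<subseteq> T" if "equiv ?S T" "r \<subseteq> T" "(P', P) \<in> T" "(Q', Q) \<in> T" for T
    unfolding r0_def
  proof (rule seg_conn_least[OF that(1)], rule subrelI)
    fix p q assume "(p, q) \<in> seg_link Lam t \<omega> {}"
    then show "(p, q) \<in> T" unfolding link0
      using that seg_link_subset_conn[of Lam t \<omega> "{origin, x}"] unfolding r_def by blast
  qed
  from free_ends_pairing[OF good fin ox]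
  consider (A) "(P, P') \<in> r" "(Q, Q') \<in> r" "(P, Q) \<notin> r"
    | (B) "(P, P') \<notin> r" "(P, Q) \<in> r \<and> (P', Q') \<in> r \<or> (P, Q') \<in> r \<and> (P', Q) \<in> r"
    unfolding r_def P_def P'_def Q_def Q'_def by blast
  then show ?thesis
  proof cases
    case A
    \<comment> \<open>The two added links join segments that are already connected.\<close>
    have "r0 = r" using least[OF eqr] A symr r_r0 by blast
    then have "\<not> connected0 Lam t \<omega> x" using A conn0 by simp
    moreover have "f P = f P'" if "f \<in> spin_paths Lam twoS t \<omega> {origin, x}" for f
      using that A(1) unfolding spin_paths_conn r_def by blast
    then have "s1_coeff twoS (f P) (f P') = 0" if "f \<in> spin_paths Lam twoS t \<omega> {origin, x}" for f
      unfolding s1_coeff_def using that by (metis n_not_Suc_n Suc_eq_plus1)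
    ultimately show ?thesis by (simp add: P_def P'_def)
  next
    case B
    \<comment> \<open>\<open>c1\<close> is the arc leaving the origin upwards, that is
      \<open>arc_plus\<close>; \<open>c2\<close> is the arc that reaches the origin from
      below.\<close>
    define c1 where "c1 = r `` {P}"
    define c2 where "c2 = r `` {P'}"
    let ?Qs = "?S // r"
    have c12: "c1 \<in> ?Qs" "c2 \<in> ?Qs" unfolding c1_def c2_def using S by (auto intro: quotientI)
    have c_ne: "c1 \<noteq> c2" using B(1) S reflr unfolding c1_def c2_def by blast
    have disj: "c1 \<inter> c2 = {}" using quotient_disj[OF eqr c12] c_ne by blast
    have mem: "(p, q) \<in> r \<Longrightarrow> p \<in> c1 \<longleftrightarrow> q \<in> c1" "(p, q) \<in> r \<Longrightarrow> p \<in> c2 \<longleftrightarrow> q \<in> c2" for p q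
      unfolding c1_def c2_def using symr transr by blast+
    let ?D = "c1 \<union> c2"
    have PD: "P \<in> c1" "P' \<in> c2" unfolding c1_def c2_def using S reflr by auto
    have QD: "Q \<in> ?D" "Q' \<in> ?D" using B(2) unfolding c1_def c2_def by auto
    have D0: "(P, p) \<in> r0" if "p \<in> ?D" for p
      using that r_r0 P0(1) transr0 unfolding c1_def c2_def by blast
    have DS: "?D \<subseteq> ?S" unfolding c1_def c2_def using rS by blast
    \<comment> \<open>The right-hand side is an equivalence that contains \<open>r\<close> and the
      two closing links, since all four ends lie in the two arcs; minimality of \<open>r0\<close>
      gives one inclusion.\<close>
    have r0_eq: "(p, q) \<in> r0 \<longleftrightarrow> (p, q) \<in> r \<or> p \<in> ?D \<and> q \<in> ?D" for p q
    proof
      let ?T = "{(p, q). (p, q) \<in> r \<or> p \<in> ?D \<and> q \<in> ?D}"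
      have "equiv ?S ?T"
      proof (rule equivI)
        show "?T \<subseteq> ?S \<times> ?S" using rS DS by blast
        show "refl_on ?S ?T" unfolding refl_on_def using reflr by blast
        show "sym ?T" unfolding sym_def using symr by blast
        show "trans ?T"
        proof (rule transI)
          fix a b c assume "(a, b) \<in> ?T" "(b, c) \<in> ?T"
          then show "(a, c) \<in> ?T" using transr[of a b c] mem[of a b] mem[of b c] by auto
        qed
      qed
      then have "r0 \<subseteq> ?T" using PD QD by (intro least) auto
      then show "(p, q) \<in> r0 \<Longrightarrow> (p, q) \<in> r \<or> p \<in> ?D \<and> q \<in> ?D" by blast
      show "(p, q) \<in> r \<or> p \<in> ?D \<and> q \<in> ?D \<Longrightarrow> (p, q) \<in> r0"
        using r_r0 D0 symr0 transr0 by blast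
    qed
    have class0: "r0 `` {p} = (if p \<in> ?D then ?D else r `` {p})" for p
    proof (rule set_eqI)
      fix q
      show "q \<in> r0 `` {p} \<longleftrightarrow> q \<in> (if p \<in> ?D then ?D else r `` {p})"
        using r0_eq[of p q] mem[of p q] by auto
    qed
    have conn: "connected0 Lam t \<omega> x" unfolding conn0 r0_eq using PD QD by auto
    have loop: "loop0x Lam t \<omega> = ?D"
      using class0[of P] PD unfolding loop0x_def r0_def P_def by simp
    have arc: "arc_plus Lam t \<omega> x = c1" unfolding arc_plus_def c1_def r_def P_def ..
    have loops: "loops Lam t \<omega> - {loop0x Lam t \<omega>} = ?Qs - {c1, c2}"
    proof (intro equalityI subsetI)
      fix c assume c: "c \<in> loops Lam t \<omega> - {loop0x Lam t \<omega>}"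
      then have "c \<in> ?S // r0" by (simp add: loops_def r0_def)
      then obtain p where p: "p \<in> ?S" "c = r0 `` {p}" by (rule quotientE)
      then have "p \<notin> ?D" using c class0[of p] loop by auto
      then have "c = r `` {p}" using p class0[of p] by simp
      moreover have "p \<in> r `` {p}" using p reflr by auto
      ultimately show "c \<in> ?Qs - {c1, c2}" using \<open>p \<notin> ?D\<close> quotientI[OF p(1), of r] by blast
    next
      fix c assume c: "c \<in> ?Qs - {c1, c2}"
      then have "c \<in> ?Qs" by blast
      then obtain p where p: "p \<in> ?S" "c = r `` {p}" by (rule quotientE)
      have pc: "p \<in> c" using p reflr by auto
      have "p \<notin> ?D" using quotient_disj[OF eqr _ c12(1), of c] quotient_disj[OF eqr _ c12(2),
          of c] c pc by blast
      then have "c = r0 `` {p}" using p class0[of p] by simp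
      moreover have "c \<noteq> ?D" using pc \<open>p \<notin> ?D\<close> by blast
      ultimately show "c \<in> loops Lam t \<omega> - {loop0x Lam t \<omega>}"
        unfolding loop loops_def r0_def[symmetric] using quotientI[OF p(1), of r0] by blast
    qed
    let ?Wp = "hlen t \<omega> h c1" and ?Wm = "hlen t \<omega> h c2" and ?s = "spinval twoS"
    let ?e = "\<lambda>c k. exp (?s k * hlen t \<omega> h c)"
    have hD: "hlen t \<omega> h ?D = ?Wp + ?Wm"
      unfolding hlen_def using disj DS fS by (intro sum.union_disjoint) (auto intro: finite_subset)
    \<comment> \<open>The ends at \<open>x\<close> carry the same two spins as those at the origin,
      possibly exchanged. As the matrix element of S^1 is symmetric, its square appears and the root
      in it disappears.\<close>
    have val: "s1_coeff twoS (f P) (f P') * s1_coeff twoS (f Q) (f Q') =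
         s1_coeff twoS (g c1) (g c2) * s1_coeff twoS (g c1) (g c2)"
      if f: "f = (\<lambda>p\<in>?S. g (r `` {p}))" for f g
    proof -
      have fP: "f P = g c1" "f P' = g c2" using S f by (simp_all add: c1_def c2_def)
      have cl: "r `` {p} = r `` {q}" if "(p, q) \<in> r" for p q using equiv_class_eq[OF eqr that] .
      from B(2) show ?thesis
      proof
        assume *: "(P, Q) \<in> r \<and> (P', Q') \<in> r"
        have "f Q = g c1" "f Q' = g c2" using S f *
            cl[of P Q] cl[of P' Q'] by (simp_all add: c1_def c2_def)
        then show ?thesis using fP by simp
      next
        assume *: "(P, Q') \<in> r \<and> (P', Q) \<in> r"
        have "f Q' = g c1" "f Q = g c2" using S f *
            cl[of P Q'] cl[of P' Q] by (simp_all add: c1_def c2_def)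
        then show ?thesis using fP by (simp add: s1_coeff_commute)
      qed
    qed
    have "(\<Sum>f\<in>spin_paths Lam twoS t \<omega> {origin, x}.
      s1_coeff twoS (f P) (f P') * s1_coeff twoS (f Q) (f Q') * exp (energy Lam twoS h t \<omega> f)) =
      (\<Sum>g\<in>?Qs \<rightarrow>\<^sub>E {..twoS}. (s1_coeff twoS (g c1) (g c2) * s1_coeff twoS (g c1) (g c2)) *
          (\<Prod>c\<in>?Qs. ?e c (g c)))"
      unfolding sum_spin_paths_quotient r_def[symmetric]
    proof (rule sum.cong[OF refl])
      fix g
      show "s1_coeff twoS ((\<lambda>p\<in>?S. g (r `` {p})) P) ((\<lambda>p\<in>?S. g (r `` {p})) P') *
         s1_coeff twoS ((\<lambda>p\<in>?S. g (r `` {p})) Q) ((\<lambda>p\<in>?S. g (r `` {p})) Q') *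
         exp (energy Lam twoS h t \<omega> (\<lambda>p\<in>?S. g (r `` {p}))) =
         (s1_coeff twoS (g c1) (g c2) * s1_coeff twoS (g c1) (g c2)) * (\<Prod>c\<in>?Qs. ?e c (g c))"
        using val[OF refl, of g] exp_energy_quotient[OF fin, of twoS h t \<omega> g "{origin, x}",
            folded r_def]
        by (simp only:)
    qed
    also have "\<dots> = (\<Sum>k\<le>twoS. \<Sum>l\<le>twoS. (s1_coeff twoS k l * s1_coeff twoS k l) * (?e c1 k *
        ?e c2 l)) *
        (\<Prod>c\<in>?Qs - {c1, c2}. \<Sum>k\<le>twoS. ?e c k)"
      using finite_segs_quotient[OF fin, of t \<omega> "{origin, x}"] c12 c_ne unfolding r_def[symmetric]
      by (intro sum_PiE_two[of ?Qs "{..twoS}" c1 c2 "\<lambda>k l. s1_coeff twoS k l * s1_coeff twoS k l"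
          ?e]) auto
    also have "(\<Sum>k\<le>twoS. \<Sum>l\<le>twoS. (s1_coeff twoS k l * s1_coeff twoS k l) * (?e c1 k * ?e c2 l)) =
        (\<Sum>k\<le>twoS. \<Sum>l\<le>twoS. if k = l + 1 \<or> l = k + 1 then
           (real twoS / 2 * (real twoS / 2 + 1) - ?s k * ?s l) / 4 * exp (?s k * ?Wp + ?s l *
               ?Wm) else 0)"
      by (intro sum.cong refl) (simp add: s1_coeff_square exp_add)
    also have "\<dots> = ztilde twoS Lam t \<omega> h x"
    proof -
      \<comment> \<open>Raising the index by one raises the spin value by one; the factor 1/4 is the
        square of the 1/2 in S^1.\<close>
      have "?s (Suc k) = ?s k + 1" for k by (simp add: spinval_def)
      then show ?thesis
        unfolding sum_neighbours ztilde_def Let_def arc loop hD sum_distrib_left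
        by (intro sum.cong refl) (simp add: algebra_simps add_divide_distrib diff_divide_distrib)
    qed
    finally show ?thesis
      using conn unfolding loops zact_def P_def P'_def Q_def Q'_def by simp
  qed
qed

text \<open>In the trace \<open>B\<close> acts at the seam between time 0 and time \<open>t\<close>.
  Since \<open>path_weight\<close> has its top index first, \<open>B\<close> receives the bottom
  configuration in its first slot and the top one in its second.\<close>

lemma trace_path_weight:
  assumes good: "good_bridges Lam t \<omega>" and fin: "finite Lam"
  shows "(\<Sum>\<sigma>\<in>configs Lam twoS. \<Sum>\<tau>\<in>configs Lam twoS. B \<sigma> \<tau> * path_weight Lam twoS h t \<omega> \<tau> \<sigma>) =
    (\<Sum>f\<in>spin_paths Lam twoS t \<omega> Lam. B (bottom_cfg Lam f) (top_cfg Lam t \<omega> f) *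
        exp (energy Lam twoS h t \<omega> f))"
proof -
  let ?C = "configs Lam twoS" and ?F = "spin_paths Lam twoS t \<omega> Lam"
  let ?g = "\<lambda>f. B (bottom_cfg Lam f) (top_cfg Lam t \<omega> f) * exp (energy Lam twoS h t \<omega> f)"
  have "(\<Sum>f\<in>?F. ?g f) = (\<Sum>\<sigma>\<in>?C. \<Sum>f | f \<in> ?F \<and> bottom_cfg Lam f = \<sigma>. ?g f)"
    using top_cfg_in_configs[OF good] finite_spin_paths[OF fin] finite_configs[OF fin]
    by (intro sum.group[symmetric]) auto
  also have "\<dots> = (\<Sum>\<sigma>\<in>?C. \<Sum>\<tau>\<in>?C. \<Sum>f | f \<in> {f. f \<in> ?F \<and> bottom_cfg Lam f = \<sigma>} \<and> top_cfg Lam t \<omega> f =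
      \<tau>. ?g f)"
    using top_cfg_in_configs[OF good] finite_spin_paths[OF fin] finite_configs[OF fin]
    by (intro sum.cong refl sum.group[symmetric]) auto
  also have "\<dots> = (\<Sum>\<sigma>\<in>?C. \<Sum>\<tau>\<in>?C. B \<sigma> \<tau> * path_weight Lam twoS h t \<omega> \<tau> \<sigma>)"
    unfolding path_weight_def sum_distrib_left by (intro sum.cong refl) auto
  finally show ?thesis ..
qed

text \<open>A wrap-around link at \<open>v\<close> is exactly the equation between bottom and top
  spin at \<open>v\<close>.\<close>

lemma spin_paths_subset:
  assumes good: "good_bridges Lam t \<omega>"
  shows "f \<in> spin_paths Lam twoS t \<omega> M \<longleftrightarrow>
    f \<in> spin_paths Lam twoS t \<omega> Lam \<and> (\<forall>v\<in>Lam - M. bottom_cfg Lam f v = top_cfg Lam t \<omega> f v)"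
  unfolding spin_paths_def mem_Collect_eq respects_seg_link_iff[OF good]
  by (auto simp: bottom_cfg_def top_cfg_def)

text \<open>The identity at the seam equates bottom and top at every site, which closes all the
  wrap-arounds.\<close>

lemma trace_loops:
  assumes good: "good_bridges Lam t \<omega>" and fin: "finite Lam"
  shows "(\<Sum>\<sigma>\<in>configs Lam twoS. \<Sum>\<tau>\<in>configs Lam twoS. (if \<sigma> = \<tau> then 1 else 0) *
      path_weight Lam twoS h t \<omega> \<tau> \<sigma>) =
    (\<Prod>\<gamma>\<in>loops Lam t \<omega>. zact twoS t \<omega> h \<gamma>)"
proof -
  have *: "f \<in> spin_paths Lam twoS t \<omega> {} \<longleftrightarrow>
    f \<in> spin_paths Lam twoS t \<omega> Lam \<and> bottom_cfg Lam f = top_cfg Lam t \<omega> f" for f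
    unfolding spin_paths_subset[OF good, of f _ "{}"] fun_eq_iff[of "bottom_cfg Lam f"]
    by (auto simp: bottom_cfg_def top_cfg_def)
  show ?thesis
    unfolding trace_path_weight[OF good fin] sum_paths_loops[OF fin, symmetric]
    using finite_spin_paths[OF fin] by (intro sum.mono_neutral_cong_right) (auto simp: *)
qed

definition s1_pair :: "nat \<Rightarrow> site \<Rightarrow> cfg \<Rightarrow> cfg \<Rightarrow> real" where
  "s1_pair twoS x \<sigma> \<tau> = (if \<forall>v. v \<noteq> origin \<and> v \<noteq> x \<longrightarrow> \<sigma> v = \<tau> v
     then s1_coeff twoS (\<sigma> origin) (\<tau> origin) * s1_coeff twoS (\<sigma> x) (\<tau> x) else 0)"

text \<open>\<open>s1_pair\<close> forces bottom and top to agree away from the two sites, which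
  closes the wrap-arounds there and leaves the origin and \<open>x\<close> open.\<close>

lemma trace_two_point:
  assumes good: "good_bridges Lam t \<omega>" and fin: "finite Lam"
    and ox: "origin \<in> Lam" "x \<in> Lam" "x \<noteq> origin"
  shows "(\<Sum>\<sigma>\<in>configs Lam twoS. \<Sum>\<tau>\<in>configs Lam twoS. s1_pair twoS x \<sigma> \<tau> *
      path_weight Lam twoS h t \<omega> \<tau> \<sigma>) =
    (if connected0 Lam t \<omega> x then 1 else 0) * ztilde twoS Lam t \<omega> h x *
      (\<Prod>\<gamma>\<in>loops Lam t \<omega> - {loop0x Lam t \<omega>}. zact twoS t \<omega> h \<gamma>)"
  unfolding trace_path_weight[OF good fin] sum_paths_two_point[OF assms, symmetric]
proof (rule sum.mono_neutral_cong_right[OF finite_spin_paths[OF fin]])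
  let ?P = "spin_paths Lam twoS t \<omega> {origin, x}"
  have off: "bottom_cfg Lam f v = top_cfg Lam t \<omega> f v" if "v \<notin> Lam" for f v
    using that by (simp add: bottom_cfg_def top_cfg_def)
  have iff: "f \<in> ?P \<longleftrightarrow> f \<in> spin_paths Lam twoS t \<omega> Lam \<and>
     (\<forall>v. v \<noteq> origin \<and> v \<noteq> x \<longrightarrow> bottom_cfg Lam f v = top_cfg Lam t \<omega> f v)" for f
    unfolding spin_paths_subset[OF good, of f _ "{origin, x}"] using off by blast
  show "?P \<subseteq> spin_paths Lam twoS t \<omega> Lam" using iff by blast
  show "\<forall>f\<in>spin_paths Lam twoS t \<omega> Lam - ?P.
       s1_pair twoS x (bottom_cfg Lam f) (top_cfg Lam t \<omega> f) * exp (energy Lam twoS h t \<omega> f) = 0"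
  proof
    fix f assume "f \<in> spin_paths Lam twoS t \<omega> Lam - ?P"
    then have n: "\<not> (\<forall>v. v \<noteq> origin \<and> v \<noteq> x \<longrightarrow> bottom_cfg Lam f v = top_cfg Lam t \<omega> f v)"
        using iff by blast
    show "s1_pair twoS x (bottom_cfg Lam f) (top_cfg Lam t \<omega> f) * exp (energy Lam twoS h t \<omega> f) = 0"
      unfolding s1_pair_def if_not_P[OF n] by simp
  qed
  fix f assume "f \<in> ?P"
  then have "\<forall>v. v \<noteq> origin \<and> v \<noteq> x \<longrightarrow> bottom_cfg Lam f v = top_cfg Lam t \<omega> f v" using iff by blast
  then have "s1_pair twoS x (bottom_cfg Lam f) (top_cfg Lam t \<omega> f) =
      s1_coeff twoS (bottom_cfg Lam f origin) (top_cfg Lam t \<omega> f origin) *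
          s1_coeff twoS (bottom_cfg Lam f x) (top_cfg Lam t \<omega> f x)"
    unfolding s1_pair_def by (rule if_P)
  then show "s1_pair twoS x (bottom_cfg Lam f) (top_cfg Lam t \<omega> f) * exp (energy Lam twoS h t \<omega> f) =
      s1_coeff twoS (f (origin, 0)) (f (origin, prevcut \<omega> origin t)) *
      s1_coeff twoS (f (x, 0)) (f (x, prevcut \<omega> x t)) * exp (energy Lam twoS h t \<omega> f)"
    using ox by (simp add: bottom_cfg_def top_cfg_def)
qed

lemma S1_s1_coeff:
  "S1 twoS x \<sigma> \<tau> = complex_of_real (if \<forall>v. v \<noteq> x \<longrightarrow> \<sigma> v = \<tau> v then s1_coeff twoS (\<sigma> x) (\<tau> x) else 0)"
proof -
  have "(if a \<and> b then complex_of_real z else 0) =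
      complex_of_real (if a then (if b then z else 0) else 0)" for a b z
    by simp
  then show ?thesis unfolding S1_def s1_coeff_def .
qed

lemma op_mult_S1:
  assumes "origin \<in> Lam" "x \<noteq> origin" "finite Lam" "\<sigma> \<in> configs Lam twoS" "\<tau> \<in> configs Lam twoS"
  shows "op_mult (configs Lam twoS) (S1 twoS origin) (S1 twoS x) \<sigma> \<tau> =
      complex_of_real (s1_pair twoS x \<sigma> \<tau>)"
proof -
  \<comment> \<open>The only intermediate configuration that can contribute: the operator at the
    origin has acted, the one at \<open>x\<close> has not.\<close>
  let ?\<rho> = "\<sigma>(origin := \<tau> origin)"
  let ?a = "\<lambda>x \<sigma> \<tau>. if \<forall>v. v \<noteq> x \<longrightarrow> \<sigma> v = \<tau> v then s1_coeff twoS (\<sigma> x) (\<tau> x) else 0"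
  have \<rho>: "?\<rho> \<in> configs Lam twoS"
    using assms(1,4,5) unfolding configs_def PiE_iff extensional_def by simp
  have zero: "?a origin \<sigma> \<rho> * ?a x \<rho> \<tau> = 0" if "\<rho> \<noteq> ?\<rho>" for \<rho>
  proof (rule ccontr)
    assume "?a origin \<sigma> \<rho> * ?a x \<rho> \<tau> \<noteq> 0"
    then have 1: "\<forall>v. v \<noteq> origin \<longrightarrow> \<sigma> v = \<rho> v" and 2: "\<forall>v. v \<noteq> x \<longrightarrow> \<rho> v = \<tau> v"
      by (auto split: if_splits)
    have "\<rho> = ?\<rho>"
      using 1 2 assms(2) by (intro ext) simp
    then show False using that by simp
  qed
  have "(\<Sum>\<rho>\<in>configs Lam twoS. ?a origin \<sigma> \<rho> * ?a x \<rho> \<tau>) = ?a origin \<sigma> ?\<rho> * ?a x ?\<rho> \<tau>"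
  proof -
    have "(\<Sum>\<rho>\<in>configs Lam twoS - {?\<rho>}. ?a origin \<sigma> \<rho> * ?a x \<rho> \<tau>) = 0"
      by (rule sum.neutral) (use zero in blast)
    then show ?thesis unfolding sum.remove[OF finite_configs[OF assms(3)] \<rho>] by simp
  qed
  also have "\<dots> = s1_pair twoS x \<sigma> \<tau>"
  proof -
    have "(\<forall>v. v \<noteq> x \<longrightarrow> ?\<rho> v = \<tau> v) \<longleftrightarrow> (\<forall>v. v \<noteq> origin \<and> v \<noteq> x \<longrightarrow> \<sigma> v = \<tau> v)" by simp blast
    then show ?thesis unfolding s1_pair_def using assms(2) by (simp; blast)
  qed
  finally show ?thesis
    unfolding op_mult_def S1_s1_coeff of_real_mult[symmetric] of_real_sum[symmetric] by simp
qed

section \<open>Measurability of the loop integrands\<close>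

definition bridge_times :: "bridges \<Rightarrow> real set" where
  "bridge_times \<omega> = (\<lambda>(x, y, s, c). s) ` set \<omega>"

text \<open>An increasing change of bridge times that fixes 0 and \<open>\<beta>\<close> transports
  the whole loop structure. Ties and bridges at time 0 are allowed, since measurability is needed on
  the whole cube of times.\<close>

definition time_change :: "real \<Rightarrow> (real \<Rightarrow> real) \<Rightarrow> bridges \<Rightarrow> bridges \<Rightarrow> bool" where
  "time_change \<beta> \<psi> \<omega> \<omega>' \<longleftrightarrow> 0 < \<beta> \<and> \<psi> 0 = 0 \<and> \<psi> \<beta> = \<beta> \<and>
     set \<omega>' = (\<lambda>(x, y, s, c). (x, y, \<psi> s, c)) ` set \<omega> \<and>
     bridge_times \<omega> \<subseteq> {0..<\<beta>} \<and> strict_mono_on (insert 0 (insert \<beta> (bridge_times \<omega>))) \<psi>"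

abbreviation retime :: "(real \<Rightarrow> real) \<Rightarrow> site \<times> real \<Rightarrow> site \<times> real" where
  "retime \<psi> \<equiv> map_prod id \<psi>"

lemma loops_subset: "loops Lam \<beta> \<omega> \<subseteq> Pow (segs Lam \<beta> \<omega>)"
  unfolding loops_def quotient_def seg_conn_def by auto

lemma cut_times_subset: "cut_times \<omega> v \<subseteq> insert 0 (bridge_times \<omega>)"
  unfolding cut_times_def bridge_times_def by force

lemma bridge_times_mem: "(x, y, s, c) \<in> set \<omega> \<Longrightarrow> s \<in> bridge_times \<omega>"
  unfolding bridge_times_def by force

text \<open>Time changes are reversible, so for connectivity it suffices to prove preservation in
  one direction.\<close>

lemma time_change_inverse:
  assumes "time_change \<beta> \<psi> \<omega> \<omega>'"
  obtains \<phi> where "time_change \<beta> \<phi> \<omega>' \<omega>" "\<And>s. s \<in> insert 0 (insert \<beta> (bridge_times \<omega>)) \<Longrightarrow> \<phi> (\<psi> s) =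
      s"
proof -
  let ?T = "insert 0 (insert \<beta> (bridge_times \<omega>))"
  have tc: "0 < \<beta>" "\<psi> 0 = 0" "\<psi> \<beta> = \<beta>" "set \<omega>' = (\<lambda>(x, y, s, c). (x, y, \<psi> s, c)) ` set \<omega>"
    "bridge_times \<omega> \<subseteq> {0..<\<beta>}" "strict_mono_on ?T \<psi>"
    using assms by (auto simp: time_change_def)
  have inj: "inj_on \<psi> ?T" using tc(6) by (rule strict_mono_on_imp_inj_on)
  define \<phi> where "\<phi> = the_inv_into ?T \<psi>"
  have \<phi>: "\<phi> (\<psi> s) = s" if "s \<in> ?T" for s unfolding \<phi>_def using the_inv_into_f_f[OF inj that] .
  have bt: "bridge_times \<omega>' = \<psi> ` bridge_times \<omega>"
    unfolding bridge_times_def tc(4) image_image by (rule image_cong) auto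
  have "time_change \<beta> \<phi> \<omega>' \<omega>"
    unfolding time_change_def
  proof (intro conjI)
    show "\<phi> 0 = 0" "\<phi> \<beta> = \<beta>" using \<phi>[of 0] \<phi>[of \<beta>] tc by auto
    have "(\<lambda>(x, y, s, c). (x, y, \<phi> s, c)) ` set \<omega>' = (\<lambda>b. b) ` set \<omega>"
      unfolding tc(4) image_image
    proof (rule image_cong[OF refl])
      fix b assume "b \<in> set \<omega>"
      then show "(case case b of (x, y, s, c) \<Rightarrow> (x, y, \<psi> s, c) of (x, y, s, c) \<Rightarrow> (x, y, \<phi> s, c)) =
          b"
      proof -
        obtain x y s c where b: "b = (x, y, s, c)" by (metis surj_pair)
        then have "s \<in> ?T" using \<open>b \<in> set \<omega>\<close> bridge_times_mem[of x y s c \<omega>] by simp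
        then show ?thesis using b \<phi> by simp
      qed
    qed
    then show "set \<omega> = (\<lambda>(x, y, s, c). (x, y, \<phi> s, c)) ` set \<omega>'" by simp
    show "bridge_times \<omega>' \<subseteq> {0..<\<beta>}"
    proof
      fix s' assume "s' \<in> bridge_times \<omega>'"
      then obtain s where s: "s \<in> bridge_times \<omega>" "s' = \<psi> s" using bt by auto
      have "0 \<le> s" "s < \<beta>" using s tc(5) by auto
      have "\<psi> s < \<psi> \<beta>" using strict_mono_onD[OF tc(6), of s \<beta>] s \<open>s < \<beta>\<close> by auto
      moreover have "\<psi> 0 \<le> \<psi> s"
        using strict_mono_onD[OF tc(6), of 0 s] s \<open>0 \<le> s\<close> by (cases "s = 0") auto
      ultimately show "s' \<in> {0..<\<beta>}" using s tc by simp
    qed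
    have T': "insert 0 (insert \<beta> (bridge_times \<omega>')) = \<psi> ` ?T" using bt tc by simp
    show "strict_mono_on (insert 0 (insert \<beta> (bridge_times \<omega>'))) \<phi>"
      unfolding T'
    proof (rule strict_mono_onI)
      fix a b assume ab: "a \<in> \<psi> ` ?T" "b \<in> \<psi> ` ?T" "a < b"
      then obtain r s where rs: "r \<in> ?T" "s \<in> ?T" "a = \<psi> r" "b = \<psi> s" by blast
      have "r < s"
      proof (rule ccontr)
        assume "\<not> r < s"
        then have "s < r \<or> s = r" by auto
        then show False using strict_mono_onD[OF tc(6) rs(2,1)] ab(3) rs(3,4) by auto
      qed
      then show "\<phi> a < \<phi> b" using \<phi> rs by simp
    qed
  qed (rule tc(1))
  then show thesis using \<phi> that by blast
qed

context
  fixes \<beta> :: real and \<psi> :: "real \<Rightarrow> real" and \<omega> \<omega>' :: bridges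
  assumes tc: "time_change \<beta> \<psi> \<omega> \<omega>'"
begin

lemma time_changeD:
  "0 < \<beta>" "\<psi> 0 = 0" "\<psi> \<beta> = \<beta>" "set \<omega>' = (\<lambda>(x, y, s, c). (x, y, \<psi> s, c)) ` set \<omega>"
    "bridge_times \<omega> \<subseteq> {0..<\<beta>}" "strict_mono_on (insert 0 (insert \<beta> (bridge_times \<omega>))) \<psi>"
  using tc by (auto simp: time_change_def)

lemma time_change_less:
  assumes "a \<in> insert 0 (insert \<beta> (bridge_times \<omega>))" "b \<in> insert 0 (insert \<beta> (bridge_times \<omega>))"
  shows "\<psi> a < \<psi> b \<longleftrightarrow> a < b"
  using strict_mono_onD[OF time_changeD(6) assms] strict_mono_onD[OF time_changeD(6) assms(2,1)]
  by (metis linorder_neqE_linordered_idom less_asym' order_less_irrefl)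

lemma cut_in: "r \<in> cut_times \<omega> v \<Longrightarrow> r \<in> insert 0 (insert \<beta> (bridge_times \<omega>))"
  using cut_times_subset by blast

lemma snd_seg_in: "p \<in> segs Lam \<beta> \<omega> \<Longrightarrow> snd p \<in> insert 0 (insert \<beta> (bridge_times \<omega>))"
  by (cases p) (auto simp: segs_def dest!: cut_in)

lemma cut_times_time_change: "cut_times \<omega>' v = \<psi> ` cut_times \<omega> v"
proof -
  have "(x, y, s', c) \<in> set \<omega>' \<longleftrightarrow> (\<exists>s. (x, y, s, c) \<in> set \<omega> \<and> s' = \<psi> s)" for x y s' c
    unfolding time_changeD(4) image_iff Bex_def split_paired_Ex prod.case prod.inject by blast
  then have "{s. \<exists>x y c. (x, y, s, c) \<in> set \<omega>' \<and> (v = x \<or> v = y)} =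
      \<psi> ` {s. \<exists>x y c. (x, y, s, c) \<in> set \<omega> \<and> (v = x \<or> v = y)}"
    unfolding image_def by (simp only:) blast
  then show ?thesis unfolding cut_times_def image_Un using time_changeD(2) by simp
qed

lemma nxt_time_change:
  assumes "r \<in> cut_times \<omega> v"
  shows "nxt \<beta> \<omega>' v (\<psi> r) = \<psi> (nxt \<beta> \<omega> v r)"
proof -
  let ?A = "{s \<in> cut_times \<omega> v. r < s} \<union> {\<beta>}"
  have sub: "?A \<subseteq> insert 0 (insert \<beta> (bridge_times \<omega>))" using cut_in by blast
  have A': "{s \<in> cut_times \<omega>' v. \<psi> r < s} \<union> {\<beta>} = \<psi> ` ?A"
    unfolding cut_times_time_change using time_change_less[OF cut_in[OF assms] cut_in]
        time_changeD(3) by auto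
  have fin: "finite ?A" by simp
  have MinA: "Min ?A \<in> ?A" using fin by (intro Min_in) auto
  have "Min (\<psi> ` ?A) = \<psi> (Min ?A)"
  proof (rule Min_eqI)
    fix y assume "y \<in> \<psi> ` ?A"
    then obtain a where a: "a \<in> ?A" "y = \<psi> a" by blast
    have "Min ?A \<le> a" using a fin by (intro Min_le) auto
    moreover have "\<psi> a < \<psi> (Min ?A) \<longleftrightarrow> a < Min ?A"
      using a MinA sub by (intro time_change_less) blast+
    ultimately show "\<psi> (Min ?A) \<le> y" using a by auto
  qed (use fin MinA in auto)
  then show ?thesis unfolding nxt_def A' .
qed

lemma cut_less: "r \<in> cut_times \<omega> v \<Longrightarrow> r < \<beta>"
  using cut_times_subset time_changeD(1,5) by fastforce

lemma segs_time_change: "segs Lam \<beta> \<omega>' = retime \<psi> ` segs Lam \<beta> \<omega>"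
proof -
  have "r' \<in> cut_times \<omega>' v \<and> r' < \<beta> \<longleftrightarrow> (\<exists>r\<in>cut_times \<omega> v. r' = \<psi> r)" for r' v
    unfolding cut_times_time_change
    using time_change_less[OF cut_in, of _ v \<beta>] time_changeD(3) cut_less by auto
  then show ?thesis unfolding segs_def using cut_less by (force simp: map_prod_def)
qed

lemma seg_link_time_change:
  assumes "(p, q) \<in> seg_link Lam \<beta> \<omega> M"
  shows "(retime \<psi> p, retime \<psi> q) \<in> seg_link Lam \<beta> \<omega>' M"
proof -
  have pq: "p \<in> segs Lam \<beta> \<omega>" "q \<in> segs Lam \<beta> \<omega>" using seg_link_segs[OF assms] by auto
  then have pq': "retime \<psi> p \<in> segs Lam \<beta> \<omega>'" "retime \<psi> q \<in> segs Lam \<beta> \<omega>'"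
      by (auto simp: segs_time_change)
  have cuts: "snd p \<in> cut_times \<omega> (fst p)" "snd q \<in> cut_times \<omega> (fst q)"
      using pq by (auto simp: segs_def)
  have np: "nxt \<beta> \<omega>' (fst p) (\<psi> (snd p)) = \<psi> (nxt \<beta> \<omega> (fst p) (snd p))"
    and nq: "nxt \<beta> \<omega>' (fst q) (\<psi> (snd q)) = \<psi> (nxt \<beta> \<omega> (fst q) (snd q))"
    using nxt_time_change cuts by auto
  have sel: "fst (retime \<psi> z) = fst z" "snd (retime \<psi> z) = \<psi> (snd z)" for z by (cases z; simp)+
  from assms consider
      "fst p = fst q \<and> snd q = 0 \<and> nxt \<beta> \<omega> (fst p) (snd p) = \<beta> \<and> fst p \<notin> M"
    | x y s c v w where "(x, y, s, c) \<in> set \<omega>" "(v, w) = (x, y) \<or> (v, w) = (y, x)"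
       "if c then fst p = v \<and> nxt \<beta> \<omega> v (snd p) = s \<and> q = (w, s)
        else (fst p = v \<and> nxt \<beta> \<omega> v (snd p) = s \<and> fst q = w \<and> nxt \<beta> \<omega> w (snd q) = s)
                    \<or> (p = (v, s) \<and> q = (w, s))"
    unfolding seg_link_def by blast
  then show ?thesis
  proof cases
    case 1
    then have "nxt \<beta> \<omega>' (fst p) (\<psi> (snd p)) = \<beta>" using np time_changeD(3) by metis
    then have "fst (retime \<psi> p) = fst (retime \<psi> q) \<and> snd (retime \<psi> q) = 0 \<and>
        nxt \<beta> \<omega>' (fst (retime \<psi> p)) (snd (retime \<psi> p)) = \<beta> \<and> fst (retime \<psi> p) \<notin> M"
      using 1 time_changeD(2) unfolding sel by metis
    with pq' show ?thesis unfolding seg_link_def by blast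
  next
    case 2
    have b: "(x, y, \<psi> s, c) \<in> set \<omega>'" unfolding time_changeD(4) using 2(1) by force
    have "if c then fst (retime \<psi> p) = v \<and> nxt \<beta> \<omega>' v (snd (retime \<psi> p)) = \<psi> s \<and> retime \<psi> q = (w,
        \<psi> s)
        else (fst (retime \<psi> p) = v \<and> nxt \<beta> \<omega>' v (snd (retime \<psi> p)) = \<psi> s \<and> fst (retime \<psi> q) = w \<and>
            nxt \<beta> \<omega>' w (snd (retime \<psi> q)) = \<psi> s)
                    \<or> (retime \<psi> p = (v, \<psi> s) \<and> retime \<psi> q = (w, \<psi> s))"
      using 2(3) np nq sel by (cases c) auto
    with b 2(2) pq' show ?thesis unfolding seg_link_def by blast
  qed
qed

lemma seg_conn_time_change:
  assumes "(p, q) \<in> seg_conn Lam \<beta> \<omega> M"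
  shows "(retime \<psi> p, retime \<psi> q) \<in> seg_conn Lam \<beta> \<omega>' M"
proof -
  have "(p, q) \<in> (seg_link Lam \<beta> \<omega> M \<union> (seg_link Lam \<beta> \<omega> M)\<inverse>)\<^sup>*"
    using assms by (simp add: seg_conn_def)
  then have "(retime \<psi> p, retime \<psi> q) \<in> (seg_link Lam \<beta> \<omega>' M \<union> (seg_link Lam \<beta> \<omega>' M)\<inverse>)\<^sup>*"
  proof (induction rule: rtrancl_induct)
    case (step a b)
    then have "(retime \<psi> a, retime \<psi> b) \<in> seg_link Lam \<beta> \<omega>' M \<union> (seg_link Lam \<beta> \<omega>' M)\<inverse>"
      using seg_link_time_change[of a b Lam M] seg_link_time_change[of b a Lam M] by blast
    with step.IH show ?case by (rule rtrancl_into_rtrancl)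
  qed simp
  moreover have "p \<in> segs Lam \<beta> \<omega>" "q \<in> segs Lam \<beta> \<omega>" using assms by (auto simp: seg_conn_def)
  ultimately show ?thesis unfolding seg_conn_def segs_time_change by blast
qed

lemma inj_on_retime: "inj_on (retime \<psi>) (segs Lam \<beta> \<omega>)"
proof (rule inj_onI)
  fix p q assume pq: "p \<in> segs Lam \<beta> \<omega>" "q \<in> segs Lam \<beta> \<omega>" "retime \<psi> p = retime \<psi> q"
  have "snd p \<in> insert 0 (insert \<beta> (bridge_times \<omega>))" "snd q \<in> insert 0 (insert \<beta> (bridge_times \<omega>))"
    using pq(1,2) snd_seg_in by blast+
  moreover have "\<psi> (snd p) = \<psi> (snd q)" "fst p = fst q" using pq(3) by (cases p; cases q; simp)+
  ultimately show "p = q"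
    using time_change_less[of "snd p" "snd q"] time_change_less[of "snd q" "snd p"]
    by (metis prod_eqI linorder_neqE_linordered_idom order_less_irrefl)
qed

end

context
  fixes \<beta> :: real and \<psi> :: "real \<Rightarrow> real" and \<omega> \<omega>' :: bridges
  assumes tc: "time_change \<beta> \<psi> \<omega> \<omega>'"
begin

lemma seg_conn_time_change_iff:
  assumes "p \<in> segs Lam \<beta> \<omega>" "q \<in> segs Lam \<beta> \<omega>"
  shows "(retime \<psi> p, retime \<psi> q) \<in> seg_conn Lam \<beta> \<omega>' M \<longleftrightarrow> (p, q) \<in> seg_conn Lam \<beta> \<omega> M"
proof
  assume a: "(retime \<psi> p, retime \<psi> q) \<in> seg_conn Lam \<beta> \<omega>' M"
  obtain \<phi> where \<phi>: "time_change \<beta> \<phi> \<omega>' \<omega>" "\<And>s. s \<in> insert 0 (insert \<beta> (bridge_times \<omega>)) \<Longrightarrow>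
      \<phi> (\<psi> s) = s"
    using time_change_inverse[OF tc] by blast
  have "retime \<phi> (retime \<psi> z) = z" if "z \<in> segs Lam \<beta> \<omega>" for z
  proof -
    have "snd z \<in> insert 0 (insert \<beta> (bridge_times \<omega>))" using snd_seg_in[OF tc that] .
    then show ?thesis using \<phi>(2) by (cases z) simp
  qed
  then show "(p, q) \<in> seg_conn Lam \<beta> \<omega> M"
    using seg_conn_time_change[OF \<phi>(1) a] assms by simp
qed (rule seg_conn_time_change[OF tc])

lemma seg_conn_class_time_change:
  assumes p: "p \<in> segs Lam \<beta> \<omega>"
  shows "seg_conn Lam \<beta> \<omega>' M `` {retime \<psi> p} = retime \<psi> ` (seg_conn Lam \<beta> \<omega> M `` {p})"
proof (intro equalityI subsetI)
  fix q' assume q': "q' \<in> seg_conn Lam \<beta> \<omega>' M `` {retime \<psi> p}"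
  then have "q' \<in> segs Lam \<beta> \<omega>'" by (auto simp: seg_conn_def)
  then obtain q where q: "q' = retime \<psi> q" "q \<in> segs Lam \<beta> \<omega>"
      unfolding segs_time_change[OF tc] by (rule imageE)
  have "(retime \<psi> p, retime \<psi> q) \<in> seg_conn Lam \<beta> \<omega>' M"
      using q' unfolding q(1) by (rule Image_singleton_iff[THEN iffD1])
  then have "q \<in> seg_conn Lam \<beta> \<omega> M `` {p}"
    unfolding seg_conn_time_change_iff[OF p q(2)] by (rule Image_singleton_iff[THEN iffD2])
  then show "q' \<in> retime \<psi> ` (seg_conn Lam \<beta> \<omega> M `` {p})" unfolding q(1) by (rule imageI)
next
  fix q' assume "q' \<in> retime \<psi> ` (seg_conn Lam \<beta> \<omega> M `` {p})"
  then obtain q where q: "q' = retime \<psi> q" "q \<in> seg_conn Lam \<beta> \<omega> M `` {p}" by (rule imageE)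
  then have "(p, q) \<in> seg_conn Lam \<beta> \<omega> M" by (simp only: Image_singleton_iff)
  from seg_conn_time_change[OF tc this] show "q' \<in> seg_conn Lam \<beta> \<omega>' M `` {retime \<psi> p}"
    unfolding q(1) by (simp only: Image_singleton_iff)
qed

lemma loops_time_change: "loops Lam \<beta> \<omega>' = (`) (retime \<psi>) ` loops Lam \<beta> \<omega>"
proof -
  have quot: "S // r = (\<lambda>p. r `` {p}) ` S" for S and r :: "((site \<times> real) \<times> (site \<times> real)) set"
    unfolding quotient_def by blast
  show ?thesis
    unfolding loops_def quot segs_time_change[OF tc] image_image
    by (intro image_cong refl seg_conn_class_time_change)
qed

lemma retime_zero: "retime \<psi> (v, 0) = (v, 0)"
  by (simp add: time_changeD[OF tc])

lemma zero_in_segs: "v \<in> Lam \<Longrightarrow> (v, 0) \<in> segs Lam \<beta> \<omega>"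
  using time_changeD(1)[OF tc] by (simp add: segs_def)

lemma loop0x_time_change: "origin \<in> Lam \<Longrightarrow> loop0x Lam \<beta> \<omega>' = retime \<psi> ` loop0x Lam \<beta> \<omega>"
  using seg_conn_class_time_change[OF zero_in_segs] unfolding loop0x_def retime_zero .

lemma arc_plus_time_change: "origin \<in> Lam \<Longrightarrow> arc_plus Lam \<beta> \<omega>' x = retime \<psi> ` arc_plus Lam \<beta> \<omega> x"
  using seg_conn_class_time_change[OF zero_in_segs] unfolding arc_plus_def retime_zero .

lemma connected0_time_change:
  "origin \<in> Lam \<Longrightarrow> x \<in> Lam \<Longrightarrow> connected0 Lam \<beta> \<omega>' x \<longleftrightarrow> connected0 Lam \<beta> \<omega> x"
  using seg_conn_time_change_iff[OF zero_in_segs zero_in_segs] unfolding connected0_def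
      retime_zero .

text \<open>The sum runs over segments of the fixed realization \<open>\<omega>\<close>; the new
  times enter only through the values of \<open>\<psi>\<close>. This exhibits measurable dependence
  on the times.\<close>

lemma hlen_time_change:
  assumes "\<gamma> \<subseteq> segs Lam \<beta> \<omega>"
  shows "hlen \<beta> \<omega>' h (retime \<psi> ` \<gamma>) =
    (\<Sum>p\<in>\<gamma>. h (fst p) * (\<psi> (nxt \<beta> \<omega> (fst p) (snd p)) - \<psi> (snd p)))"
proof -
  have "hlen \<beta> \<omega>' h (retime \<psi> ` \<gamma>) = (\<Sum>p\<in>\<gamma>. h (fst (retime \<psi> p)) * seglen \<beta> \<omega>' (retime \<psi> p))"
    unfolding hlen_def using inj_on_subset[OF inj_on_retime[OF tc] assms] by (simp add:
        sum.reindex del: fst_map_prod)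
  also have "\<dots> = (\<Sum>p\<in>\<gamma>. h (fst p) * (\<psi> (nxt \<beta> \<omega> (fst p) (snd p)) - \<psi> (snd p)))"
  proof (rule sum.cong[OF refl])
    fix p assume "p \<in> \<gamma>"
    then have "snd p \<in> cut_times \<omega> (fst p)" using assms by (auto simp: segs_def)
    then show "h (fst (retime \<psi> p)) * seglen \<beta> \<omega>' (retime \<psi> p) = h (fst p) *
        (\<psi> (nxt \<beta> \<omega> (fst p) (snd p)) - \<psi> (snd p))"
      by (simp add: seglen_def nxt_time_change[OF tc])
  qed
  finally show ?thesis .
qed

lemma inj_on_image_retime: "\<Gamma> \<subseteq> Pow (segs Lam \<beta> \<omega>) \<Longrightarrow> inj_on ((`) (retime \<psi>)) \<Gamma>"
  using inj_on_image_Pow[OF inj_on_retime[OF tc]] by (rule inj_on_subset)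

lemma prod_zact_time_change:
  assumes "\<Gamma> \<subseteq> Pow (segs Lam \<beta> \<omega>)"
  shows "(\<Prod>\<gamma>\<in>(`) (retime \<psi>) ` \<Gamma>. zact twoS \<beta> \<omega>' h \<gamma>) =
    (\<Prod>\<gamma>\<in>\<Gamma>. \<Sum>k\<le>twoS. exp (spinval twoS k *
      (\<Sum>p\<in>\<gamma>. h (fst p) * (\<psi> (nxt \<beta> \<omega> (fst p) (snd p)) - \<psi> (snd p)))))"
  unfolding prod.reindex[OF inj_on_image_retime[OF assms]] zact_def comp_def
  using assms by (intro prod.cong refl) (auto simp: hlen_time_change)

end

section \<open>Order patterns of bridge times\<close>

definition bridge_list :: "(nat \<Rightarrow> site \<times> site) \<Rightarrow> (nat \<Rightarrow> bool) \<Rightarrow> nat \<Rightarrow> (nat \<Rightarrow> real) \<Rightarrow> bridges" where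
  "bridge_list es cs n ts = map (\<lambda>i. (fst (es i), snd (es i), ts i, cs i)) [0..<n]"

text \<open>The second component records which bridges lie above the permanent cut at time 0. Times
  with equal pattern are related by a time change.\<close>

definition order_pattern :: "nat \<Rightarrow> (nat \<Rightarrow> real) \<Rightarrow> (nat \<times> nat) set \<times> nat set" where
  "order_pattern n ts = ({(i, j). i < n \<and> j < n \<and> ts i < ts j}, {i. i < n \<and> 0 < ts i})"

text \<open>The time change from \<open>ts0\<close> to \<open>ts\<close>, of interest only at 0,
  \<open>\<beta>\<close> and the times \<open>ts0\<close>. The choice of the index is harmless since
  equal times stay equal within a pattern; 0 is kept fixed explicitly.\<close>

definition interpolate :: "nat \<Rightarrow> (nat \<Rightarrow> real) \<Rightarrow> (nat \<Rightarrow> real) \<Rightarrow> real \<Rightarrow> real" where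
  "interpolate n ts0 ts r = (if r \<noteq> 0 \<and> (\<exists>i<n. ts0 i = r) then ts (SOME i. i < n \<and> ts0 i =
      r) else r)"

lemma order_pattern_eq_iff:
  "order_pattern n ts = order_pattern n ts0 \<longleftrightarrow>
    (\<forall>i\<in>{..<n}. \<forall>j\<in>{..<n}. ts i < ts j \<longleftrightarrow> ts0 i < ts0 j) \<and> (\<forall>i\<in>{..<n}. 0 < ts i \<longleftrightarrow> 0 < ts0 i)"
  unfolding order_pattern_def by (auto simp: set_eq_iff)

lemma time_change_interpolate:
  assumes "0 < \<beta>" "ts0 \<in> {..<n} \<rightarrow>\<^sub>E {0..<\<beta>}" "ts \<in> {..<n} \<rightarrow>\<^sub>E {0..<\<beta>}"
    and pat: "order_pattern n ts = order_pattern n ts0"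
  shows "time_change \<beta> (interpolate n ts0 ts) (bridge_list es cs n ts0) (bridge_list es cs n ts)"
proof -
  let ?\<psi> = "interpolate n ts0 ts"
  have less: "ts i < ts j \<longleftrightarrow> ts0 i < ts0 j" if "i < n" "j < n" for i j
    using pat that unfolding order_pattern_eq_iff by blast
  have pos: "0 < ts i \<longleftrightarrow> 0 < ts0 i" if "i < n" for i
    using pat that unfolding order_pattern_eq_iff by blast
  have rng: "0 \<le> ts0 i" "ts0 i < \<beta>" "0 \<le> ts i" "ts i < \<beta>" if "i < n" for i
    using PiE_mem[OF assms(2), of i] PiE_mem[OF assms(3), of i] that by auto
  have \<psi>: "?\<psi> (ts0 i) = ts i" if i: "i < n" for i
  proof (cases "ts0 i = 0")
    case True
    then show ?thesis using pos[OF i] rng[OF i] by (simp add: interpolate_def)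
  next
    case False
    let ?j = "SOME j. j < n \<and> ts0 j = ts0 i"
    have j: "?j < n \<and> ts0 ?j = ts0 i" by (rule someI[of _ i]) (simp add: i)
    \<comment> \<open>A tie in \<open>ts0\<close> is the failure of both strict comparisons, hence
      also a tie in \<open>ts\<close>.\<close>
    have "ts ?j = ts i" using less[of ?j i] less[of i ?j] j i by auto
    then show ?thesis using False i by (auto simp: interpolate_def)
  qed
  have \<psi>0: "?\<psi> 0 = 0" by (simp add: interpolate_def)
  have \<psi>\<beta>: "?\<psi> \<beta> = \<beta>" using rng(2) by (force simp: interpolate_def)
  have bt: "bridge_times (bridge_list es cs n ts0) = ts0 ` {..<n}"
    unfolding bridge_times_def bridge_list_def by (force simp: image_image)
  show ?thesis
    unfolding time_change_def bt
  proof (intro conjI)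
    have "set (bridge_list es cs n ts) = (\<lambda>i. (fst (es i), snd (es i), ts i, cs i)) ` {..<n}"
      by (simp add: bridge_list_def lessThan_atLeast0)
    also have "\<dots> = (\<lambda>i. (fst (es i), snd (es i), ?\<psi> (ts0 i), cs i)) ` {..<n}"
      using \<psi> by (intro image_cong) auto
    also have "\<dots> = (\<lambda>(x, y, s, c). (x, y, ?\<psi> s, c)) ` set (bridge_list es cs n ts0)"
      by (simp add: bridge_list_def lessThan_atLeast0 image_image)
    finally show "set (bridge_list es cs n ts) = (\<lambda>(x, y, s, c). (x, y, ?\<psi> s,
        c)) ` set (bridge_list es cs n ts0)" .
    show "ts0 ` {..<n} \<subseteq> {0..<\<beta>}" using rng by auto
    show "strict_mono_on (insert 0 (insert \<beta> (ts0 ` {..<n}))) ?\<psi>"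
    proof (rule strict_mono_onI)
      fix a b assume a: "a \<in> insert 0 (insert \<beta> (ts0 ` {..<n}))"
          and b: "b \<in> insert 0 (insert \<beta> (ts0 ` {..<n}))" and ab: "a < b"
      from a consider "a = 0" | "a = \<beta>" | i where "i < n" "a = ts0 i" by blast
      then show "?\<psi> a < ?\<psi> b"
      proof cases
        case 1
        from b 1 ab consider "b = \<beta>" | j where "j < n" "b = ts0 j" by blast
        then show ?thesis using 1 ab \<psi>0 \<psi>\<beta> \<psi> pos by cases auto
      next
        case 2
        then show ?thesis using b ab assms(1) rng(2) by force
      next
        case 3
        from b ab rng(1)[OF 3(1)] 3 consider "b = \<beta>" | j where "j < n" "b = ts0 j" by force
        then show ?thesis using 3 ab \<psi>\<beta> \<psi> less rng by cases auto
      qed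
    qed
  qed (use assms(1) \<psi>0 \<psi>\<beta> in auto)
qed

lemma interpolate_measurable [measurable]:
  "(\<lambda>ts. interpolate n ts0 ts r) \<in> borel_measurable (PiM {..<n} (\<lambda>_. lborel))"
proof (cases "r \<noteq> 0 \<and> (\<exists>i<n. ts0 i = r)")
  case True
  let ?i = "SOME i. i < n \<and> ts0 i = r"
  have "?i < n \<and> ts0 ?i = r" by (rule someI_ex) (use True in blast)
  then have "(\<lambda>ts. ts ?i) \<in> borel_measurable (PiM {..<n} (\<lambda>_. lborel :: real measure))"
    using measurable_component_singleton[of ?i "{..<n}" "\<lambda>_. lborel :: real measure"] by simp
  then show ?thesis unfolding interpolate_def using True by simp
next
  case False
  then have "(\<lambda>ts. interpolate n ts0 ts r) = (\<lambda>_. r)"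
      unfolding interpolate_def by (simp only: if_False)
  then show ?thesis by simp
qed

text \<open>There are finitely many patterns, each a measurable event cut out by comparing
  coordinates. Picking one representative per pattern writes the integrand as a finite sum of
  indicators times measurable functions.\<close>

lemma measurable_by_order_pattern:
  fixes F :: "(nat \<Rightarrow> real) \<Rightarrow> real" and n :: nat and \<beta> :: real
  defines "\<Omega> \<equiv> {..<n} \<rightarrow>\<^sub>E {0..<\<beta>}"
  assumes G: "\<And>ts0. ts0 \<in> \<Omega> \<Longrightarrow> G ts0 \<in> borel_measurable (PiM {..<n} (\<lambda>_. lborel))"
    and FG: "\<And>ts0 ts. ts0 \<in> \<Omega> \<Longrightarrow> ts \<in> \<Omega> \<Longrightarrow> order_pattern n ts = order_pattern n ts0 \<Longrightarrow> F ts = G ts0 ts"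
  shows "(\<lambda>ts. indicator \<Omega> ts *\<^sub>R F ts) \<in> borel_measurable (PiM {..<n} (\<lambda>_. lborel))"
proof -
  let ?M = "PiM {..<n} (\<lambda>_. lborel :: real measure)"
  have comp: "(\<lambda>ts. ts i) \<in> borel_measurable ?M" if "i \<in> {..<n}" for i
    using measurable_component_singleton[of i "{..<n}" "\<lambda>_. lborel :: real measure"] that by simp
  define Pt where "Pt = order_pattern n ` \<Omega>"
  have "Pt \<subseteq> Pow ({..<n} \<times> {..<n}) \<times> Pow {..<n}"
    unfolding Pt_def order_pattern_def by auto
  then have finPt: "finite Pt" by (rule finite_subset) simp
  define rep where "rep \<pi> = (SOME ts. ts \<in> \<Omega> \<and> order_pattern n ts = \<pi>)" for \<pi>
  have rep: "rep \<pi> \<in> \<Omega>" "order_pattern n (rep \<pi>) = \<pi>" if "\<pi> \<in> Pt" for \<pi>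
  proof -
    have "\<exists>ts. ts \<in> \<Omega> \<and> order_pattern n ts = \<pi>" using that unfolding Pt_def by auto
    from someI_ex[OF this] show "rep \<pi> \<in> \<Omega>" "order_pattern n (rep \<pi>) = \<pi>" unfolding rep_def by auto
  qed
  have \<Omega>m: "\<Omega> \<in> sets ?M" unfolding \<Omega>_def by (intro sets_PiM_I_finite) auto
  have pm: "{ts \<in> space ?M. order_pattern n ts = order_pattern n ts0} \<in> sets ?M" for ts0
    unfolding order_pattern_eq_iff
  proof (rule predE, intro pred_intros_logic pred_intros_finite finite_lessThan)
    fix i j assume "i \<in> {..<n}" "j \<in> {..<n}"
    note [measurable] = comp[OF this(1)] comp[OF this(2)]
    show "Measurable.pred ?M (\<lambda>ts. ts i < ts j)" by measurable
  next
    fix i assume "i \<in> {..<n}"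
    note [measurable] = comp[OF this]
    show "Measurable.pred ?M (\<lambda>ts. 0 < ts i)" by measurable
  qed auto
  let ?A = "\<lambda>\<pi>. \<Omega> \<inter> {ts \<in> space ?M. order_pattern n ts = order_pattern n (rep \<pi>)}"
  have "(\<lambda>ts. \<Sum>\<pi>\<in>Pt. indicator (?A \<pi>) ts * G (rep \<pi>) ts) \<in> borel_measurable ?M"
    by (intro borel_measurable_sum borel_measurable_times borel_measurable_indicator sets.Int \<Omega>m
        pm G rep(1))
  also have "(\<lambda>ts. \<Sum>\<pi>\<in>Pt. indicator (?A \<pi>) ts * G (rep \<pi>) ts) = (\<lambda>ts. indicator \<Omega> ts *\<^sub>R F ts)"
  proof (rule ext)
    fix ts
    show "(\<Sum>\<pi>\<in>Pt. indicator (?A \<pi>) ts * G (rep \<pi>) ts) = indicator \<Omega> ts *\<^sub>R F ts"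
    proof (cases "ts \<in> \<Omega>")
      case True
      let ?\<pi> = "order_pattern n ts"
      have \<pi>: "?\<pi> \<in> Pt" using True unfolding Pt_def by auto
      have sp: "ts \<in> space ?M" using True \<Omega>m sets.sets_into_space by blast
      have "(\<Sum>\<pi>\<in>Pt. indicator (?A \<pi>) ts * G (rep \<pi>) ts) = (\<Sum>\<pi>\<in>Pt. if \<pi> =
          ?\<pi> then G (rep \<pi>) ts else 0)"
        using rep(2) True sp by (intro sum.cong refl) (auto simp: indicator_def)
      also have "\<dots> = G (rep ?\<pi>) ts" using \<pi> finPt by simp
      also have "\<dots> = F ts" using FG[OF rep(1)[OF \<pi>] True] rep(2)[OF \<pi>] by simp
      finally show ?thesis using True by simp
    qed (auto simp: indicator_def intro!: sum.neutral)
  qed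
  finally show ?thesis .
qed

lemma loops_integrand_measurable:
  assumes "0 < \<beta>"
  shows "(\<lambda>ts. indicator ({..<n} \<rightarrow>\<^sub>E {0..<\<beta>}) ts *\<^sub>R
      (\<Prod>\<gamma>\<in>loops Lam \<beta> (bridge_list es cs n ts). zact twoS \<beta> (bridge_list es cs n ts) h \<gamma>))
    \<in> borel_measurable (PiM {..<n} (\<lambda>_. lborel))"
proof (rule measurable_by_order_pattern)
  fix ts0 :: "nat \<Rightarrow> real"
  let ?\<omega> = "bridge_list es cs n ts0"
  \<comment> \<open>The loops and their segments are those of the reference times
    \<open>ts0\<close>, so the index sets are fixed and \<open>ts\<close> enters only through
    \<open>interpolate\<close>.\<close>
  let ?G = "\<lambda>ts0 ts. \<Prod>\<gamma>\<in>loops Lam \<beta> (bridge_list es cs n ts0). \<Sum>k\<le>twoS. exp (spinval twoS k *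
      (\<Sum>p\<in>\<gamma>. h (fst p) * (interpolate n ts0 ts (nxt \<beta> (bridge_list es cs n ts0) (fst p) (snd p)) -
          interpolate n ts0 ts (snd p))))"
  show "?G ts0 \<in> borel_measurable (PiM {..<n} (\<lambda>_. lborel))" by measurable
  fix ts assume "ts0 \<in> {..<n} \<rightarrow>\<^sub>E {0..<\<beta>}" "ts \<in> {..<n} \<rightarrow>\<^sub>E {0..<\<beta>}" "order_pattern n ts =
      order_pattern n ts0"
  note tc = time_change_interpolate[OF assms this, of es cs]
  show "(\<Prod>\<gamma>\<in>loops Lam \<beta> (bridge_list es cs n ts). zact twoS \<beta> (bridge_list es cs n ts) h \<gamma>) =
      ?G ts0 ts"
    unfolding loops_time_change[OF tc] by (rule prod_zact_time_change[OF tc loops_subset])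
qed

lemma two_point_integrand_measurable:
  assumes "0 < \<beta>" "origin \<in> Lam" "x \<in> Lam"
  shows "(\<lambda>ts. indicator ({..<n} \<rightarrow>\<^sub>E {0..<\<beta>}) ts *\<^sub>R
      ((if connected0 Lam \<beta> (bridge_list es cs n ts) x then 1 else 0) *
        ztilde twoS Lam \<beta> (bridge_list es cs n ts) h x *
        (\<Prod>\<gamma>\<in>loops Lam \<beta> (bridge_list es cs n ts) - {loop0x Lam \<beta> (bridge_list es cs n ts)}.
          zact twoS \<beta> (bridge_list es cs n ts) h \<gamma>)))
    \<in> borel_measurable (PiM {..<n} (\<lambda>_. lborel))"
proof (rule measurable_by_order_pattern)
  fix ts0 :: "nat \<Rightarrow> real"
  let ?\<omega> = "bridge_list es cs n"
  let ?H = "\<lambda>ts0 ts \<gamma>. \<Sum>p\<in>\<gamma>. h (fst p) * (interpolate n ts0 ts (nxt \<beta> (?\<omega> ts0) (fst p) (snd p)) -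
      interpolate n ts0 ts (snd p))"
  let ?Z = "\<lambda>Wp Wm. (1 / 4) * (\<Sum>k<twoS. (real twoS / 2 * (real twoS / 2 + 1) - spinval twoS k *
      (spinval twoS k + 1)) *
            (exp ((spinval twoS k + 1) * Wp + spinval twoS k * Wm)
             + exp (spinval twoS k * Wp + (spinval twoS k + 1) * Wm)))"
  let ?G = "\<lambda>ts0 ts. (if connected0 Lam \<beta> (?\<omega> ts0) x then 1 else 0) *
      ?Z (?H ts0 ts (arc_plus Lam \<beta> (?\<omega> ts0) x)) (?H ts0 ts (loop0x Lam \<beta> (?\<omega> ts0)) -
          ?H ts0 ts (arc_plus Lam \<beta> (?\<omega> ts0) x)) *
      (\<Prod>\<gamma>\<in>loops Lam \<beta> (?\<omega> ts0) - {loop0x Lam \<beta> (?\<omega> ts0)}. \<Sum>k\<le>twoS. exp (spinval twoS k *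
          ?H ts0 ts \<gamma>))"
  show "?G ts0 \<in> borel_measurable (PiM {..<n} (\<lambda>_. lborel))" by measurable
  fix ts assume "ts0 \<in> {..<n} \<rightarrow>\<^sub>E {0..<\<beta>}" "ts \<in> {..<n} \<rightarrow>\<^sub>E {0..<\<beta>}" "order_pattern n ts =
      order_pattern n ts0"
  note tc = time_change_interpolate[OF assms(1) this, of es cs]
  have sub: "loop0x Lam \<beta> (?\<omega> ts0) \<subseteq> segs Lam \<beta> (?\<omega> ts0)"
      "arc_plus Lam \<beta> (?\<omega> ts0) x \<subseteq> segs Lam \<beta> (?\<omega> ts0)"
    unfolding loop0x_def arc_plus_def seg_conn_def by auto
  \<comment> \<open>Removing the distinguished loop commutes with retiming because retiming is
    injective on sets of segments.\<close>
  have diff: "loops Lam \<beta> (?\<omega> ts) - {loop0x Lam \<beta> (?\<omega> ts)} =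
      (`) (retime (interpolate n ts0 ts)) ` (loops Lam \<beta> (?\<omega> ts0) - {loop0x Lam \<beta> (?\<omega> ts0)})"
  proof -
    have inj: "inj_on ((`) (retime (interpolate n ts0 ts))) (insert (loop0x Lam \<beta> (?\<omega> ts0)) (loops
        Lam \<beta> (?\<omega> ts0)))"
      by (rule inj_on_image_retime[OF tc, where Lam = Lam]) (use loops_subset sub(1) in blast)
    have "(`) (retime (interpolate n ts0 ts)) ` (loops Lam \<beta> (?\<omega> ts0) - {loop0x Lam \<beta> (?\<omega> ts0)}) =
       (`) (retime (interpolate n ts0 ts)) ` loops Lam \<beta> (?\<omega> ts0) -
           (`) (retime (interpolate n ts0 ts)) ` {loop0x Lam \<beta> (?\<omega> ts0)}"
      by (rule inj_on_image_set_diff[OF inj]) blast+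
    then show ?thesis
      unfolding loops_time_change[OF tc] loop0x_time_change[OF tc assms(2)] by (simp only:
          image_insert image_empty)
  qed
  have prod: "(\<Prod>\<gamma>\<in>loops Lam \<beta> (?\<omega> ts) - {loop0x Lam \<beta> (?\<omega> ts)}. zact twoS \<beta> (?\<omega> ts) h \<gamma>) =
      (\<Prod>\<gamma>\<in>loops Lam \<beta> (?\<omega> ts0) - {loop0x Lam \<beta> (?\<omega> ts0)}. \<Sum>k\<le>twoS. exp (spinval twoS k *
          ?H ts0 ts \<gamma>))"
    unfolding diff using loops_subset by (intro prod_zact_time_change[OF tc]) blast
  have zt: "ztilde twoS Lam \<beta> (?\<omega> ts) h x =
      ?Z (?H ts0 ts (arc_plus Lam \<beta> (?\<omega> ts0) x)) (?H ts0 ts (loop0x Lam \<beta> (?\<omega> ts0)) -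
          ?H ts0 ts (arc_plus Lam \<beta> (?\<omega> ts0) x))"
    unfolding ztilde_def Let_def arc_plus_time_change[OF tc assms(2)] loop0x_time_change[OF tc
        assms(2)]
      hlen_time_change[OF tc sub(1)] hlen_time_change[OF tc sub(2)] by (rule refl)
  show "(if connected0 Lam \<beta> (?\<omega> ts) x then 1 else 0) * ztilde twoS Lam \<beta> (?\<omega> ts) h x *
        (\<Prod>\<gamma>\<in>loops Lam \<beta> (?\<omega> ts) - {loop0x Lam \<beta> (?\<omega> ts)}. zact twoS \<beta> (?\<omega> ts) h \<gamma>) = ?G ts0 ts"
    unfolding prod zt connected0_time_change[OF tc assms(2,3)] by (rule refl)
qed

section \<open>The expansion of the Gibbs operator\<close>

lemma finite_lattice: "finite (lattice d L)"
proof -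
  have "lattice d L \<subseteq> {f. \<forall>i. (i \<in> {..<d} \<longrightarrow> f i \<in> {- (int L div 2)..int L div 2}) \<and> (i \<notin> {..<d} \<longrightarrow>
      f i = 0)}"
    unfolding lattice_def by (auto simp: abs_le_iff)
  then show ?thesis by (rule finite_subset) (intro finite_set_of_finite_funs; simp)
qed

lemma nn_edges_in_lattice:
  assumes "e \<in> nn_edges d L"
  shows "fst e \<in> lattice d L \<and> snd e \<in> lattice d L \<and> fst e \<noteq> snd e"
proof -
  obtain x y i where e: "e = (x, y)" "x \<in> lattice d L" "y \<in> lattice d L" "y = x(i := x i + 1)"
    using assms unfolding nn_edges_def by blast
  then have "x i \<noteq> y i" by simp
  then show ?thesis using e(1-3) by auto
qed

lemma finite_nn_edges: "finite (nn_edges d L)"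
proof (rule finite_subset)
  show "nn_edges d L \<subseteq> lattice d L \<times> lattice d L" unfolding nn_edges_def by blast
qed (simp add: finite_lattice)

text \<open>Fubini in the coordinate \<open>i\<close>: the value to be avoided does not depend on
  it, so the exceptional set meets each line in at most one point.\<close>

lemma AE_PiM_lborel_coordinate_neq:
  fixes f :: "('i \<Rightarrow> real) \<Rightarrow> real"
  assumes I: "finite I" "i \<in> I" and f: "f \<in> borel_measurable (PiM I (\<lambda>_. lborel))"
    and indep: "\<And>ts y. f (ts(i := y)) = f ts"
  shows "AE ts in PiM I (\<lambda>_. lborel). ts i \<noteq> f ts"
proof -
  let ?M = "PiM I (\<lambda>_. lborel :: real measure)"
  have ts_i: "(\<lambda>ts. ts i) \<in> borel_measurable ?M"
    using I measurable_component_singleton[of i I "\<lambda>_. lborel :: real measure"] by simp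
  let ?N = "{ts \<in> space ?M. \<not> ts i \<noteq> f ts}"
  have N': "?N \<in> sets ?M" using borel_measurable_eq[OF ts_i f] by simp
  have ins: "insert i (I - {i}) = I" using I by auto
  have "(\<integral>\<^sup>+ ts. indicator ?N ts \<partial>?M) =
      (\<integral>\<^sup>+ ts. (\<integral>\<^sup>+ y. indicator ?N (ts(i := y)) \<partial>lborel) \<partial>PiM (I - {i}) (\<lambda>_. lborel))"
    using lborel_prod.product_nn_integral_insert[of "I - {i}"
        i "indicator ?N"] I N' unfolding ins by simp
  also have "\<dots> \<le> (\<integral>\<^sup>+ ts. (\<integral>\<^sup>+ y. indicator {f ts} y \<partial>lborel) \<partial>PiM (I - {i}) (\<lambda>_. lborel))"
    by (intro nn_integral_mono) (auto simp: indicator_def indep)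
  also have "\<dots> = 0" by simp
  finally have "emeasure ?M ?N = 0" using N' by simp
  then show ?thesis by (intro AE_I[OF _ _ N']) auto
qed

text \<open>Taking another coordinate or the constant 0 as the value to be avoided excludes ties and
  bridges at time 0, the obstructions to \<open>good_bridges\<close>.\<close>

lemma AE_PiM_lborel_distinct:
  assumes "finite I"
  shows "AE ts in PiM I (\<lambda>_. lborel :: real measure). inj_on ts I \<and> (\<forall>i\<in>I. ts i \<noteq> 0)"
proof -
  let ?M = "PiM I (\<lambda>_. lborel :: real measure)"
  have "AE ts in ?M. \<forall>i\<in>I. \<forall>j\<in>I - {i}. ts i \<noteq> ts j"
  proof (intro AE_finite_allI assms finite_Diff)
    fix i j assume ij: "i \<in> I" "j \<in> I - {i}"
    show "AE ts in ?M. ts i \<noteq> ts j"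
      using ij assms measurable_component_singleton[of j I "\<lambda>_. lborel :: real measure"]
      by (intro AE_PiM_lborel_coordinate_neq) auto
  qed
  moreover have "AE ts in ?M. \<forall>i\<in>I. ts i \<noteq> 0"
    by (intro AE_finite_allI assms AE_PiM_lborel_coordinate_neq) auto
  ultimately show ?thesis
  proof eventually_elim
    case (elim ts)
    then show ?case by (auto simp: inj_on_def)
  qed
qed

context dyson
begin

text \<open>The weights are replaced by 1: with \<open>u\<close> equal to 0 or 1 some of them
  vanish, and a single integral could then not be bounded by the weighted sum over all
  marks.\<close>

lemma weight_integral_finite:
  assumes "finite I" "m \<in> I \<rightarrow>\<^sub>E X" "0 \<le> t"
  shows "weight_integral m I t \<sigma> \<tau> < \<infinity>"
proof -
  interpret one: dyson C b A X "\<lambda>_. 1"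
    by standard (use finite_C finite_X A_nonneg in auto)
  have fin: "finite (I \<rightarrow>\<^sub>E X)" using assms(1) finite_X by (rule finite_PiE)
  have "weight_integral m I t \<sigma> \<tau> \<le> (\<Sum>m\<in>I \<rightarrow>\<^sub>E X. weight_integral m I t \<sigma> \<tau>)"
    using assms(2) fin by (intro member_le_sum) auto
  also have "\<dots> < \<infinity>"
    using one.sum_weight_integral[OF assms(1) refl assms(3), of \<sigma> \<tau>] by simp
  finally show ?thesis .
qed

text \<open>Every index has to be removed, each below the current end time, and end times only
  decrease. An index outside the interval can never be removed. This discards both times outside the
  cube and removals that do not start with the latest bridge.\<close>

lemma ordered_weight_eq_0:
  assumes "finite I" "card I = n" "j \<in> I" "ts j \<notin> {0..<t}"
  shows "ordered_weight m n I t ts \<sigma> \<tau> = 0"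
  using assms
proof (induction n arbitrary: I t \<sigma>)
  case (Suc n)
  have "indicator {0..<t} (ts i) * (exp ((t - ts i) * b \<sigma>) *
        (\<Sum>\<rho>\<in>C. A (m i) \<sigma> \<rho> * ordered_weight m n (I - {i}) (ts i) ts \<rho> \<tau>)) = 0" if i: "i \<in> I" for i
  proof (cases "ts i \<in> {0..<t}")
    case True
    then have "i \<noteq> j" using Suc.prems by auto
    then have "ordered_weight m n (I - {i}) (ts i) ts \<rho> \<tau> = 0" for \<rho>
      using Suc.prems True i by (intro Suc.IH) auto
    then show ?thesis by simp
  qed simp
  then show ?case unfolding ordered_weight.simps by (intro sum.neutral ballI)
qed simp

lemma ordered_weight_integral:
  assumes "finite I" "m \<in> I \<rightarrow>\<^sub>E X" "0 \<le> t"
  shows "integrable (PiM I (\<lambda>_. lborel)) (\<lambda>ts. ordered_weight m (card I) I t ts \<sigma> \<tau>)"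
    and "ennreal (\<integral>ts. ordered_weight m (card I) I t ts \<sigma> \<tau> \<partial>PiM I (\<lambda>_. lborel)) =
        weight_integral m I t \<sigma> \<tau>"
proof -
  show int: "integrable (PiM I (\<lambda>_. lborel)) (\<lambda>ts. ordered_weight m (card I) I t ts \<sigma> \<tau>)"
    using weight_integral_finite[OF assms]
    by (intro integrableI_nonneg ordered_weight_measurable_PiM) (auto simp: ordered_weight_nonneg
        weight_integral_def)
  show "ennreal (\<integral>ts. ordered_weight m (card I) I t ts \<sigma> \<tau> \<partial>PiM I (\<lambda>_. lborel)) =
      weight_integral m I t \<sigma> \<tau>"
    unfolding weight_integral_def using int
    by (intro nn_integral_eq_integral[symmetric]) (auto simp: ordered_weight_nonneg)
qed

lemma sum_ordered_weight_integral:
  assumes "finite I" "0 \<le> t"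
  shows "(\<Sum>m\<in>I \<rightarrow>\<^sub>E X. (\<Prod>i\<in>I. w (m i)) *
      (\<integral>ts. ordered_weight m (card I) I t ts \<sigma> \<tau> \<partial>PiM I (\<lambda>_. lborel))) =
    fact (card I) * dyson_term (card I) t \<sigma> \<tau>"
proof -
  let ?J = "\<lambda>m. \<integral>ts. ordered_weight m (card I) I t ts \<sigma> \<tau> \<partial>PiM I (\<lambda>_. lborel)"
  have J: "0 \<le> ?J m" for m by (intro integral_nonneg_AE) (simp add: ordered_weight_nonneg)
  have P: "0 \<le> (\<Prod>i\<in>I. w (m i))" if "m \<in> I \<rightarrow>\<^sub>E X" for m
    using that by (intro prod_nonneg ballI w_nonneg) (auto simp: PiE_mem)
  have "ennreal (\<Sum>m\<in>I \<rightarrow>\<^sub>E X. (\<Prod>i\<in>I. w (m i)) * ?J m) = (\<Sum>m\<in>I \<rightarrow>\<^sub>E X. ennreal (\<Prod>i\<in>I. w (m i)) *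
      ennreal (?J m))"
    using J P by (subst sum_ennreal[symmetric]) (auto simp: ennreal_mult intro!: sum.cong)
  also have "\<dots> = (\<Sum>m\<in>I \<rightarrow>\<^sub>E X. ennreal (\<Prod>i\<in>I. w (m i)) * weight_integral m I t \<sigma> \<tau>)"
    using assms by (intro sum.cong refl) (simp add: ordered_weight_integral)
  also have "\<dots> = ennreal (fact (card I) * dyson_term (card I) t \<sigma> \<tau>)"
    by (rule sum_weight_integral[OF assms(1) refl assms(2)])
  finally show ?thesis
    using J P dyson_term_nonneg by (subst (asm) ennreal_inj) (auto intro!: sum_nonneg
        mult_nonneg_nonneg)
qed

end

section \<open>From the Dyson series to the Poisson integral\<close>

context
  fixes Lam :: "site set" and E :: "(site \<times> site) set" and twoS :: nat and h :: "site \<Rightarrow> real"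
      and u :: real
  assumes finL: "finite Lam" and finE: "finite E"
    and edges: "\<And>e. e \<in> E \<Longrightarrow> fst e \<in> Lam \<and> snd e \<in> Lam \<and> fst e \<noteq> snd e"
    and u: "0 \<le> u" "u \<le> 1"
begin

interpretation D: dyson "configs Lam twoS" "field_energy Lam twoS h"
    bridge_op "E \<times> (UNIV :: bool set)"
  "\<lambda>m. if snd m then u else 1 - u"
  by standard (use finE u in \<open>auto simp: finite_configs[OF finL] bridge_op_def split: prod.split\<close>)

lemma good_bridges_image:
  assumes "set \<omega> = (\<lambda>i. (fst (fst (m i)), snd (fst (m i)), ts i, snd (m i))) ` I"
    and "inj_on ts I" "0 < t" "\<And>i. i \<in> I \<Longrightarrow> 0 < ts i \<and> ts i < t" "\<And>i. i \<in> I \<Longrightarrow> fst (m i) \<in> E"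
  shows "good_bridges Lam t \<omega>"
  unfolding good_bridges_def
proof (intro conjI allI impI)
  fix x y s c assume "(x, y, s, c) \<in> set \<omega>"
  then obtain i where i: "i \<in> I" "x = fst (fst (m i))" "y = snd (fst (m i))" "s = ts i" "c =
      snd (m i)"
    unfolding assms(1) by blast
  show "x \<in> Lam" "y \<in> Lam" "x \<noteq> y" "0 < s" "s < t"
    using edges[OF assms(5)[OF i(1)]] assms(4)[OF i(1)] i by auto
  fix x' y' c' assume "(x', y', s, c') \<in> set \<omega>"
  then obtain j where j: "j \<in> I" "x' = fst (fst (m j))" "y' = snd (fst (m j))" "s = ts j" "c' =
      snd (m j)"
    unfolding assms(1) by blast
  have "i = j" using inj_onD[OF assms(2), of i j] i j by simp
  then show "x = x'" "y = y'" "c = c'" using i j by auto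
qed (rule assms(3))

text \<open>With distinct times only the removal of the latest bridge contributes, and then both
  sides satisfy the same recursion.\<close>

lemma ordered_weight_eq_path_weight:
  assumes "finite I" "card I = n" "\<sigma> \<in> configs Lam twoS" "inj_on ts I" "0 < t"
    and "\<And>i. i \<in> I \<Longrightarrow> 0 < ts i \<and> ts i < t" "\<And>i. i \<in> I \<Longrightarrow> fst (m i) \<in> E"
    and "set \<omega> = (\<lambda>i. (fst (fst (m i)), snd (fst (m i)), ts i, snd (m i))) ` I"
  shows "D.ordered_weight m n I t ts \<sigma> \<tau> = path_weight Lam twoS h t \<omega> \<sigma> \<tau>"
  using assms
proof (induction n arbitrary: I t \<sigma> \<omega>)
  case 0
  then have "\<omega> = []" by simp
  then show ?case using path_weight_Nil[OF 0(5) finL 0(3)] by simp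
next
  case (Suc n)
  let ?br = "\<lambda>i. (fst (fst (m i)), snd (fst (m i)), ts i, snd (m i))"
  have "I \<noteq> {}" using Suc.prems by auto
  then have "Max (ts ` I) \<in> ts ` I" using Suc.prems(1) by (intro Max_in) auto
  then obtain k where "Max (ts ` I) = ts k" and k1: "k \<in> I" by (rule imageE)
  then have "ts i \<le> ts k" if "i \<in> I" for i
    using Max_ge[of "ts ` I" "ts i"] Suc.prems(1) that by simp
  with k1 have k: "k \<in> I" "\<And>i. i \<in> I \<Longrightarrow> ts i \<le> ts k" by auto
  have later: "ts i < ts k" if "i \<in> I - {k}" for i
    using k(2)[of i] inj_onD[OF Suc.prems(4), of i k] that k(1) by force
  \<comment> \<open>Any listing of the remaining bridges will do; the list order carries no
    information, as the times order the bridges.\<close>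
  obtain \<omega>' where \<omega>': "set \<omega>' = ?br ` (I - {k})"
    using finite_list[of "?br ` (I - {k})"] Suc.prems(1) by auto
  have good: "good_bridges Lam t \<omega>"
    by (rule good_bridges_image[OF Suc.prems(8,4-7)])
  have set_\<omega>: "set \<omega> = insert (?br k) (set \<omega>')" unfolding Suc.prems(8) \<omega>' using k(1) by blast
  have latest: "s' < ts k" if b: "(x', y', s', c') \<in> set \<omega>'" for x' y' s' c'
  proof -
    obtain i where "i \<in> I - {k}" "s' = ts i" using b unfolding \<omega>' by blast
    then show ?thesis using later by simp
  qed
  have IH: "D.ordered_weight m n (I - {k}) (ts k) ts \<rho> \<tau> = path_weight Lam twoS h (ts k) \<omega>' \<rho> \<tau>"
    if "\<rho> \<in> configs Lam twoS" for \<rho>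
  proof (rule Suc.IH)
    show "inj_on ts (I - {k})" using Suc.prems(4) by (rule inj_on_subset) blast
    show "0 < ts i \<and> ts i < ts k" if "i \<in> I - {k}"
        for i using later[OF that] Suc.prems(6)[of i] that by simp
  qed (use Suc.prems k that \<omega>' in auto)
  let ?g = "\<lambda>i. indicator {0..<t} (ts i) * (exp ((t - ts i) * field_energy Lam twoS h \<sigma>) *
        (\<Sum>\<rho>\<in>configs Lam twoS. bridge_op (m i) \<sigma> \<rho> * D.ordered_weight m n (I - {i}) (ts i) ts \<rho> \<tau>))"
  \<comment> \<open>If another index goes first, the later bridge \<open>k\<close> is left above the
    remaining interval.\<close>
  have zero: "?g i = 0" if i: "i \<in> I - {k}" for i
  proof -
    have "D.ordered_weight m n (I - {i}) (ts i) ts \<rho> \<tau> = 0" for \<rho>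
      using Suc.prems(1,2) i k(1) later[OF i] by (intro D.ordered_weight_eq_0[of _ _ k]) auto
    then show ?thesis by simp
  qed
  have "(\<Sum>i\<in>I - {k}. ?g i) = 0" by (rule sum.neutral) (use zero in blast)
  then have "D.ordered_weight m (Suc n) I t ts \<sigma> \<tau> = ?g k"
    unfolding D.ordered_weight.simps sum.remove[OF Suc.prems(1) k(1)] by simp
  also have "\<dots> = exp ((t - ts k) * field_energy Lam twoS h \<sigma>) *
      (\<Sum>\<rho>\<in>configs Lam twoS. bridge_op ((fst (fst (m k)), snd (fst (m k))), snd (m k)) \<sigma> \<rho> *
          path_weight Lam twoS h (ts k) \<omega>' \<rho> \<tau>)"
    using Suc.prems(6)[OF k(1)] IH by simp
  also have "\<dots> = path_weight Lam twoS h t \<omega> \<sigma> \<tau>"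
    by (rule path_weight_last[OF good set_\<omega> latest finL Suc.prems(3), symmetric])
  finally show ?case .
qed

text \<open>The identity for \<open>F\<close> is known only on good realizations, which is almost
  everywhere; measurability of the integrand makes that sufficient for equality of the
  integrals.\<close>

lemma bridge_integral:
  fixes F :: "bridges \<Rightarrow> real" and B :: "cfg \<Rightarrow> cfg \<Rightarrow> real"
  assumes \<beta>: "0 < \<beta>" and m: "m \<in> {..<n} \<rightarrow>\<^sub>E E \<times> UNIV"
    and meas: "(\<lambda>ts. indicator ({..<n} \<rightarrow>\<^sub>E {0..<\<beta>}) ts *\<^sub>R F (bridge_list (fst \<circ> m) (snd \<circ> m) n
        ts)) \<in>
        borel_measurable (PiM {..<n} (\<lambda>_. lborel))"
    and F: "\<And>\<omega>. good_bridges Lam \<beta> \<omega> \<Longrightarrow>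
        (\<Sum>\<sigma>\<in>configs Lam twoS. \<Sum>\<tau>\<in>configs Lam twoS. B \<sigma> \<tau> * path_weight Lam twoS h \<beta> \<omega> \<tau> \<sigma>) = F \<omega>"
  shows "(LINT ts : ({..<n} \<rightarrow>\<^sub>E {0..<\<beta>}) | PiM {..<n} (\<lambda>_. lborel). F (bridge_list (fst \<circ> m) (snd
      \<circ> m) n ts)) =
    (\<Sum>\<sigma>\<in>configs Lam twoS. \<Sum>\<tau>\<in>configs Lam twoS. B \<sigma> \<tau> *
      (\<integral>ts. D.ordered_weight m n {..<n} \<beta> ts \<tau> \<sigma> \<partial>PiM {..<n} (\<lambda>_. lborel)))"
proof -
  let ?M = "PiM {..<n} (\<lambda>_. lborel :: real measure)" and ?I = "{..<n}"
  let ?C = "configs Lam twoS" and ?\<Omega> = "{..<n} \<rightarrow>\<^sub>E {0..<\<beta>}"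
  let ?ow = "\<lambda>ts \<tau> \<sigma>. D.ordered_weight m n ?I \<beta> ts \<tau> \<sigma>"
  have int: "integrable ?M (\<lambda>ts. ?ow ts \<tau> \<sigma>)" for \<tau> \<sigma>
    using D.ordered_weight_integral(1)[of ?I m \<beta>] m \<beta> by simp
  have "(LINT ts : ?\<Omega> | ?M. F (bridge_list (fst \<circ> m) (snd \<circ> m) n ts)) =
      (\<integral>ts. (\<Sum>\<sigma>\<in>?C. \<Sum>\<tau>\<in>?C. B \<sigma> \<tau> * ?ow ts \<tau> \<sigma>) \<partial>?M)"
    unfolding set_lebesgue_integral_def
  proof (rule integral_cong_AE[OF meas])
    show "(\<lambda>ts. \<Sum>\<sigma>\<in>?C. \<Sum>\<tau>\<in>?C. B \<sigma> \<tau> * ?ow ts \<tau> \<sigma>) \<in> borel_measurable ?M"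
      using D.ordered_weight_measurable_PiM[of m n ?I \<beta>] by (intro borel_measurable_sum
          borel_measurable_times) auto
    show "AE ts in ?M. indicator ?\<Omega> ts *\<^sub>R F (bridge_list (fst \<circ> m) (snd \<circ> m) n ts) =
        (\<Sum>\<sigma>\<in>?C. \<Sum>\<tau>\<in>?C. B \<sigma> \<tau> * ?ow ts \<tau> \<sigma>)"
      using AE_PiM_lborel_distinct[OF finite_lessThan[of n]] AE_space
    proof eventually_elim
      case (elim ts)
      show ?case
      proof (cases "ts \<in> ?\<Omega>")
        case True
        let ?\<omega> = "bridge_list (fst \<circ> m) (snd \<circ> m) n ts"
        have rng: "0 < ts i \<and> ts i < \<beta>" if "i \<in> ?I" for i
          using PiE_mem[OF True that] elim that by (force simp: order_less_le)
        have mE: "fst (m i) \<in> E" if "i \<in> ?I" for i using PiE_mem[OF m that] by auto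
        have set\<omega>: "set ?\<omega> = (\<lambda>i. (fst (fst (m i)), snd (fst (m i)), ts i, snd (m i))) ` ?I"
          by (simp add: bridge_list_def lessThan_atLeast0)
        have good: "good_bridges Lam \<beta> ?\<omega>"
          using elim rng mE by (intro good_bridges_image[OF set\<omega> _ \<beta>]) auto
        have "?ow ts \<tau> \<sigma> = path_weight Lam twoS h \<beta> ?\<omega> \<tau> \<sigma>" if "\<tau> \<in> ?C" for \<tau> \<sigma>
          using that elim rng mE set\<omega> \<beta> by (intro ordered_weight_eq_path_weight) auto
        then have "(\<Sum>\<sigma>\<in>?C. \<Sum>\<tau>\<in>?C. B \<sigma> \<tau> * ?ow ts \<tau> \<sigma>) = F ?\<omega>"
          unfolding F[OF good, symmetric] by simp
        then show ?thesis using True by simp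
      next
        \<comment> \<open>Outside the cube the set integral is cut off by its indicator, and the
          weights vanish on their own because some bridge lies outside the interval.\<close>
        case False
        have "ts \<in> extensional ?I" using elim by (auto simp: space_PiM PiE_def)
        then obtain j where "j \<in> ?I" "ts j \<notin> {0..<\<beta>}" using False by (auto simp: PiE_iff)
        then have "?ow ts \<tau> \<sigma> = 0" for \<tau> \<sigma> by (intro D.ordered_weight_eq_0) auto
        then show ?thesis using False by simp
      qed
    qed
  qed
  also have "\<dots> = (\<Sum>\<sigma>\<in>?C. \<Sum>\<tau>\<in>?C. B \<sigma> \<tau> * (\<integral>ts. ?ow ts \<tau> \<sigma> \<partial>?M))"
    using int by (simp add: Bochner_Integration.integral_sum)
  finally show ?thesis .
qed

text \<open>\<open>rho_int\<close> sums over edges and types separately, the Dyson expansion over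
  marks; pairing pointwise matches the two.\<close>

lemma sum_marks:
  "(\<Sum>es\<in>I \<rightarrow>\<^sub>E E. \<Sum>cs\<in>I \<rightarrow>\<^sub>E (UNIV :: bool set). \<Phi> es cs) =
   (\<Sum>m\<in>I \<rightarrow>\<^sub>E E \<times> UNIV. \<Phi> (\<lambda>i\<in>I. fst (m i)) (\<lambda>i\<in>I. snd (m i)))"
  unfolding sum.cartesian_product
proof (rule sum.reindex_bij_witness[of _ "\<lambda>m. (\<lambda>i\<in>I. fst (m i), \<lambda>i\<in>I. snd (m i))" "\<lambda>(es,
    cs). \<lambda>i\<in>I. (es i, cs i)"])
  fix a assume a: "a \<in> (I \<rightarrow>\<^sub>E E) \<times> (I \<rightarrow>\<^sub>E (UNIV :: bool set))"
  obtain es cs where eq: "a = (es, cs)" by (cases a)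
  have e: "es \<in> I \<rightarrow>\<^sub>E E" and c: "cs \<in> I \<rightarrow>\<^sub>E UNIV" using a eq by auto
  have 1: "(\<lambda>i\<in>I. fst ((\<lambda>i\<in>I. (es i, cs i)) i)) = es" and 2: "(\<lambda>i\<in>I. snd ((\<lambda>i\<in>I. (es i,
      cs i)) i)) = cs"
    using PiE_arb[OF e] PiE_arb[OF c] by (auto intro!: ext simp: restrict_def)
  show "(\<lambda>m. (\<lambda>i\<in>I. fst (m i), \<lambda>i\<in>I. snd (m i))) ((\<lambda>(es, cs). \<lambda>i\<in>I. (es i, cs i)) a) = a"
    unfolding eq prod.case 1 2 ..
  show "(\<lambda>(es, cs). \<lambda>i\<in>I. (es i, cs i)) a \<in> I \<rightarrow>\<^sub>E E \<times> UNIV"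
    unfolding eq prod.case using PiE_mem[OF e] by auto
  show "\<Phi> (\<lambda>i\<in>I. fst ((case a of (es, cs) \<Rightarrow> \<lambda>i\<in>I. (es i, cs i)) i)) (\<lambda>i\<in>I. snd ((case a of (es,
      cs) \<Rightarrow> \<lambda>i\<in>I. (es i, cs i)) i)) =
     (case a of (es, cs) \<Rightarrow> \<Phi> es cs)"
    unfolding eq prod.case 1 2 ..
next
  fix m assume m: "m \<in> I \<rightarrow>\<^sub>E E \<times> (UNIV :: bool set)"
  show "(\<lambda>(es, cs). \<lambda>i\<in>I. (es i, cs i)) (\<lambda>i\<in>I. fst (m i), \<lambda>i\<in>I. snd (m i)) = m"
    unfolding prod.case
  proof (rule ext)
    fix i show "(\<lambda>i\<in>I. ((\<lambda>i\<in>I. fst (m i)) i, (\<lambda>i\<in>I. snd (m i)) i)) i = m i"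
      using PiE_arb[OF m, of i] by (cases "i \<in> I") auto
  qed
  show "(\<lambda>i\<in>I. fst (m i), \<lambda>i\<in>I. snd (m i)) \<in> (I \<rightarrow>\<^sub>E E) \<times> (I \<rightarrow>\<^sub>E (UNIV :: bool set))"
    using PiE_mem[OF m] by (auto simp: mem_Times_iff)
qed

text \<open>The 1/n! of the Poisson law cancels the n! orderings of unordered bridges, which leaves
  the Dyson series term by term.\<close>

lemma rho_int_dyson:
  fixes F :: "bridges \<Rightarrow> real" and B :: "cfg \<Rightarrow> cfg \<Rightarrow> real" and G :: "real \<Rightarrow> cfg \<Rightarrow> cfg \<Rightarrow> real"
  assumes \<beta>: "0 < \<beta>"
    and meas: "\<And>es cs n. (\<lambda>ts. indicator ({..<n} \<rightarrow>\<^sub>E {0..<\<beta>}) ts *\<^sub>R F (bridge_list es cs n ts)) \<in>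
        borel_measurable (PiM {..<n} (\<lambda>_. lborel))"
    and F: "\<And>\<omega>. good_bridges Lam \<beta> \<omega> \<Longrightarrow>
        (\<Sum>\<sigma>\<in>configs Lam twoS. \<Sum>\<tau>\<in>configs Lam twoS. B \<sigma> \<tau> * path_weight Lam twoS h \<beta> \<omega> \<tau> \<sigma>) = F \<omega>"
    and G: "\<And>\<sigma> \<tau>. \<sigma> \<in> configs Lam twoS \<Longrightarrow> (\<lambda>n. D.dyson_term n \<beta> \<sigma> \<tau>) sums G \<beta> \<sigma> \<tau>"
  shows "rho_int E \<beta> u F = exp (- real (card E) * \<beta>) *
    (\<Sum>\<sigma>\<in>configs Lam twoS. \<Sum>\<tau>\<in>configs Lam twoS. B \<sigma> \<tau> * G \<beta> \<tau> \<sigma>)"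
proof -
  let ?C = "configs Lam twoS"
  have nth_term: "(1 / fact n) * (\<Sum>es\<in>{..<n} \<rightarrow>\<^sub>E E. \<Sum>cs\<in>{..<n} \<rightarrow>\<^sub>E (UNIV :: bool set).
          (\<Prod>i<n. if cs i then u else 1 - u) *
          (LINT ts : ({..<n} \<rightarrow>\<^sub>E {0..<\<beta>}) | PiM {..<n} (\<lambda>_. lborel).
             F (map (\<lambda>i. (fst (es i), snd (es i), ts i, cs i)) [0..<n]))) =
      (\<Sum>\<sigma>\<in>?C. \<Sum>\<tau>\<in>?C. B \<sigma> \<tau> * D.dyson_term n \<beta> \<tau> \<sigma>)" for n
  proof -
    let ?I = "{..<n}"
    let ?J = "\<lambda>m \<tau> \<sigma>. \<integral>ts. D.ordered_weight m n ?I \<beta> ts \<tau> \<sigma> \<partial>PiM ?I (\<lambda>_. lborel)"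
    let ?W = "\<lambda>m. \<Prod>i<n. if snd (m i) then u else 1 - u"
    have "(\<Sum>es\<in>?I \<rightarrow>\<^sub>E E. \<Sum>cs\<in>?I \<rightarrow>\<^sub>E (UNIV :: bool set).
          (\<Prod>i<n. if cs i then u else 1 - u) *
          (LINT ts : (?I \<rightarrow>\<^sub>E {0..<\<beta>}) | PiM ?I (\<lambda>_. lborel).
             F (map (\<lambda>i. (fst (es i), snd (es i), ts i, cs i)) [0..<n]))) =
       (\<Sum>m\<in>?I \<rightarrow>\<^sub>E E \<times> UNIV. ?W m *
          (LINT ts : (?I \<rightarrow>\<^sub>E {0..<\<beta>}) | PiM ?I (\<lambda>_. lborel). F (bridge_list (fst \<circ> m) (snd \<circ> m) n
              ts)))"
      unfolding sum_marks
    proof (rule sum.cong[OF refl])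
      fix m :: "nat \<Rightarrow> (site \<times> site) \<times> bool"
      have "map (\<lambda>i. (fst ((\<lambda>i\<in>?I. fst (m i)) i), snd ((\<lambda>i\<in>?I. fst (m i)) i), ts i,
          (\<lambda>i\<in>?I. snd (m i)) i)) [0..<n] =
          bridge_list (fst \<circ> m) (snd \<circ> m) n ts" for ts
        unfolding bridge_list_def by (rule map_cong) auto
      moreover have "(\<Prod>i<n. if (\<lambda>i\<in>?I. snd (m i)) i then u else 1 - u) = ?W m"
        by (intro prod.cong) auto
      ultimately show "(\<Prod>i<n. if (\<lambda>i\<in>?I. snd (m i)) i then u else 1 - u) *
          (LINT ts : (?I \<rightarrow>\<^sub>E {0..<\<beta>}) | PiM ?I (\<lambda>_. lborel).
             F (map (\<lambda>i. (fst ((\<lambda>i\<in>?I. fst (m i)) i), snd ((\<lambda>i\<in>?I. fst (m i)) i), ts i,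
                 (\<lambda>i\<in>?I. snd (m i)) i)) [0..<n])) =
          ?W m * (LINT ts : (?I \<rightarrow>\<^sub>E {0..<\<beta>}) | PiM ?I (\<lambda>_. lborel). F (bridge_list (fst \<circ> m) (snd
              \<circ> m) n ts))"
        by (simp only:)
    qed
    also have "\<dots> = (\<Sum>m\<in>?I \<rightarrow>\<^sub>E E \<times> UNIV. ?W m * (\<Sum>\<sigma>\<in>?C. \<Sum>\<tau>\<in>?C. B \<sigma> \<tau> * ?J m \<tau> \<sigma>))"
      using bridge_integral[OF \<beta> _ meas F] by (intro sum.cong refl) simp
    also have "\<dots> = (\<Sum>\<sigma>\<in>?C. \<Sum>\<tau>\<in>?C. B \<sigma> \<tau> * (\<Sum>m\<in>?I \<rightarrow>\<^sub>E E \<times> UNIV. ?W m * ?J m \<tau> \<sigma>))"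
    proof -
      have "(\<Sum>m\<in>?I \<rightarrow>\<^sub>E E \<times> UNIV. ?W m * (\<Sum>\<sigma>\<in>?C. \<Sum>\<tau>\<in>?C. B \<sigma> \<tau> * ?J m \<tau> \<sigma>)) =
          (\<Sum>m\<in>?I \<rightarrow>\<^sub>E E \<times> UNIV. \<Sum>\<sigma>\<in>?C. \<Sum>\<tau>\<in>?C. B \<sigma> \<tau> * (?W m * ?J m \<tau> \<sigma>))"
        by (simp add: sum_distrib_left mult_ac)
      also have "\<dots> = (\<Sum>\<sigma>\<in>?C. \<Sum>m\<in>?I \<rightarrow>\<^sub>E E \<times> UNIV. \<Sum>\<tau>\<in>?C. B \<sigma> \<tau> * (?W m * ?J m \<tau> \<sigma>))"
        by (rule sum.swap)
      also have "\<dots> = (\<Sum>\<sigma>\<in>?C. \<Sum>\<tau>\<in>?C. \<Sum>m\<in>?I \<rightarrow>\<^sub>E E \<times> UNIV. B \<sigma> \<tau> * (?W m * ?J m \<tau> \<sigma>))"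
        by (intro sum.cong refl sum.swap)
      finally show ?thesis by (simp only: sum_distrib_left)
    qed
    also have "\<dots> = (\<Sum>\<sigma>\<in>?C. \<Sum>\<tau>\<in>?C. B \<sigma> \<tau> * (fact n * D.dyson_term n \<beta> \<tau> \<sigma>))"
      using D.sum_ordered_weight_integral[of ?I \<beta>] \<beta> by simp
    finally show ?thesis by (simp add: sum_distrib_left)
  qed
  have "(\<lambda>n. \<Sum>\<sigma>\<in>?C. \<Sum>\<tau>\<in>?C. B \<sigma> \<tau> * D.dyson_term n \<beta> \<tau> \<sigma>) sums (\<Sum>\<sigma>\<in>?C. \<Sum>\<tau>\<in>?C. B \<sigma> \<tau> * G \<beta> \<tau> \<sigma>)"
    by (intro sums_sum sums_mult G)
  then show ?thesis unfolding rho_int_def nth_term by (simp add: sums_iff)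
qed

text \<open>This is minus the Hamiltonian. The constant \<open>- real (card E)\<close> collects the
  summands -1 of the edges.\<close>

definition ham_mat :: "cfg \<Rightarrow> cfg \<Rightarrow> real" where
  "ham_mat \<sigma> \<rho> = D.A_tot \<sigma> \<rho> + (if \<sigma> = \<rho> then field_energy Lam twoS h \<sigma> - real (card E) else 0)"

text \<open>\<open>B\<close> is the observable at the seam: the identity for the partition function,
  the S^1 pair for the correlation. The Poisson normalization is absorbed by the constant in
  \<open>ham_mat\<close>.\<close>

lemma rho_int_mexp:
  fixes F :: "bridges \<Rightarrow> real" and B :: "cfg \<Rightarrow> cfg \<Rightarrow> real"
  assumes \<beta>: "0 < \<beta>"
    and meas: "\<And>es cs n. (\<lambda>ts. indicator ({..<n} \<rightarrow>\<^sub>E {0..<\<beta>}) ts *\<^sub>R F (bridge_list es cs n ts)) \<in>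
        borel_measurable (PiM {..<n} (\<lambda>_. lborel))"
    and F: "\<And>\<omega>. good_bridges Lam \<beta> \<omega> \<Longrightarrow>
        (\<Sum>\<sigma>\<in>configs Lam twoS. \<Sum>\<tau>\<in>configs Lam twoS. B \<sigma> \<tau> * path_weight Lam twoS h \<beta> \<omega> \<tau> \<sigma>) = F \<omega>"
  shows "rho_int E \<beta> u F = (\<Sum>\<sigma>\<in>configs Lam twoS. \<Sum>\<tau>\<in>configs Lam twoS. B \<sigma> \<tau> *
      mexp (configs Lam twoS) ham_mat \<beta> \<tau> \<sigma>)"
proof -
  let ?C = "configs Lam twoS" and ?b = "field_energy Lam twoS h"
  \<comment> \<open>The exponential factor removes the constant \<open>- real (card E)\<close> from
    the generator, so that \<open>G\<close> solves the equation required by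
    \<open>dyson_sums\<close>.\<close>
  define G where "G t \<sigma> \<tau> = exp (real (card E) * t) * mexp ?C ham_mat t \<sigma> \<tau>" for t \<sigma> \<tau>
  note finC = finite_configs[OF finL, of twoS]
  have deriv: "((\<lambda>t. G t \<sigma> \<tau>) has_real_derivative (?b \<sigma> * G t \<sigma> \<tau> + (\<Sum>\<rho>\<in>?C. D.A_tot \<sigma> \<rho> *
      G t \<rho> \<tau>))) (at t)"
    if \<sigma>: "\<sigma> \<in> ?C" for t \<sigma> \<tau>
  proof -
    have "(\<Sum>\<rho>\<in>?C. ham_mat \<sigma> \<rho> * mexp ?C ham_mat t \<rho> \<tau>) =
        (\<Sum>\<rho>\<in>?C. D.A_tot \<sigma> \<rho> * mexp ?C ham_mat t \<rho> \<tau> + (if \<sigma> = \<rho> then (?b \<sigma> - real (card E)) *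
            mexp ?C ham_mat t \<rho> \<tau> else 0))"
      by (intro sum.cong refl) (simp add: ham_mat_def distrib_right)
    also have "\<dots> = (\<Sum>\<rho>\<in>?C. D.A_tot \<sigma> \<rho> * mexp ?C ham_mat t \<rho> \<tau>) + (?b \<sigma> - real (card E)) *
        mexp ?C ham_mat t \<sigma> \<tau>"
      using \<sigma> finC by (simp add: sum.distrib)
    finally have R: "(\<Sum>\<rho>\<in>?C. ham_mat \<sigma> \<rho> * mexp ?C ham_mat t \<rho> \<tau>) =
        (\<Sum>\<rho>\<in>?C. D.A_tot \<sigma> \<rho> * mexp ?C ham_mat t \<rho> \<tau>) + (?b \<sigma> - real (card E)) *
            mexp ?C ham_mat t \<sigma> \<tau>" .
    have "((\<lambda>t. G t \<sigma> \<tau>) has_real_derivative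
        (real (card E) * exp (real (card E) * t) * mexp ?C ham_mat t \<sigma> \<tau> +
         exp (real (card E) * t) * (\<Sum>\<rho>\<in>?C. ham_mat \<sigma> \<rho> * mexp ?C ham_mat t \<rho> \<tau>))) (at t)"
      unfolding G_def
      by (rule derivative_eq_intros has_real_derivative_mexp[OF finC \<sigma>] refl | simp)+
    also have "real (card E) * exp (real (card E) * t) * mexp ?C ham_mat t \<sigma> \<tau> +
         exp (real (card E) * t) * (\<Sum>\<rho>\<in>?C. ham_mat \<sigma> \<rho> * mexp ?C ham_mat t \<rho> \<tau>) =
       ?b \<sigma> * G t \<sigma> \<tau> + (\<Sum>\<rho>\<in>?C. D.A_tot \<sigma> \<rho> * G t \<rho> \<tau>)"
      unfolding R G_def by (simp add: algebra_simps sum_distrib_left)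
    finally show ?thesis .
  qed
  have sums: "(\<lambda>n. D.dyson_term n \<beta> \<sigma> \<tau>) sums G \<beta> \<sigma> \<tau>" if "\<sigma> \<in> ?C" for \<sigma> \<tau>
    using \<beta> that by (intro D.dyson_sums[of "\<lambda>t \<sigma>. G t \<sigma> \<tau>"] deriv) (auto simp: G_def)
  have "rho_int E \<beta> u F = exp (- real (card E) * \<beta>) * (\<Sum>\<sigma>\<in>?C. \<Sum>\<tau>\<in>?C. B \<sigma> \<tau> * G \<beta> \<tau> \<sigma>)"
    by (rule rho_int_dyson[OF \<beta>, where G = G]) (use meas F sums in blast)+
  also have "\<dots> = (\<Sum>\<sigma>\<in>?C. \<Sum>\<tau>\<in>?C. B \<sigma> \<tau> * (exp (- real (card E) * \<beta>) * exp (real (card E) * \<beta>) *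
      mexp ?C ham_mat \<beta> \<tau> \<sigma>))"
    by (simp add: sum_distrib_left G_def mult_ac)
  also have "exp (- real (card E) * \<beta>) * exp (real (card E) * \<beta>) = 1"
    by (simp add: exp_add[symmetric])
  finally show ?thesis by simp
qed

lemma ham_mat_sum:
  "ham_mat \<sigma> \<rho> = (\<Sum>e\<in>E. u * bridge_op (e, True) \<sigma> \<rho> + (1 - u) * bridge_op (e, False) \<sigma> \<rho> - (if \<sigma> =
      \<rho> then 1 else 0)) +
    (\<Sum>x\<in>Lam. h x * (if \<sigma> = \<rho> then spinval twoS (\<sigma> x) else 0))"
proof -
  have "D.A_tot \<sigma> \<rho> = (\<Sum>e\<in>E. \<Sum>c\<in>UNIV. (if c then u else 1 - u) * bridge_op (e, c) \<sigma> \<rho>)"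
    unfolding D.A_tot_def sum.cartesian_product by (intro sum.cong) auto
  also have "\<dots> = (\<Sum>e\<in>E. u * bridge_op (e, True) \<sigma> \<rho> + (1 - u) * bridge_op (e, False) \<sigma> \<rho>)"
    by (simp add: UNIV_bool add.commute)
  finally show ?thesis
    unfolding ham_mat_def field_energy_def by (simp add: sum_subtractf)
qed

end

section \<open>Identification with the Gibbs operator\<close>

lemma Tswap_bridge_op: "Tswap x y \<sigma> \<tau> = complex_of_real (bridge_op ((x, y), True) \<sigma> \<tau>)"
  unfolding Tswap_def bridge_op_def by (simp; blast)

lemma Qop_bridge_op: "Qop x y \<sigma> \<tau> = complex_of_real (bridge_op ((x, y), False) \<sigma> \<tau>)"
  unfolding Qop_def bridge_op_def by (simp; blast)

lemma gibbs_mexp: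
  assumes "0 \<le> u" "u \<le> 1" "\<sigma> \<in> configs (lattice d L) twoS"
  shows "gibbs d L twoS u \<beta> h \<sigma> \<tau> =
    complex_of_real (mexp (configs (lattice d L) twoS) (ham_mat (lattice d L) (nn_edges d L) twoS
        h u) \<beta> \<sigma> \<tau>)"
proof -
  have "(\<lambda>\<sigma> \<tau>. - complex_of_real \<beta> * hamiltonian d L twoS u h \<sigma> \<tau>) =
      (\<lambda>\<sigma> \<tau>. complex_of_real (\<beta> * ham_mat (lattice d L) (nn_edges d L) twoS h u \<sigma> \<tau>))"
  proof (intro ext)
    fix \<sigma> \<tau> :: cfg
    have edges: "(\<Sum>(x, y)\<in>nn_edges d L. complex_of_real u * Tswap x y \<sigma> \<tau> + complex_of_real (1 -
        u) * Qop x y \<sigma> \<tau> - op_id \<sigma> \<tau>) =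
       complex_of_real (\<Sum>e\<in>nn_edges d L. u * bridge_op (e, True) \<sigma> \<tau> + (1 - u) * bridge_op (e,
           False) \<sigma> \<tau> - (if \<sigma> = \<tau> then 1 else 0))"
      unfolding of_real_sum by (rule sum.cong[OF refl]) (auto simp: Tswap_bridge_op Qop_bridge_op
          op_id_def)
    have field: "(\<Sum>x\<in>lattice d L. complex_of_real (h x) * S3 twoS x \<sigma> \<tau>) =
       complex_of_real (\<Sum>x\<in>lattice d L. h x * (if \<sigma> = \<tau> then spinval twoS (\<sigma> x) else 0))"
      unfolding of_real_sum by (rule sum.cong[OF refl]) (simp add: S3_def)
    have ham: "ham_mat (lattice d L) (nn_edges d L) twoS h u \<sigma> \<tau> =
       (\<Sum>e\<in>nn_edges d L. u * bridge_op (e, True) \<sigma> \<tau> + (1 - u) * bridge_op (e, False) \<sigma> \<tau> -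
           (if \<sigma> = \<tau> then 1 else 0)) +
       (\<Sum>x\<in>lattice d L. h x * (if \<sigma> = \<tau> then spinval twoS (\<sigma> x) else 0))"
      by (rule ham_mat_sum[OF finite_lattice finite_nn_edges nn_edges_in_lattice assms(1,2)])
    show "- complex_of_real \<beta> * hamiltonian d L twoS u h \<sigma> \<tau> =
        complex_of_real (\<beta> * ham_mat (lattice d L) (nn_edges d L) twoS h u \<sigma> \<tau>)"
      unfolding hamiltonian_def edges field ham of_real_add of_real_mult by algebra
  qed
  then show ?thesis
    unfolding gibbs_def using op_exp_of_real[OF finite_configs[OF finite_lattice] assms(3)] by simp
qed

lemma origin_in_lattice: "origin \<in> lattice d L"
  by (simp add: origin_def lattice_def)

theorem theorem2p1:
  fixes d L twoS :: nat and u \<beta> :: real and h :: "site \<Rightarrow> real"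
  assumes "d \<ge> 1" and "twoS \<ge> 1" and "0 \<le> u" and "u \<le> 1" and "\<beta> > 0" and "even L"
    and "\<forall>x\<in>lattice d L. h x \<ge> 0"
  shows "Zpart d L twoS u \<beta> h =
           complex_of_real (rho_int (nn_edges d L) \<beta> u
             (\<lambda>\<omega>. \<Prod>\<gamma>\<in>loops (lattice d L) \<beta> \<omega>. zact twoS \<beta> \<omega> h \<gamma>)) \<and>
         (\<forall>x\<in>lattice d L. x \<noteq> origin \<longrightarrow>
           expval d L twoS u \<beta> h (op_mult (configs (lattice d L) twoS) (S1 twoS origin) (S1 twoS x)) =
           complex_of_real (rho_int (nn_edges d L) \<beta> u
             (\<lambda>\<omega>. (if connected0 (lattice d L) \<beta> \<omega> x then 1 else 0) *
                  ztilde twoS (lattice d L) \<beta> \<omega> h x *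
                  (\<Prod>\<gamma>\<in>loops (lattice d L) \<beta> \<omega> - {loop0x (lattice d L) \<beta> \<omega>}. zact twoS \<beta> \<omega> h \<gamma>)))
           / Zpart d L twoS u \<beta> h)"
proof (intro conjI ballI impI)
  let ?\<Lambda> = "lattice d L" and ?E = "nn_edges d L"
  let ?C = "configs ?\<Lambda> twoS"
  let ?G = "mexp ?C (ham_mat ?\<Lambda> ?E twoS h u) \<beta>"
  note finL = finite_lattice[of d L]
  note ctx = finL finite_nn_edges[of d L] nn_edges_in_lattice assms(3,4) assms(5)
  have finC: "finite ?C" by (rule finite_configs[OF finL])
  have gibbs: "gibbs d L twoS u \<beta> h \<sigma> \<tau> = complex_of_real (?G \<sigma> \<tau>)" if "\<sigma> \<in> ?C" for \<sigma> \<tau>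
    using gibbs_mexp[OF assms(3,4) that] .
  \<comment> \<open>Seam observable: the identity matrix.\<close>
  have "rho_int ?E \<beta> u (\<lambda>\<omega>. \<Prod>\<gamma>\<in>loops ?\<Lambda> \<beta> \<omega>. zact twoS \<beta> \<omega> h \<gamma>) =
      (\<Sum>\<sigma>\<in>?C. \<Sum>\<tau>\<in>?C. (if \<sigma> = \<tau> then 1 else 0) * ?G \<tau> \<sigma>)"
    by (rule rho_int_mexp[OF ctx loops_integrand_measurable[OF assms(5)] trace_loops[OF _ finL]])
  also have "\<dots> = (\<Sum>\<sigma>\<in>?C. \<Sum>\<tau>\<in>?C. if \<sigma> = \<tau> then ?G \<tau> \<sigma> else 0)"
    by (intro sum.cong refl) simp
  also have "\<dots> = (\<Sum>\<sigma>\<in>?C. ?G \<sigma> \<sigma>)"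
    using finC by (intro sum.cong refl) simp
  finally show "Zpart d L twoS u \<beta> h =
      complex_of_real (rho_int ?E \<beta> u (\<lambda>\<omega>. \<Prod>\<gamma>\<in>loops ?\<Lambda> \<beta> \<omega>. zact twoS \<beta> \<omega> h \<gamma>))"
    unfolding Zpart_def op_trace_def by (simp add: gibbs)
  fix x assume x: "x \<in> ?\<Lambda>" "x \<noteq> origin"
  \<comment> \<open>Seam observable: the product of the two S^1 operators. The partition function is
    a common denominator and is carried along unchanged.\<close>
  have "rho_int ?E \<beta> u (\<lambda>\<omega>. (if connected0 ?\<Lambda> \<beta> \<omega> x then 1 else 0) * ztilde twoS ?\<Lambda> \<beta> \<omega> h x *
        (\<Prod>\<gamma>\<in>loops ?\<Lambda> \<beta> \<omega> - {loop0x ?\<Lambda> \<beta> \<omega>}. zact twoS \<beta> \<omega> h \<gamma>)) =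
      (\<Sum>\<sigma>\<in>?C. \<Sum>\<tau>\<in>?C. s1_pair twoS x \<sigma> \<tau> * ?G \<tau> \<sigma>)"
    by (rule rho_int_mexp[OF ctx two_point_integrand_measurable[OF assms(5) origin_in_lattice x(1)]
          trace_two_point[OF _ finL origin_in_lattice x]])
  then have "complex_of_real (rho_int ?E \<beta> u (\<lambda>\<omega>. (if connected0 ?\<Lambda> \<beta> \<omega> x then 1 else 0) *
      ztilde twoS ?\<Lambda> \<beta> \<omega> h x *
        (\<Prod>\<gamma>\<in>loops ?\<Lambda> \<beta> \<omega> - {loop0x ?\<Lambda> \<beta> \<omega>}. zact twoS \<beta> \<omega> h \<gamma>))) =
      (\<Sum>\<sigma>\<in>?C. \<Sum>\<tau>\<in>?C. complex_of_real (s1_pair twoS x \<sigma> \<tau>) * complex_of_real (?G \<tau> \<sigma>))"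
    by simp
  \<comment> \<open>The Gibbs entry carries its arguments in the order top, bottom, as the second
    factor in the trace of a product demands.\<close>
  also have "\<dots> = op_trace ?C (op_mult ?C (op_mult ?C (S1 twoS origin) (S1 twoS x)) (gibbs d L twoS
      u \<beta> h))"
    unfolding op_trace_def op_mult_def[of ?C "op_mult ?C (S1 twoS origin) (S1 twoS x)"]
    using op_mult_S1[OF origin_in_lattice x(2) finL] gibbs by (intro sum.cong refl) simp
  finally show "expval d L twoS u \<beta> h (op_mult ?C (S1 twoS origin) (S1 twoS x)) =
      complex_of_real (rho_int ?E \<beta> u (\<lambda>\<omega>. (if connected0 ?\<Lambda> \<beta> \<omega> x then 1 else 0) *
          ztilde twoS ?\<Lambda> \<beta> \<omega> h x *
        (\<Prod>\<gamma>\<in>loops ?\<Lambda> \<beta> \<omega> - {loop0x ?\<Lambda> \<beta> \<omega>}. zact twoS \<beta> \<omega> h \<gamma>))) / Zpart d L twoS u \<beta> h"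
    unfolding expval_def by (simp only:)
qed

end
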